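(* Let $(U_\uparrow,U_\downarrow)\in\mathcal U^{(2)}$, let $\psi_{(U_\uparrow,U_\downarrow)}:\mathrm{QSym}\to\mathbb R$ be the corresponding character, and let $(\alpha,\beta)=\mathrm{rank}(U_\uparrow,U_\downarrow)\in\Delta^{(2)}$. Then under the projection $\partial\mathcal Z\to\partial\mathcal Y$ (restriction of characters from $\mathrm{QSym}$ to $\mathrm{Sym}$), $\psi_{(U_\uparrow,U_\downarrow)}$ is sent to $\psi_{\alpha,\beta}$; that is, $\psi_{(U_\uparrow,U_\downarrow)}|_{\mathrm{Sym}}=\psi_{\alpha,\beta}$.
   Context: $\mathcal U^{(2)}$ is the set of pairs $(U_\uparrow,U_\downarrow)$ of disjoint open subsets of $]0,1[$. $\Delta^{(2)}$ is the set of pairs $(\alpha,\beta)$ of sequences $\alpha_1\ge\alpha_2\ge\dots\ge0$, $\beta_1\ge\beta_2\ge\dots\ge0$ with $\sum_j(\alpha_j+\beta_j)\le1$. The map $\mathrm{rank}:\mathcal U^{(2)}\to\Delta^{(2)}$ sends $(U_\uparrow,U_\downarrow)$ to $(\alpha,\beta)$, where $\alpha$ (resp. $\beta$) lists the lengths of the interval components of $U_\uparrow$ (resp. $U_\downarrow$) in decreasing order, completed by zeros. $\mathrm{Sym}\subset\mathrm{QSym}$ are the $\mathbb R$-algebras of symmetric and quasisymmetric functions in $x_1,x_2,\dots$. For a composition $\lambda=(\lambda_1,\dots,\lambda_\ell)$, $M_\lambda=\sum_{i_1<\dots<i_\ell}x_{i_1}^{\lambda_1}\cdots x_{i_\ell}^{\lambda_\ell}$,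 and the fundamental quasisymmetric function $F_\lambda$ is the sum of $M_\mu$ over all compositions $\mu$ equal to $\lambda$ or refining $\lambda$; $F_\varnothing=1$. The $F_\lambda$ form a basis of $\mathrm{QSym}$. A character of $\mathrm{QSym}$ is a unital multiplicative linear functional $\psi:\mathrm{QSym}\to\mathbb R$ with $\psi(F_\lambda)\ge0$ and $\psi(F_\lambda F_{(1)})=\psi(F_\lambda)$ for all $\lambda$; characters of $\mathrm{Sym}$ are defined in the same way with Schur functions $S_\lambda$ in place of $F_\lambda$. The points of the boundary $\partial\mathcal Z$ (resp. $\partial\mathcal Y$) of the graph of zigzag diagrams (resp. Young's lattice) are identified with the characters of $\mathrm{QSym}$ (resp. $\mathrm{Sym}$). Character $\psi_{(U_\uparrow,U_\downarrow)}$. Let $\xi_1,\xi_2,\dots$ be i.i.d. uniform on $[0,1]$. For each $n$ let $\Pi_n$ be the random permutation of $[n]=\{1,\dots,n\}$, written as a word, in which $i$ is to the left of $j$ iff: $\xi_i,\xi_j$ do not lie in the same interval component of $U_\uparrow\cup U_\downarrow$ and $\xi_i<\xi_j$; or they lie in the same component of $U_\uparrow$ and $i<j$; or they lie in the same component of $U_\downarrow$ and $i>j$. For a permutation $\pi_n$ of $[n]$ let $\mathrm{zs}(\pi_n)$ be the composition of $n$ formed by the lengths of the successive maximal increasing runs of the word $\pi_n(1)\dots\pi_n(n)$. The probability $\mathbb P(\Pi_n=\pi_n)$ depends only on $\lambda=\mathrm{zs}(\pi_n)$, and $\psi_{(U_\uparrow,U_\downarrow)}$ is the linear functional with $\psi_{(U_\uparrow,U_\downarrow)}(F_\lambda)=\mathbb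 P(\Pi_n=\pi_n)$ for any $\pi_n$ with $\mathrm{zs}(\pi_n)=\lambda$, and with value $1$ at $F_\varnothing=1$; it is a character of $\mathrm{QSym}$. Character $\psi_{\alpha,\beta}$. Let $H(t)=1+\sum_{n\ge1}h_nt^n$ be the generating series of the complete homogeneous symmetric functions. $\psi_{\alpha,\beta}:\mathrm{Sym}\to\mathbb R$ is the algebra homomorphism determined by $$1+\sum_{n\ge1}\psi_{\alpha,\beta}(h_n)t^n=e^{\gamma t}\,\frac{\prod_{j\ge1}(1+\beta_jt)}{\prod_{i\ge1}(1-\alpha_it)},\qquad \gamma=1-\sum_i\alpha_i-\sum_j\beta_j .$$ *)

theory Defs
  imports
    "HOL-Probability.Probability"
    "HOL-Library.Poly_Mapping"
    "HOL-Combinatorics.Multiset_Permutations"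
begin

section \<open>Pairs of open sets and their ranks\<close>

definition U2 :: "(real set \<times> real set) set" where
  "U2 = {(U, V). open U \<and> open V \<and> U \<inter> V = {} \<and> U \<subseteq> {0<..<1} \<and> V \<subseteq> {0<..<1}}"

text \<open>Sequences are indexed from \<open>0\<close>, so \<open>\<alpha> 0\<close> is the first term.\<close>

definition Delta2 :: "((nat \<Rightarrow> real) \<times> (nat \<Rightarrow> real)) set" where
  "Delta2 = {(\<alpha>, \<beta>). decseq \<alpha> \<and> decseq \<beta> \<and> (\<forall>j. 0 \<le> \<alpha> j) \<and> (\<forall>j. 0 \<le> \<beta> j) \<and>
     summable (\<lambda>j. \<alpha> j + \<beta> j) \<and> suminf (\<lambda>j. \<alpha> j + \<beta> j) \<le> 1}"

text \<open>The nonzero terms of \<open>a\<close> are the lengths of the components of \<open>U\<close>, each component being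
  listed exactly once.\<close>

definition lists_lengths :: "real set \<Rightarrow> (nat \<Rightarrow> real) \<Rightarrow> bool" where
  "lists_lengths U a \<longleftrightarrow>
     (\<exists>C. bij_betw C {j. a j \<noteq> 0} (components U) \<and>
          (\<forall>j. a j \<noteq> 0 \<longrightarrow> a j = measure lborel (C j)))"

definition rank2 :: "real set \<times> real set \<Rightarrow> (nat \<Rightarrow> real) \<times> (nat \<Rightarrow> real)" where
  "rank2 = (\<lambda>(U, V). THE p. p \<in> Delta2 \<and> lists_lengths U (fst p) \<and> lists_lengths V (snd p))"


section \<open>Symmetric and quasisymmetric functions\<close>

text \<open>A formal power series in the variables \<open>x\<^sub>0, x\<^sub>1, \<dots>\<close> is the function giving the coefficient
  of each monomial; a monomial is its finitely supported exponent function.\<close>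

type_synonym monomial = "nat \<Rightarrow>\<^sub>0 nat"
type_synonym series = "monomial \<Rightarrow> real"

definition mdegree :: "monomial \<Rightarrow> nat" where
  "mdegree m = (\<Sum>i\<in>Poly_Mapping.keys m. Poly_Mapping.lookup m i)"

definition bounded_degree :: "series \<Rightarrow> bool" where
  "bounded_degree f \<longleftrightarrow> (\<exists>d. \<forall>m. f m \<noteq> 0 \<longrightarrow> mdegree m \<le> d)"

definition series_one :: series where
  "series_one = (\<lambda>m. if m = 0 then 1 else 0)"

definition series_mult :: "series \<Rightarrow> series \<Rightarrow> series" where
  "series_mult f g = (\<lambda>m. \<Sum>(a, b) | a + b = m. f a * g b)"

text \<open>\<open>exponents m\<close> is \<open>[a\<^sub>1, \<dots>, a\<^sub>k]\<close> when \<open>m\<close> is the monomial with exponents \<open>a\<^sub>1, \<dots>, a\<^sub>k > 0\<close> at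
  indices \<open>i\<^sub>1 < \<dots> < i\<^sub>k\<close>.\<close>

definition exponents :: "monomial \<Rightarrow> nat list" where
  "exponents m = map (Poly_Mapping.lookup m) (sorted_list_of_set (Poly_Mapping.keys m))"

definition QSym :: "series set" where
  "QSym = {f. bounded_degree f \<and> (\<forall>m m'. exponents m = exponents m' \<longrightarrow> f m = f m')}"

text \<open>For a bijection \<open>p\<close>, \<open>Poly_Mapping.map_key p m\<close> is \<open>m\<close> with exponents \<open>lookup m \<circ> p\<close>.\<close>

definition Sym :: "series set" where
  "Sym = {f. bounded_degree f \<and> (\<forall>p m. bij p \<longrightarrow> f (Poly_Mapping.map_key p m) = f m)}"

definition composition :: "nat list \<Rightarrow> bool" where
  "composition \<nu> \<longleftrightarrow> (\<forall>k\<in>set \<nu>. 0 < k)"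

definition refines :: "nat list \<Rightarrow> nat list \<Rightarrow> bool" where
  "refines \<mu> \<nu> \<longleftrightarrow> (\<exists>bs. concat bs = \<mu> \<and> map sum_list bs = \<nu>)"

definition monomial_qsym :: "nat list \<Rightarrow> series" where
  "monomial_qsym \<nu> = (\<lambda>m. if exponents m = \<nu> then 1 else 0)"

definition fundamental_qsym :: "nat list \<Rightarrow> series" where
  "fundamental_qsym \<nu> = (\<lambda>m. \<Sum>\<mu> | composition \<mu> \<and> refines \<mu> \<nu>. monomial_qsym \<mu> m)"

definition complete_sym :: "nat \<Rightarrow> series" where
  "complete_sym n = (\<lambda>m. if mdegree m = n then 1 else 0)"

definition linear_functional_on :: "series set \<Rightarrow> (series \<Rightarrow> real) \<Rightarrow> bool" where
  "linear_functional_on A \<psi> \<longleftrightarrow>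
     (\<forall>f\<in>A. \<forall>g\<in>A. \<psi> (\<lambda>m. f m + g m) = \<psi> f + \<psi> g) \<and>
     (\<forall>c. \<forall>f\<in>A. \<psi> (\<lambda>m. c * f m) = c * \<psi> f)"

definition algebra_hom_on :: "series set \<Rightarrow> (series \<Rightarrow> real) \<Rightarrow> bool" where
  "algebra_hom_on A \<psi> \<longleftrightarrow> linear_functional_on A \<psi> \<and> \<psi> series_one = 1 \<and>
     (\<forall>f\<in>A. \<forall>g\<in>A. \<psi> (series_mult f g) = \<psi> f * \<psi> g)"


section \<open>The functional on \<open>QSym\<close> attached to a pair of open sets\<close>

definition iid_uniform :: "(nat \<Rightarrow> real) measure" where
  "iid_uniform = PiM UNIV (\<lambda>_. uniform_measure lborel {0..1})"

definition left_of :: "real set \<Rightarrow> real set \<Rightarrow> (nat \<Rightarrow> real) \<Rightarrow> nat \<Rightarrow> nat \<Rightarrow> bool" where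
  "left_of U V \<xi> i j \<longleftrightarrow>
     (\<not> connected_component (U \<union> V) (\<xi> i) (\<xi> j) \<and> \<xi> i < \<xi> j) \<or>
     (connected_component U (\<xi> i) (\<xi> j) \<and> i < j) \<or>
     (connected_component V (\<xi> i) (\<xi> j) \<and> i > j)"

text \<open>A permutation of \<open>{1..n}\<close> is represented by its word. The event that the random
  permutation is \<open>w\<close> is that the relation \<open>left_of\<close> is the left-to-right order of \<open>w\<close>; almost
  surely this holds for exactly one \<open>w\<close>, the exception being ties \<open>\<xi> i = \<xi> j\<close> outside \<open>U \<union> V\<close>.\<close>

definition perm_prob :: "real set \<Rightarrow> real set \<Rightarrow> nat list \<Rightarrow> real" where
  "perm_prob U V w = measure iid_uniform
     {\<xi> \<in> space iid_uniform. \<forall>a < length w. \<forall>b < length w. left_of U V \<xi> (w ! a) (w ! b) \<longleftrightarrow> a < b}"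

text \<open>The lengths of the successive maximal increasing runs of a word.\<close>

fun zs :: "nat list \<Rightarrow> nat list" where
  "zs [] = []"
| "zs [x] = [1]"
| "zs (x # y # w) =
     (let r = zs (y # w) in if x < y then Suc (hd r) # tl r else 1 # r)"

text \<open>Functionals on \<open>QSym\<close> and \<open>Sym\<close> are taken extensional, so that functionals with the same
  values there are equal. The word \<open>[]\<close>, for \<open>n = 0\<close>, has probability \<open>1\<close>.\<close>

definition psi_open :: "real set \<times> real set \<Rightarrow> series \<Rightarrow> real" where
  "psi_open = (\<lambda>(U, V). THE \<psi>. \<psi> \<in> extensional QSym \<and> linear_functional_on QSym \<psi> \<and>
     (\<forall>n. \<forall>w \<in> permutations_of_set {1..n}. \<psi> (fundamental_qsym (zs w)) = perm_prob U V w))"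


section \<open>The homomorphism on \<open>Sym\<close> attached to a pair of sequences\<close>

definition psi_seq :: "(nat \<Rightarrow> real) \<times> (nat \<Rightarrow> real) \<Rightarrow> series \<Rightarrow> real" where
  "psi_seq = (\<lambda>(\<alpha>, \<beta>). THE \<psi>. \<psi> \<in> extensional Sym \<and> algebra_hom_on Sym \<psi> \<and>
     (\<lambda>t. exp ((1 - suminf \<alpha> - suminf \<beta>) * t) *
          prodinf (\<lambda>j. 1 + \<beta> j * t) / prodinf (\<lambda>i. 1 - \<alpha> i * t))
       has_fps_expansion Abs_fps (\<lambda>n. \<psi> (complete_sym n)))"

end

theory Submission
  imports Defs
begin

text \<open>
  Call a pair \<open>(x, y)\<close> a descent if its entries lie in one component of \<open>V\<close>, or in no common component
  and \<open>x < y\<close>. Put \<open>D x y = 1\<close> in this case and \<open>0\<close> otherwise, and let \<open>B x y\<close> be \<open>1\<close>, \<open>-1\<close> or \<open>0\<close> as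
  \<open>x\<close>, \<open>y\<close> share a component of \<open>U\<close>, of \<open>V\<close>, or none. An ascent is allowed with weight \<open>D + B\<close>.
  Expanding the probability of a word accordingly, the functional \<open>\<psi>\<close> of \<open>(U, V)\<close> takes on
  the monomial function \<open>M\<^sub>\<nu>\<close> the value \<open>\<Phi> \<nu>\<close>, an iterated integral of \<open>D\<close> against powers of
  \<open>s x = \<integral> B x y dy\<close>, the signed length of the component of \<open>x\<close>.

  The identity \<open>D y a * D y b = D y a * D a b + D y b * D b a + D y b * B a b\<close> gives
  \<open>\<psi> (p\<^sub>k M\<^sub>\<nu>) = \<psi> p\<^sub>k * \<psi> M\<^sub>\<nu>\<close> for the power sums \<open>p\<^sub>k = M\<^sub>(\<^sub>k\<^sub>)\<close>. As the power sums generate \<open>Sym\<close>, the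
  restriction of \<open>\<psi>\<close> to \<open>Sym\<close> is multiplicative and is determined by
  \<open>\<psi> p\<^sub>k = \<integral> s x ^ (k - 1) dx = \<Sum> \<alpha>\<^sub>j ^ k - \<Sum> (- \<beta>\<^sub>j) ^ k\<close> for \<open>k \<ge> 2\<close>. By Newton's identities the
  generating function of the \<open>\<psi> h\<^sub>n\<close> is the exponential of \<open>\<Sum> \<psi> p\<^sub>k * t ^ k / k\<close>, which is the
  required product.
\<close>

text \<open>Multiplication by a power sum inserts a single letter into a composition, whereas a
  product of two general monomial functions is a full quasi-shuffle. This is why products are
  examined only against \<open>p_k\<close>. It is also why the iterated integrals
  \<open>\<Phi>\<close> carry a base point y: once the inserted letter has passed an entry located
  at b, the same relation is needed again with base point b. At y = -1, to the left of [0,1], the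
  first kernel is 1 almost everywhere and the base point drops out.

  The splitting of the ascent weight mirrors the expansion of F in the functions M: D cuts a run
  after a letter, while B keeps its neighbour in the same block. A block of c letters then lies in
  one component and contributes \<open>s x ^ (c - 1)\<close>.

  The rank and both functionals in the statement are definite descriptions, so existence and
  uniqueness have to be established for each of them. Hence the unitriangular passage between F and
  M, the words realizing every composition, the decreasing enumeration of the components, and the
  recovery of power sums from the h_n.\<close>

abbreviation lk :: "monomial \<Rightarrow> nat \<Rightarrow> nat" where "lk \<equiv> Poly_Mapping.lookup"

section \<open>Monomials and their exponents\<close>

lemma mdegree_superset:
  assumes "finite K" "Poly_Mapping.keys m \<subseteq> K"
  shows "mdegree m = (\<Sum>i\<in>K. lk m i)"
  unfolding mdegree_def
  by (rule sum.mono_neutral_left) (use assms in \<open>auto simp: in_keys_iff\<close>)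

lemma mdegree_add: "mdegree (a + b) = mdegree a + mdegree b"
proof -
  let ?K = "Poly_Mapping.keys a \<union> Poly_Mapping.keys b"
  have "Poly_Mapping.keys (a + b) \<subseteq> ?K" by (rule Poly_Mapping.keys_add)
  then show ?thesis
    by (simp add: mdegree_superset[of ?K] lookup_add sum.distrib)
qed

lemma mdegree_single [simp]: "mdegree (Poly_Mapping.single i k) = k"
  by (cases "k = 0") (simp_all add: mdegree_def)

text \<open>Evaluates \<open>exponents\<close> on any increasing list of indices that contains the
  support, so that a monomial and its quotient by \<open>x_i^k\<close> can be read off from the same
  list.\<close>

lemma exponents_filter:
  assumes "sorted_wrt (<) L" "Poly_Mapping.keys m \<subseteq> set L"
  shows "exponents m = map (lk m) (filter (\<lambda>i. lk m i \<noteq> 0) L)"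
proof -
  have "sorted_list_of_set (Poly_Mapping.keys m) = filter (\<lambda>i. lk m i \<noteq> 0) L"
  proof (rule sorted_distinct_set_unique)
    show "sorted (filter (\<lambda>i. lk m i \<noteq> 0) L)" "distinct (filter (\<lambda>i. lk m i \<noteq> 0) L)"
      using assms(1) by (auto simp: strict_sorted_iff sorted_filter[of id, simplified])
    show "set (sorted_list_of_set (Poly_Mapping.keys m)) = set (filter (\<lambda>i. lk m i \<noteq> 0) L)"
      using assms(2) by (auto simp: in_keys_iff)
  qed auto
  then show ?thesis by (simp add: exponents_def)
qed

lemma mset_exponents:
  "mset (exponents m) = image_mset (lk m) (mset_set (Poly_Mapping.keys m))"
  by (simp add: exponents_def flip: mset_set_set)

lemma composition_exponents: "composition (exponents m)"
  by (auto simp: composition_def exponents_def in_keys_iff)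

lemma sum_list_exponents: "sum_list (exponents m) = mdegree m"
  unfolding sum_mset_sum_list[symmetric] mset_exponents mdegree_def sum_unfold_sum_mset ..

lemma length_exponents: "length (exponents m) = card (Poly_Mapping.keys m)"
  by (simp add: exponents_def)

lemma exponents_zero_iff: "exponents m = [] \<longleftrightarrow> m = 0"
  by (simp add: exponents_def)

lemma exponents_single:
  assumes "0 < k"
  shows "exponents (Poly_Mapping.single i k) = [k]"
  using assms by (simp add: exponents_def)

lemma exponents_eq_singleton_iff:
  assumes "0 < k"
  shows "exponents m = [k] \<longleftrightarrow> (\<exists>i. m = Poly_Mapping.single i k)"
proof
  assume *: "exponents m = [k]"
  then have "card (Poly_Mapping.keys m) = 1" by (simp flip: length_exponents)
  then obtain i where i: "Poly_Mapping.keys m = {i}" by (auto simp: card_1_singleton_iff)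
  with * have "lk m i = k" by (simp add: exponents_def)
  then have "m = Poly_Mapping.single i k"
    using i by (intro poly_mapping_eqI) (auto simp: lookup_single when_def in_keys_iff split: if_splits)
  then show "\<exists>i. m = Poly_Mapping.single i k" ..
qed (use assms exponents_single in auto)

text \<open>\<open>Poly_Mapping.nth \<nu>\<close>, with exponents \<nu> at the first indices, serves
  as representative monomial: the coefficient of M_\<nu> in a quasisymmetric f is the value of f
  there.\<close>

lemma exponents_nth:
  assumes "composition \<nu>"
  shows "exponents (Poly_Mapping.nth \<nu>) = \<nu>"
proof -
  have lk: "lk (Poly_Mapping.nth \<nu>) i = (if i < length \<nu> then \<nu> ! i else 0)" for i
    by (simp add: nth.rep_eq nth_default_def)
  then have lk': "nth_default 0 \<nu> i = (if i < length \<nu> then \<nu> ! i else 0)" for i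
    by (simp add: nth_default_def)
  have "exponents (Poly_Mapping.nth \<nu>) =
      map (lk (Poly_Mapping.nth \<nu>)) (filter (\<lambda>i. lk (Poly_Mapping.nth \<nu>) i \<noteq> 0) [0..<length \<nu>])"
    by (rule exponents_filter) (auto simp: subset_iff simp del: keys_nth simp flip: lookup_not_eq_zero_eq_in_keys simp: lk' split: if_splits)
  also have "filter (\<lambda>i. lk (Poly_Mapping.nth \<nu>) i \<noteq> 0) [0..<length \<nu>] = [0..<length \<nu>]"
    using assms by (auto simp: filter_id_conv lk' composition_def)
  finally show ?thesis by (auto simp: lk' intro: nth_equalityI)
qed

lemma mdegree_nth:
  assumes "composition \<nu>"
  shows "mdegree (Poly_Mapping.nth \<nu>) = sum_list \<nu>"
  using sum_list_exponents[of "Poly_Mapping.nth \<nu>"] exponents_nth[OF assms] by simp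

lemma composition_length_le: "composition \<nu> \<Longrightarrow> length \<nu> \<le> sum_list \<nu>"
  by (induction \<nu>) (auto simp: composition_def)

lemma finite_compositions_le: "finite {\<nu>. composition \<nu> \<and> sum_list \<nu> \<le> d}"
proof (rule finite_subset)
  show "{\<nu>. composition \<nu> \<and> sum_list \<nu> \<le> d} \<subseteq> {xs. set xs \<subseteq> {..d} \<and> length xs \<le> d}"
    using composition_length_le member_le_sum_list by (fastforce intro: order_trans)
qed (simp add: finite_lists_length_le)

text \<open>A divisor is determined by its exponents on the support of m, each at most the degree. A
  sum over an infinite set is 0 by convention, so finiteness is what makes
  \<open>series_mult\<close> the Cauchy product.\<close>

lemma finite_monomial_splits: "finite {(a, b). a + b = (m :: monomial)}"
proof -
  have "finite {a. \<exists>b. a + b = m}"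
  proof (rule inj_on_finite)
    show "inj_on (\<lambda>a. restrict (lk a) (Poly_Mapping.keys m)) {a. \<exists>b. a + b = m}"
    proof (rule inj_onI)
      fix a a' assume "a \<in> {a. \<exists>b. a + b = m}" "a' \<in> {a. \<exists>b. a + b = m}"
        and eq: "restrict (lk a) (Poly_Mapping.keys m) = restrict (lk a') (Poly_Mapping.keys m)"
      then obtain b b' where m: "m = a + b" "m = a' + b'" by auto
      show "a = a'"
      proof (rule poly_mapping_eqI)
        fix i
        show "lk a i = lk a' i"
        proof (cases "i \<in> Poly_Mapping.keys m")
          case True
          then show ?thesis using fun_cong[OF eq, of i] by simp
        next
          case False
          then have "lk m i = 0" by (simp add: in_keys_iff)
          then have "lk (a + b) i = 0" "lk (a' + b') i = 0" by (simp_all only: m(1)[symmetric] m(2)[symmetric])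
          then show ?thesis by (simp add: lookup_add)
        qed
      qed
    qed
    show "(\<lambda>a. restrict (lk a) (Poly_Mapping.keys m)) ` {a. \<exists>b. a + b = m} \<subseteq>
        Poly_Mapping.keys m \<rightarrow>\<^sub>E {..mdegree m}"
    proof (rule image_subsetI)
      fix a assume "a \<in> {a. \<exists>b. a + b = m}"
      then obtain b where m: "m = a + b" by auto
      have "lk a i \<le> mdegree m" if "i \<in> Poly_Mapping.keys m" for i
      proof -
        have "lk m i \<le> mdegree m"
          unfolding mdegree_def using that by (intro member_le_sum) auto
        then show ?thesis by (simp add: m lookup_add)
      qed
      then show "restrict (lk a) (Poly_Mapping.keys m) \<in> Poly_Mapping.keys m \<rightarrow>\<^sub>E {..mdegree m}"
        by auto
    qed
  qed (auto intro: finite_PiE)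
  then have "finite ({a. \<exists>b. a + b = m} \<times> {a. \<exists>b. a + b = m})" by blast
  moreover have "{(a, b). a + b = m} \<subseteq> {a. \<exists>b. a + b = m} \<times> {a. \<exists>b. a + b = m}"
    using add.commute by blast
  ultimately show ?thesis by (rule rev_finite_subset)
qed

section \<open>Products\<close>

lemma series_mult_eq_sum_superset:
  assumes "finite S" "\<And>a b. a + b = m \<Longrightarrow> f a * g b \<noteq> 0 \<Longrightarrow> (a, b) \<in> S" "\<And>a b. (a, b) \<in> S \<Longrightarrow> a + b = m"
  shows "series_mult f g m = (\<Sum>(a, b)\<in>S. f a * g b)"
  unfolding series_mult_def
proof (rule sum.mono_neutral_right)
  show "S \<subseteq> {(a, b). a + b = m}" using assms(3) by blast
  show "\<forall>p\<in>{(a, b). a + b = m} - S. (case p of (a, b) \<Rightarrow> f a * g b) = 0"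
    using assms(2) by (fastforce simp: split_beta)
qed (rule finite_monomial_splits)

lemma series_mult_one_left [simp]: "series_mult series_one f = f"
proof
  fix m
  have "series_mult series_one f m = (\<Sum>(a, b)\<in>{(0, m)}. series_one a * f b)"
    by (rule series_mult_eq_sum_superset) (auto simp: series_one_def split: if_splits)
  then show "series_mult series_one f m = f m" by (simp add: series_one_def)
qed

lemma series_mult_add_left:
  "series_mult (\<lambda>m. f m + g m) h = (\<lambda>m. series_mult f h m + series_mult g h m)"
  by (auto simp: series_mult_def split_beta sum.distrib algebra_simps)

lemma series_mult_scale_left: "series_mult (\<lambda>m. c * f m) h = (\<lambda>m. c * series_mult f h m)"
  by (auto simp: series_mult_def split_beta sum_distrib_left algebra_simps)

lemma series_mult_sum_right:
  "series_mult f (\<lambda>m. \<Sum>i\<in>I. c i * g i m) = (\<lambda>m. \<Sum>i\<in>I. c i * series_mult f (g i) m)"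
proof
  fix m
  have "series_mult f (\<lambda>m. \<Sum>i\<in>I. c i * g i m) m =
     (\<Sum>p\<in>{(a, b). a + b = m}. \<Sum>i\<in>I. c i * (f (fst p) * g i (snd p)))"
    by (auto simp: series_mult_def split_beta sum_distrib_left algebra_simps)
  also have "\<dots> = (\<Sum>i\<in>I. c i * series_mult f (g i) m)"
    by (subst sum.swap) (simp add: series_mult_def split_beta sum_distrib_left)
  finally show "series_mult f (\<lambda>m. \<Sum>i\<in>I. c i * g i m) m = \<dots>" .
qed

lemma series_mult_assoc: "series_mult (series_mult f g) h = series_mult f (series_mult g h)"
proof
  fix m
  have fin: "finite {(a, b). a + b = (n :: monomial)}" for n by (rule finite_monomial_splits)
  have "series_mult (series_mult f g) h m =
      (\<Sum>p\<in>{(a, b). a + b = m}. \<Sum>q\<in>{(a, b). a + b = fst p}. f (fst q) * g (snd q) * h (snd p))"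
    by (simp add: series_mult_def split_beta sum_distrib_right)
  also have "\<dots> = (\<Sum>(p, q)\<in>(SIGMA p:{(a, b). a + b = m}. {(a, b). a + b = fst p}).
      f (fst q) * g (snd q) * h (snd p))"
    by (rule sum.Sigma) (use fin in auto)
  \<comment> \<open>Both sides run over triples (a, b, c) with a + b + c = m; the witnesses only
    rebracket.\<close>
  also have "\<dots> = (\<Sum>(p, q)\<in>(SIGMA p:{(a, b). a + b = m}. {(a, b). a + b = snd p}).
      f (fst p) * g (fst q) * h (snd q))"
    by (rule sum.reindex_bij_witness[where i = "\<lambda>((a, _), (b, c)). ((a + b, c), (a, b))"
          and j = "\<lambda>((_, c), (a, b)). ((a, b + c), (b, c))"])
      (auto simp: algebra_simps)
  also have "\<dots> = (\<Sum>p\<in>{(a, b). a + b = m}. \<Sum>q\<in>{(a, b). a + b = snd p}. f (fst p) * g (fst q) * h (snd q))"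
    by (rule sum.Sigma[symmetric]) (use fin in auto)
  also have "\<dots> = series_mult f (series_mult g h) m"
    by (simp add: series_mult_def split_beta sum_distrib_left mult.assoc)
  finally show "series_mult (series_mult f g) h m = series_mult f (series_mult g h) m" .
qed

text \<open>The only monomials of p_k are the \<open>x_i^k\<close>. The condition
  \<open>k \<le> lk m i\<close> guards the truncated subtraction of exponents.\<close>

lemma power_sum_mult:
  assumes "0 < k"
  shows "series_mult (monomial_qsym [k]) f m =
    (\<Sum>i | i \<in> Poly_Mapping.keys m \<and> k \<le> lk m i. f (m - Poly_Mapping.single i k))"
proof -
  let ?I = "{i. i \<in> Poly_Mapping.keys m \<and> k \<le> lk m i}"
  let ?S = "(\<lambda>i. (Poly_Mapping.single i k, m - Poly_Mapping.single i k)) ` ?I"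
  have inj: "inj_on (\<lambda>i. (Poly_Mapping.single i k, m - Poly_Mapping.single i k)) ?I"
  proof (rule inj_onI)
    fix i j assume "(Poly_Mapping.single i k, m - Poly_Mapping.single i k) =
      (Poly_Mapping.single j k, m - Poly_Mapping.single j k)"
    then have "lk (Poly_Mapping.single i k) i = lk (Poly_Mapping.single j k) i" by simp
    then show "i = j" using assms by (auto simp: lookup_single when_def split: if_splits)
  qed
  have restore: "Poly_Mapping.single i k + (m - Poly_Mapping.single i k) = m" if "k \<le> lk m i" for i
    using that by (intro poly_mapping_eqI) (auto simp add: lookup_add lookup_minus lookup_single when_def)
  have "series_mult (monomial_qsym [k]) f m = (\<Sum>(a, b)\<in>?S. monomial_qsym [k] a * f b)"
  proof (rule series_mult_eq_sum_superset)
    fix a b assume "a + b = m" "monomial_qsym [k] a * f b \<noteq> 0"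
    then obtain i where a: "a = Poly_Mapping.single i k" and m: "m = a + b"
      using assms by (auto simp: monomial_qsym_def exponents_eq_singleton_iff split: if_splits)
    then have "k \<le> lk m i" "b = m - a" by (auto simp: lookup_add)
    moreover from this have "i \<in> Poly_Mapping.keys m" using assms by (auto simp: in_keys_iff)
    ultimately show "(a, b) \<in> ?S" using a by auto
  qed (use restore in auto)
  also have "\<dots> = (\<Sum>i\<in>?I. f (m - Poly_Mapping.single i k))"
    using assms by (subst sum.reindex[OF inj]) (auto simp: monomial_qsym_def exponents_single)
  finally show ?thesis .
qed

section \<open>Power sums times monomial quasisymmetric functions\<close>

text \<open>The quasi-shuffle of the one-letter word \<open>[k]\<close> with \<nu>. It is a list
  because a word may arise several times and counts with multiplicity.\<close>

fun qshuffle :: "nat \<Rightarrow> nat list \<Rightarrow> nat list list" where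
  "qshuffle k [] = [[k]]"
| "qshuffle k (c # \<nu>) = [k # c # \<nu>, (c + k) # \<nu>] @ map ((#) c) (qshuffle k \<nu>)"

lemma composition_Nil [simp]: "composition []"
  and composition_Cons [simp]: "composition (c # \<nu>) \<longleftrightarrow> 0 < c \<and> composition \<nu>"
  by (auto simp: composition_def)

lemma composition_qshuffle:
  "composition \<nu> \<Longrightarrow> 0 < k \<Longrightarrow> \<mu> \<in> set (qshuffle k \<nu>) \<Longrightarrow> composition \<mu>"
  by (induction k \<nu> arbitrary: \<mu> rule: qshuffle.induct) auto

text \<open>Splitting k off one exponent of a monomial can leave \<nu> in two ways: the exponent was
  k and disappears, so k had been inserted into \<nu>; or it was larger and shrinks, so k had been
  added to an entry. The index list and \<nu> are peeled from the front together.\<close>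

lemma count_list_qshuffle:
  assumes "distinct L" "\<And>i. i \<in> set L \<Longrightarrow> 0 < l i" "0 < k" "composition \<nu>"
  shows "(\<Sum>i | i \<in> set L \<and> k \<le> l i.
      of_bool (map (l(i := l i - k)) (filter (\<lambda>j. (l(i := l i - k)) j \<noteq> 0) L) = \<nu>) :: nat) =
    count_list (qshuffle k \<nu>) (map l L)"
  using assms
proof (induction L arbitrary: \<nu>)
  case Nil
  then show ?case by (cases \<nu>) (auto simp: count_list_0_iff)
next
  case (Cons x L)
  let ?t = "\<lambda>L i. map (l(i := l i - k)) (filter (\<lambda>j. (l(i := l i - k)) j \<noteq> 0) L)"
  have eqL: "?t (x # L) x = (if k < l x then (l x - k) # map l L else map l L)"
  proof -
    have "filter (\<lambda>j. (l(x := l x - k)) j \<noteq> 0) L = L" "x \<notin> set L"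
      using Cons.prems by (auto simp: filter_id_conv)
    then show ?thesis by auto
  qed
  have split: "{i. i \<in> set (x # L) \<and> k \<le> l i} =
      (if k \<le> l x then {x} else {}) \<union> {i. i \<in> set L \<and> k \<le> l i}" by auto
  have "(\<Sum>i | i \<in> set (x # L) \<and> k \<le> l i. of_bool (?t (x # L) i = \<nu>) :: nat) =
      (if k \<le> l x then of_bool (?t (x # L) x = \<nu>) else 0) +
      (\<Sum>i | i \<in> set L \<and> k \<le> l i. of_bool (?t (x # L) i = \<nu>))"
    unfolding split using Cons.prems by (subst sum.union_disjoint) auto
  \<comment> \<open>The filter deletes a zero exponent, so the cases \<open>l x = k\<close> and
    \<open>k < l x\<close> leave words of different shape.\<close>
  also have "(if k \<le> l x then of_bool (?t (x # L) x = \<nu>) else 0 :: nat) =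
      of_bool (l x = k \<and> map l L = \<nu>) + of_bool (k < l x \<and> (l x - k) # map l L = \<nu>)"
    unfolding eqL by auto
  \<comment> \<open>If a later index is touched, the first exponent survives and has to be the first
    letter of \<nu>.\<close>
  also have "(\<Sum>i | i \<in> set L \<and> k \<le> l i. of_bool (?t (x # L) i = \<nu>) :: nat) =
      (\<Sum>i | i \<in> set L \<and> k \<le> l i. of_bool (l x # ?t L i = \<nu>))"
    using Cons.prems by (intro sum.cong refl) auto
  also have "\<dots> = (case \<nu> of [] \<Rightarrow> 0 | c # \<nu>' \<Rightarrow> of_bool (c = l x) * count_list (qshuffle k \<nu>') (map l L))"
  proof (cases \<nu>)
    case (Cons c \<nu>')
    have "(\<Sum>i | i \<in> set L \<and> k \<le> l i. of_bool (l x # ?t L i = \<nu>) :: nat) =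
        of_bool (c = l x) * (\<Sum>i | i \<in> set L \<and> k \<le> l i. of_bool (?t L i = \<nu>'))"
      by (cases "c = l x") (simp_all add: Cons del: fun_upd_apply)
    also have "(\<Sum>i | i \<in> set L \<and> k \<le> l i. of_bool (?t L i = \<nu>') :: nat) =
        count_list (qshuffle k \<nu>') (map l L)"
      by (rule Cons.IH) (use Cons.prems Cons in auto)
    finally show ?thesis unfolding Cons by (simp only: list.case)
  qed simp
  finally have *: "(\<Sum>i | i \<in> set (x # L) \<and> k \<le> l i. of_bool (?t (x # L) i = \<nu>) :: nat) = 
     of_bool (l x = k \<and> map l L = \<nu>) + of_bool (k < l x \<and> (l x - k) # map l L = \<nu>) + 
     (case \<nu> of [] \<Rightarrow> 0 | c # \<nu>' \<Rightarrow> of_bool (c = l x) * count_list (qshuffle k \<nu>') (map l L))" .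
  show ?case
  proof (cases \<nu>)
    case Nil
    then show ?thesis unfolding * by auto
  next
    case (Cons c \<nu>')
    have inj: "count_list (map ((#) c) xs) (y # ys) = of_bool (c = y) * count_list xs ys" for xs y ys
      by (induction xs) auto
    show ?thesis unfolding * using Cons.prems Cons by (auto simp: inj)
  qed
qed

lemma monomial_qsym_power_sum_mult:
  assumes "0 < k" "composition \<nu>"
  shows "series_mult (monomial_qsym [k]) (monomial_qsym \<nu>) = (\<lambda>m. \<Sum>\<mu>\<leftarrow>qshuffle k \<nu>. monomial_qsym \<mu> m)"
proof
  fix m :: monomial
  define L where "L = sorted_list_of_set (Poly_Mapping.keys m)"
  have L: "sorted_wrt (<) L" "set L = Poly_Mapping.keys m" "distinct L"
    by (auto simp: L_def)
  have pos: "0 < lk m i" if "i \<in> set L" for i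
    using that by (simp add: L(2) in_keys_iff)
  have count: "real (count_list xs (exponents m)) = (\<Sum>\<mu>\<leftarrow>xs. monomial_qsym \<mu> m)" for xs
    by (induction xs) (auto simp: monomial_qsym_def)
  have ex: "exponents (m - Poly_Mapping.single i k) =
     map ((lk m)(i := lk m i - k)) (filter (\<lambda>j. ((lk m)(i := lk m i - k)) j \<noteq> 0) L)" for i
  proof -
    have "lk (m - Poly_Mapping.single i k) = (lk m)(i := lk m i - k)"
      by (auto simp: lookup_minus lookup_single when_def)
    moreover have "Poly_Mapping.keys (m - Poly_Mapping.single i k) \<subseteq> set L"
    proof
      fix j assume "j \<in> Poly_Mapping.keys (m - Poly_Mapping.single i k)"
      then have "lk m j - lk (Poly_Mapping.single i k) j \<noteq> 0"
        by (simp only: in_keys_iff lookup_minus not_False_eq_True)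
      then have "lk m j \<noteq> 0" by (metis diff_0_eq_0)
      then show "j \<in> set L" by (simp only: L(2) in_keys_iff not_False_eq_True)
    qed
    ultimately show ?thesis by (simp only: exponents_filter[OF L(1)])
  qed
  have "series_mult (monomial_qsym [k]) (monomial_qsym \<nu>) m =
      real (\<Sum>i | i \<in> set L \<and> k \<le> lk m i. of_bool (exponents (m - Poly_Mapping.single i k) = \<nu>))"
    unfolding power_sum_mult[OF assms(1)] by (simp add: monomial_qsym_def L(2) flip: of_bool_def)
  also have "\<dots> = real (count_list (qshuffle k \<nu>) (map (lk m) L))"
    by (simp only: ex count_list_qshuffle[OF L(3) pos assms])
  also have "map (lk m) L = exponents m" by (simp add: L_def exponents_def)
  also have "real (count_list (qshuffle k \<nu>) (exponents m)) = (\<Sum>\<mu>\<leftarrow>qshuffle k \<nu>. monomial_qsym \<mu> m)" by (rule count)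
  finally show "series_mult (monomial_qsym [k]) (monomial_qsym \<nu>) m = (\<Sum>\<mu>\<leftarrow>qshuffle k \<nu>. monomial_qsym \<mu> m)" .
qed

section \<open>Refinement of compositions\<close>

definition refinements :: "nat list \<Rightarrow> nat list set" where
  "refinements \<nu> = {\<mu>. composition \<mu> \<and> refines \<mu> \<nu>}"

lemma refinements_Nil: "refinements [] = {[]}"
  by (auto simp: refinements_def refines_def)

lemma sum_list_concat_map: "sum_list (concat bs) = sum_list (map sum_list bs)"
  by (induction bs) auto

lemma sum_list_refinements: "\<mu> \<in> refinements \<nu> \<Longrightarrow> sum_list \<mu> = sum_list \<nu>"
  by (auto simp: refinements_def refines_def sum_list_concat_map)

lemma finite_refinements: "finite (refinements \<nu>)"
  by (rule finite_subset[OF _ finite_compositions_le[of "sum_list \<nu>"]])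
    (auto simp: sum_list_refinements, auto simp: refinements_def)

text \<open>Every block is nonempty because its sum is positive, so a proper refinement has more
  parts. This makes the passage between F and M unitriangular.\<close>

lemma refinements_length:
  assumes "composition \<nu>" "\<mu> \<in> refinements \<nu>"
  shows "\<mu> = \<nu> \<or> length \<nu> < length \<mu>"
proof -
  obtain bs where bs: "concat bs = \<mu>" "map sum_list bs = \<nu>" and "composition \<mu>"
    using assms(2) by (auto simp: refinements_def refines_def)
  have "composition (map sum_list bs) \<Longrightarrow>
      concat bs = map sum_list bs \<or> length (map sum_list bs) < length (concat bs)"
  proof (induction bs)
    case (Cons b bs)
    then consider x where "b = [x]" | x y b' where "b = x # y # b'"
      by (cases b rule: remdups_adj.cases) auto
    then show ?case
    proof cases
      case 1
      then show ?thesis using Cons by auto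
    next
      case 2
      have "length (map sum_list bs) \<le> length (concat bs)"
        using Cons by (metis composition_Cons eq_iff length_map less_imp_le list.simps(9))
      then show ?thesis using 2 by simp
    qed
  qed simp
  then show ?thesis using bs assms(1) by auto
qed

lemma refinements_refl: "composition \<nu> \<Longrightarrow> \<nu> \<in> refinements \<nu>"
  unfolding refinements_def refines_def
  by (auto intro!: exI[of _ "map (\<lambda>x. [x]) \<nu>"] simp: comp_def)

lemma refinements_Cons_1: "refinements (1 # \<nu>) = (#) 1 ` refinements \<nu>"
proof (intro equalityI subsetI)
  fix \<mu> assume "\<mu> \<in> refinements (1 # \<nu>)"
  then obtain b bs where b: "composition (b @ concat bs)" "\<mu> = b @ concat bs" "sum_list b = 1" "map sum_list bs = \<nu>"
    by (auto simp: refinements_def refines_def map_eq_Cons_conv)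
  then have "b = [1]" by (cases b) (auto simp: composition_def, cases "tl b", auto)
  with b show "\<mu> \<in> (#) 1 ` refinements \<nu>"
    by (auto simp: refinements_def refines_def)
next
  fix \<mu> assume "\<mu> \<in> (#) 1 ` refinements \<nu>"
  then obtain bs where "\<mu> = 1 # concat bs" "composition (concat bs)" "map sum_list bs = \<nu>"
    by (auto simp: refinements_def refines_def)
  then show "\<mu> \<in> refinements (1 # \<nu>)"
    by (auto simp: refinements_def refines_def intro!: exI[of _ "[1] # bs"])
qed

text \<open>Follows one ascent in the recursion of \<open>zs\<close>: the new first unit is either
  cut off as a part of its own or joined to the first part of a refinement. The two choices later
  match the summands D and B.\<close>

lemma refinements_Cons_Suc:
  assumes "0 < c"
  shows "refinements (Suc c # \<nu>) =
    (#) 1 ` refinements (c # \<nu>) \<union> (\<lambda>\<mu>. Suc (hd \<mu>) # tl \<mu>) ` refinements (c # \<nu>)"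
proof (intro equalityI subsetI)
  fix \<mu> assume "\<mu> \<in> refinements (Suc c # \<nu>)"
  then obtain b bs where b: "composition (b @ concat bs)" "\<mu> = b @ concat bs" "sum_list b = Suc c" "map sum_list bs = \<nu>"
    by (auto simp: refinements_def refines_def map_eq_Cons_conv)
  then obtain d b' where [simp]: "b = d # b'" by (cases b) auto
  show "\<mu> \<in> (#) 1 ` refinements (c # \<nu>) \<union> (\<lambda>\<mu>. Suc (hd \<mu>) # tl \<mu>) ` refinements (c # \<nu>)"
  proof (cases "d = 1")
    case True
    then have "b' @ concat bs \<in> refinements (c # \<nu>)"
      using b by (auto simp: refinements_def refines_def intro!: exI[of _ "b' # bs"])
    then show ?thesis using b True by auto
  next
    case False
    then have "(d - 1) # b' @ concat bs \<in> refinements (c # \<nu>)" "d > 1"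
      using b by (auto simp: refinements_def refines_def intro!: exI[of _ "((d - 1) # b') # bs"])
    then have "Suc (hd ((d - 1) # b' @ concat bs)) # tl ((d - 1) # b' @ concat bs)
        \<in> (\<lambda>\<mu>. Suc (hd \<mu>) # tl \<mu>) ` refinements (c # \<nu>)"
      by blast
    then show ?thesis using b \<open>d > 1\<close> by simp
  qed
next
  fix \<mu> assume "\<mu> \<in> (#) 1 ` refinements (c # \<nu>) \<union> (\<lambda>\<mu>. Suc (hd \<mu>) # tl \<mu>) ` refinements (c # \<nu>)"
  then obtain b bs where b: "composition (b @ concat bs)" "sum_list b = c" "map sum_list bs = \<nu>"
      and \<mu>: "\<mu> = 1 # b @ concat bs \<or> \<mu> = Suc (hd (b @ concat bs)) # tl (b @ concat bs)"
    by (auto simp: refinements_def refines_def map_eq_Cons_conv)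
  then obtain d b' where [simp]: "b = d # b'" using assms by (cases b) auto
  from \<mu> show "\<mu> \<in> refinements (Suc c # \<nu>)"
  proof
    assume "\<mu> = 1 # b @ concat bs"
    then show ?thesis using b by (auto simp: refinements_def refines_def intro!: exI[of _ "(1 # b) # bs"])
  next
    assume "\<mu> = Suc (hd (b @ concat bs)) # tl (b @ concat bs)"
    then show ?thesis using b by (auto simp: refinements_def refines_def intro!: exI[of _ "(Suc d # b') # bs"])
  qed
qed

lemma refinements_ConsE:
  assumes "0 < c" "\<mu> \<in> refinements (c # \<nu>)"
  obtains d \<mu>' where "\<mu> = d # \<mu>'" "0 < d" "composition \<mu>'"
  using assms by (cases \<mu>) (auto simp: refinements_def refines_def map_eq_Cons_conv)

lemma composition_zs: "composition (zs w)"
  and zs_eq_Nil_iff: "zs w = [] \<longleftrightarrow> w = []"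
  by (induction w rule: zs.induct) (auto simp: Let_def composition_def dest: list.set_sel(2))

lemma zs_map_Suc: "zs (map Suc w) = zs w"
  by (induction w rule: zs.induct) (auto simp: Let_def)

text \<open>A first part 1 comes from a new largest letter in front, which creates a descent; a
  longer first part is obtained by a new smallest letter in front, which creates an ascent.
  Consequently words prescribe the value of a functional at every F_\<nu>.\<close>

lemma ex_permutation_zs:
  assumes "composition \<nu>"
  shows "\<exists>w\<in>permutations_of_set {1..sum_list \<nu>}. zs w = \<nu>"
  using assms
proof (induction "sum_list \<nu>" arbitrary: \<nu>)
  case 0
  then have "\<nu> = []" by (cases \<nu>) auto
  then show ?case by simp
next
  case (Suc n)
  then obtain c \<nu>' where \<nu>: "\<nu> = c # \<nu>'" "0 < c" "composition \<nu>'" by (cases \<nu>) auto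
  show ?case
  proof (cases "c = 1")
    case True
    then obtain w where w: "w \<in> permutations_of_set {1..n}" "zs w = \<nu>'"
      using Suc \<nu> by auto
    then have "set (Suc n # w) = {1..Suc n}" "distinct (Suc n # w)"
      by (auto simp: permutations_of_set_def)
    moreover have "zs (Suc n # w) = \<nu>"
    proof (cases w)
      case (Cons x w')
      have "set w = {1..n}" using w by (simp add: permutations_of_set_def)
      then have "x \<in> {1..n}" using Cons by (metis list.set_intros(1))
      then have "\<not> Suc n < x" by simp
      then show ?thesis using w Cons \<nu> True by (simp add: Let_def)
    qed (use w True \<nu> in auto)
    ultimately show ?thesis unfolding Suc(2)[symmetric] permutations_of_set_def by blast
  next
    case False
    then have n: "n = sum_list ((c - 1) # \<nu>')" and "composition ((c - 1) # \<nu>')"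
      using Suc(2) \<nu> by auto
    then have "\<exists>w\<in>permutations_of_set {1..n}. zs w = (c - 1) # \<nu>'"
      using Suc(1) by blast
    then obtain w where w: "w \<in> permutations_of_set {1..n}" "zs w = (c - 1) # \<nu>'" by blast
    have "set (1 # map Suc w) = {1..Suc n}"
      using w by (auto simp: permutations_of_set_def image_Suc_atLeastAtMost)
    moreover have "distinct (1 # map Suc w)"
      using w by (auto simp: permutations_of_set_def distinct_map)
    moreover have "zs (1 # map Suc w) = \<nu>"
    proof (cases w)
      case (Cons x w')
      have "set w = {1..n}" using w by (simp add: permutations_of_set_def)
      then have "x \<in> {1..n}" using Cons by (metis list.set_intros(1))
      then have "zs (1 # map Suc w) = Suc (hd (zs (map Suc w))) # tl (zs (map Suc w))"
        using Cons by (simp add: Let_def)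
      then show ?thesis using w \<nu> False by (simp only: zs_map_Suc) simp
    qed (use w in simp)
    ultimately show ?thesis unfolding Suc(2)[symmetric] permutations_of_set_def by blast
  qed
qed

section \<open>Linear functionals\<close>

definition subspace_series :: "series set \<Rightarrow> bool" where
  "subspace_series A \<longleftrightarrow> (\<lambda>m. 0) \<in> A \<and>
     (\<forall>f\<in>A. \<forall>g\<in>A. (\<lambda>m. f m + g m) \<in> A) \<and> (\<forall>c. \<forall>f\<in>A. (\<lambda>m. c * f m) \<in> A)"

lemma subspace_series_add: "subspace_series A \<Longrightarrow> f \<in> A \<Longrightarrow> g \<in> A \<Longrightarrow> (\<lambda>m. f m + g m) \<in> A"
  and subspace_series_scale: "subspace_series A \<Longrightarrow> f \<in> A \<Longrightarrow> (\<lambda>m. c * f m) \<in> A"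
  by (simp_all add: subspace_series_def)

lemma subspace_series_zero: "subspace_series A \<Longrightarrow> (\<lambda>m. 0) \<in> A"
  by (simp add: subspace_series_def)

lemma subspace_series_sum:
  assumes A: "subspace_series A" and g: "\<And>i. i \<in> I \<Longrightarrow> g i \<in> A"
  shows "(\<lambda>m. \<Sum>i\<in>I. c i * g i m) \<in> A"
  using g
proof (induction I rule: infinite_finite_induct)
  case (insert i I)
  have "(\<lambda>m. c i * g i m + (\<Sum>i\<in>I. c i * g i m)) \<in> A"
    by (rule subspace_series_add[OF A subspace_series_scale[OF A insert.prems[OF insertI1]] insert.IH])
      (rule insert.prems, rule insertI2)
  then show ?case using insert.hyps by (simp only: sum.insert not_False_eq_True)
qed (simp_all add: subspace_series_zero[OF A])

lemma linear_functional_on_add: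
    "linear_functional_on A \<psi> \<Longrightarrow> f \<in> A \<Longrightarrow> g \<in> A \<Longrightarrow> \<psi> (\<lambda>m. f m + g m) = \<psi> f + \<psi> g"
  and linear_functional_on_scale:
    "linear_functional_on A \<psi> \<Longrightarrow> f \<in> A \<Longrightarrow> \<psi> (\<lambda>m. c * f m) = c * \<psi> f"
  by (simp_all only: linear_functional_on_def)

lemma linear_functional_on_zero:
  assumes "subspace_series A" "linear_functional_on A \<psi>"
  shows "\<psi> (\<lambda>m. 0) = 0"
  using linear_functional_on_scale[OF assms(2) subspace_series_zero[OF assms(1)], of 0] by simp

lemma linear_functional_on_sum:
  assumes A: "subspace_series A" and \<psi>: "linear_functional_on A \<psi>" and g: "\<And>i. i \<in> I \<Longrightarrow> g i \<in> A"
  shows "\<psi> (\<lambda>m. \<Sum>i\<in>I. c i * g i m) = (\<Sum>i\<in>I. c i * \<psi> (g i))"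
  using g
proof (induction I rule: infinite_finite_induct)
  case (insert i I)
  have gi: "g i \<in> A" by (rule insert.prems[OF insertI1])
  have gI: "g j \<in> A" if "j \<in> I" for j by (rule insert.prems[OF insertI2[OF that]])
  have "\<psi> (\<lambda>m. c i * g i m + (\<Sum>i\<in>I. c i * g i m)) = c i * \<psi> (g i) + \<psi> (\<lambda>m. \<Sum>i\<in>I. c i * g i m)"
    by (simp only: linear_functional_on_add[OF \<psi> subspace_series_scale[OF A gi] subspace_series_sum[OF A gI]]
        linear_functional_on_scale[OF \<psi> gi])
  then show ?case using insert.hyps insert.IH[OF gI] by (simp only: sum.insert not_False_eq_True)
qed (simp_all add: linear_functional_on_zero[OF A \<psi>])

lemma bounded_degree_add:
  assumes "bounded_degree f" "bounded_degree g"
  shows "bounded_degree (\<lambda>m. f m + g m)"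
proof -
  obtain d e where "\<forall>m. f m \<noteq> 0 \<longrightarrow> mdegree m \<le> d" "\<forall>m. g m \<noteq> 0 \<longrightarrow> mdegree m \<le> e"
    using assms by (auto simp: bounded_degree_def)
  then have "mdegree m \<le> max d e" if "f m + g m \<noteq> 0" for m
    using that by (cases "f m = 0") (auto simp: le_max_iff_disj)
  then show ?thesis unfolding bounded_degree_def by blast
qed

lemma bounded_degree_scale: "bounded_degree f \<Longrightarrow> bounded_degree (\<lambda>m. c * f m)"
  unfolding bounded_degree_def by auto

lemma QSymI:
  assumes "bounded_degree f" "\<And>m m'. exponents m = exponents m' \<Longrightarrow> f m = f m'"
  shows "f \<in> QSym"
  unfolding QSym_def by (intro CollectI conjI allI impI assms)

lemma QSym_bounded_degree: "f \<in> QSym \<Longrightarrow> bounded_degree f"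
  unfolding QSym_def mem_Collect_eq by (rule conjunct1)

lemma QSym_exponents_cong:
  assumes "f \<in> QSym" "exponents m = exponents m'"
  shows "f m = f m'"
proof -
  have "\<forall>m m'. exponents m = exponents m' \<longrightarrow> f m = f m'"
    using assms(1) unfolding QSym_def mem_Collect_eq by (rule conjunct2)
  from this[THEN spec, THEN spec, THEN mp, OF assms(2)] show ?thesis .
qed

lemma subspace_QSym: "subspace_series QSym"
proof -
  have "(\<lambda>m. 0) \<in> QSym" by (rule QSymI) (simp_all add: bounded_degree_def)
  moreover have "(\<lambda>m. f m + g m) \<in> QSym" if "f \<in> QSym" "g \<in> QSym" for f g
    by (rule QSymI[OF bounded_degree_add[OF that[THEN QSym_bounded_degree]]])
      (rule arg_cong2[where f = "(+)", OF that[THEN QSym_exponents_cong]])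
  moreover have "(\<lambda>m. c * f m) \<in> QSym" if "f \<in> QSym" for c f
    by (rule QSymI[OF bounded_degree_scale[OF that[THEN QSym_bounded_degree]]])
      (rule arg_cong[where f = "(*) c", OF that[THEN QSym_exponents_cong]])
  ultimately show ?thesis by (simp add: subspace_series_def)
qed

lemma SymI:
  assumes "bounded_degree f" "\<And>p m. bij p \<Longrightarrow> f (Poly_Mapping.map_key p m) = f m"
  shows "f \<in> Sym"
  using assms by (simp add: Sym_def)

lemma Sym_bounded_degree: "f \<in> Sym \<Longrightarrow> bounded_degree f"
  by (simp add: Sym_def)

lemma Sym_map_key: "f \<in> Sym \<Longrightarrow> bij p \<Longrightarrow> f (Poly_Mapping.map_key p m) = f m"
  by (simp add: Sym_def)

lemma subspace_Sym: "subspace_series Sym"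
proof -
  have "(\<lambda>m. 0) \<in> Sym" by (simp add: Sym_def bounded_degree_def)
  moreover have "(\<lambda>m. f m + g m) \<in> Sym" if "f \<in> Sym" "g \<in> Sym" for f g
    by (rule SymI[OF bounded_degree_add[OF that[THEN Sym_bounded_degree]]]) (simp only: that[THEN Sym_map_key])
  moreover have "(\<lambda>m. c * f m) \<in> Sym" if "f \<in> Sym" for c f
    by (rule SymI[OF bounded_degree_scale[OF that[THEN Sym_bounded_degree]]]) (simp only: that[THEN Sym_map_key])
  ultimately show ?thesis by (simp add: subspace_series_def)
qed

lemma bounded_degree_monomial_qsym: "bounded_degree (monomial_qsym \<nu>)"
  unfolding bounded_degree_def
proof (intro exI allI impI)
  fix m assume "monomial_qsym \<nu> m \<noteq> 0"
  then have "exponents m = \<nu>" by (simp add: monomial_qsym_def split: if_splits)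
  then show "mdegree m \<le> sum_list \<nu>" using sum_list_exponents[of m] by simp
qed

lemma monomial_qsym_QSym: "monomial_qsym \<nu> \<in> QSym"
  by (rule QSymI[OF bounded_degree_monomial_qsym]) (simp only: monomial_qsym_def)

section \<open>Functionals given by their values on monomial quasisymmetric functions\<close>

definition qsym_support :: "series \<Rightarrow> nat list set" where
  "qsym_support f = {\<nu>. composition \<nu> \<and> f (Poly_Mapping.nth \<nu>) \<noteq> 0}"

lemma finite_qsym_support:
  assumes "f \<in> QSym"
  shows "finite (qsym_support f)"
proof -
  obtain d where "\<And>m. f m \<noteq> 0 \<Longrightarrow> mdegree m \<le> d"
    using QSym_bounded_degree[OF assms] by (auto simp: bounded_degree_def)
  then have "qsym_support f \<subseteq> {\<nu>. composition \<nu> \<and> sum_list \<nu> \<le> d}"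
    by (auto simp: qsym_support_def simp flip: mdegree_nth)
  then show ?thesis using finite_compositions_le finite_subset by blast
qed

lemma qsym_expansion:
  assumes f: "f \<in> QSym"
  shows "f = (\<lambda>m. \<Sum>\<nu>\<in>qsym_support f. f (Poly_Mapping.nth \<nu>) * monomial_qsym \<nu> m)"
proof
  fix m
  have m: "f m = f (Poly_Mapping.nth (exponents m))"
    by (rule QSym_exponents_cong[OF f]) (simp add: exponents_nth composition_exponents)
  have "(\<Sum>\<nu>\<in>qsym_support f. f (Poly_Mapping.nth \<nu>) * monomial_qsym \<nu> m) =
      (\<Sum>\<nu>\<in>qsym_support f. if exponents m = \<nu> then f (Poly_Mapping.nth \<nu>) else 0)"
    by (intro sum.cong) (auto simp: monomial_qsym_def)
  also have "\<dots> = f (Poly_Mapping.nth (exponents m))"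
    using finite_qsym_support[OF f] by (auto simp: qsym_support_def composition_exponents)
  finally show "f m = (\<Sum>\<nu>\<in>qsym_support f. f (Poly_Mapping.nth \<nu>) * monomial_qsym \<nu> m)"
    using m by simp
qed

definition qsym_functional :: "(nat list \<Rightarrow> real) \<Rightarrow> series \<Rightarrow> real" where
  "qsym_functional \<phi> f = (\<Sum>\<nu>\<in>qsym_support f. f (Poly_Mapping.nth \<nu>) * \<phi> \<nu>)"

lemma qsym_functional_superset:
  assumes "finite S" "qsym_support f \<subseteq> S" "\<And>\<nu>. \<nu> \<in> S \<Longrightarrow> composition \<nu>"
  shows "qsym_functional \<phi> f = (\<Sum>\<nu>\<in>S. f (Poly_Mapping.nth \<nu>) * \<phi> \<nu>)"
  unfolding qsym_functional_def
  by (rule sum.mono_neutral_left) (use assms in \<open>auto simp: qsym_support_def\<close>)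

lemma linear_qsym_functional: "linear_functional_on QSym (qsym_functional \<phi>)"
  unfolding linear_functional_on_def
proof (intro conjI ballI allI)
  fix f g assume fg: "f \<in> QSym" "g \<in> QSym"
  let ?S = "qsym_support f \<union> qsym_support g"
  have S: "finite ?S" "\<And>\<nu>. \<nu> \<in> ?S \<Longrightarrow> composition \<nu>" "qsym_support (\<lambda>m. f m + g m) \<subseteq> ?S"
    using finite_qsym_support fg by (auto simp: qsym_support_def)
  show "qsym_functional \<phi> (\<lambda>m. f m + g m) = qsym_functional \<phi> f + qsym_functional \<phi> g"
    using qsym_functional_superset[OF S(1,3,2)] qsym_functional_superset[OF S(1) _ S(2), of f]
      qsym_functional_superset[OF S(1) _ S(2), of g]
    by (simp add: distrib_right sum.distrib)
next
  fix c f assume f: "f \<in> QSym"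
  have "qsym_functional \<phi> (\<lambda>m. c * f m) = (\<Sum>\<nu>\<in>qsym_support f. c * f (Poly_Mapping.nth \<nu>) * \<phi> \<nu>)"
    using finite_qsym_support[OF f] by (intro qsym_functional_superset) (auto simp: qsym_support_def)
  then show "qsym_functional \<phi> (\<lambda>m. c * f m) = c * qsym_functional \<phi> f"
    by (simp add: qsym_functional_def sum_distrib_left mult.assoc)
qed

lemma qsym_functional_monomial:
  assumes "composition \<nu>"
  shows "qsym_functional \<phi> (monomial_qsym \<nu>) = \<phi> \<nu>"
proof -
  have "qsym_support (monomial_qsym \<nu>) = {\<nu>}"
    using assms by (auto simp: qsym_support_def monomial_qsym_def exponents_nth)
  then show ?thesis
    using assms by (simp add: qsym_functional_def monomial_qsym_def exponents_nth)
qed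

lemma fundamental_qsym_eq: "fundamental_qsym \<nu> = (\<lambda>m. \<Sum>\<mu>\<in>refinements \<nu>. 1 * monomial_qsym \<mu> m)"
  by (simp add: fundamental_qsym_def refinements_def)

lemma linear_functional_fundamental:
  assumes "linear_functional_on QSym \<psi>"
  shows "\<psi> (fundamental_qsym \<nu>) = (\<Sum>\<mu>\<in>refinements \<nu>. \<psi> (monomial_qsym \<mu>))"
  unfolding fundamental_qsym_eq
  using linear_functional_on_sum[OF subspace_QSym assms, of "refinements \<nu>" monomial_qsym "\<lambda>_. 1"]
  by (simp add: monomial_qsym_QSym)

text \<open>F_\<nu> is M_\<nu> plus functions M_\<mu> with \<mu> longer and of the same sum, so
  values on F can be solved for values on M, and these functions span.\<close>

lemma linear_functional_QSym_eqI:
  assumes \<psi>: "linear_functional_on QSym \<psi>" "linear_functional_on QSym \<psi>'"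
    and eq: "\<And>\<nu>. composition \<nu> \<Longrightarrow> \<psi> (fundamental_qsym \<nu>) = \<psi>' (fundamental_qsym \<nu>)"
    and f: "f \<in> QSym"
  shows "\<psi> f = \<psi>' f"
proof -
  have M: "\<psi> (monomial_qsym \<nu>) = \<psi>' (monomial_qsym \<nu>)" if "composition \<nu>" for \<nu>
    using that
  \<comment> \<open>A composition has at most as many parts as its sum, so this difference drops
    under each proper refinement.\<close>
  proof (induction "sum_list \<nu> - length \<nu>" arbitrary: \<nu> rule: less_induct)
    case less
    have "\<psi> (monomial_qsym \<mu>) = \<psi>' (monomial_qsym \<mu>)" if "\<mu> \<in> refinements \<nu> - {\<nu>}" for \<mu>
    proof (rule less.hyps)
      show c: "composition \<mu>" using that by (auto simp: refinements_def)
      have "length \<nu> < length \<mu>" "sum_list \<mu> = sum_list \<nu>"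
        using that refinements_length[OF less.prems] sum_list_refinements by auto
      then show "sum_list \<mu> - length \<mu> < sum_list \<nu> - length \<nu>"
        using composition_length_le[OF c] by linarith
    qed
    then have "(\<Sum>\<mu>\<in>refinements \<nu> - {\<nu>}. \<psi> (monomial_qsym \<mu>)) =
        (\<Sum>\<mu>\<in>refinements \<nu> - {\<nu>}. \<psi>' (monomial_qsym \<mu>))"
      by (rule sum.cong[OF refl])
    moreover have *: "\<psi> (fundamental_qsym \<nu>) = \<psi> (monomial_qsym \<nu>) + (\<Sum>\<mu>\<in>refinements \<nu> - {\<nu>}. \<psi> (monomial_qsym \<mu>))"
      if "linear_functional_on QSym \<psi>" for \<psi>
      unfolding linear_functional_fundamental[OF that]
      by (rule sum.remove[OF finite_refinements refinements_refl[OF less.prems]])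
    ultimately show ?case using eq[OF less.prems] *[OF \<psi>(1)] *[OF \<psi>(2)] by simp
  qed
  have *: "\<psi> f = (\<Sum>\<nu>\<in>qsym_support f. f (Poly_Mapping.nth \<nu>) * \<psi> (monomial_qsym \<nu>))"
    if "linear_functional_on QSym \<psi>" for \<psi>
    by (rule trans[OF arg_cong[OF qsym_expansion[OF f]]])
      (rule linear_functional_on_sum[OF subspace_QSym that monomial_qsym_QSym])
  show ?thesis
    unfolding *[OF \<psi>(1)] *[OF \<psi>(2)] by (intro sum.cong refl) (simp add: M qsym_support_def)
qed

lemma sum_list_monomial_qsym:
  assumes "linear_functional_on QSym \<psi>"
  shows "(\<lambda>m. \<Sum>\<mu>\<leftarrow>xs. monomial_qsym \<mu> m) \<in> QSym \<and>
    \<psi> (\<lambda>m. \<Sum>\<mu>\<leftarrow>xs. monomial_qsym \<mu> m) = (\<Sum>\<mu>\<leftarrow>xs. \<psi> (monomial_qsym \<mu>))"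
proof (induction xs)
  case Nil
  then show ?case
    using linear_functional_on_zero[OF subspace_QSym assms] subspace_QSym by (simp add: subspace_series_def)
next
  case (Cons \<mu> xs)
  then show ?case
    using assms subspace_QSym monomial_qsym_QSym
    by (simp add: subspace_series_def linear_functional_on_def)
qed

text \<open>By linearity the quasi-shuffle relation extends from single M_\<nu> to all of QSym. It
  is the only product rule on QSym that enters the argument.\<close>

lemma qsym_functional_power_sum_mult:
  assumes k: "0 < k" and g: "g \<in> QSym"
    and \<phi>: "\<And>\<nu>. composition \<nu> \<Longrightarrow> (\<Sum>\<mu>\<leftarrow>qshuffle k \<nu>. \<phi> \<mu>) = \<phi> [k] * \<phi> \<nu>"
  shows "qsym_functional \<phi> (series_mult (monomial_qsym [k]) g) = \<phi> [k] * qsym_functional \<phi> g"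
proof -
  let ?p = "\<lambda>\<nu>. series_mult (monomial_qsym [k]) (monomial_qsym \<nu>)"
  have *: "?p \<nu> \<in> QSym" "qsym_functional \<phi> (?p \<nu>) = \<phi> [k] * \<phi> \<nu>" if "composition \<nu>" for \<nu>
  proof -
    have "(\<Sum>\<mu>\<leftarrow>qshuffle k \<nu>. qsym_functional \<phi> (monomial_qsym \<mu>)) = (\<Sum>\<mu>\<leftarrow>qshuffle k \<nu>. \<phi> \<mu>)"
      using composition_qshuffle[OF that k]
      by (intro arg_cong[of _ _ sum_list] map_cong refl qsym_functional_monomial)
    then show "?p \<nu> \<in> QSym" "qsym_functional \<phi> (?p \<nu>) = \<phi> [k] * \<phi> \<nu>"
      using sum_list_monomial_qsym[OF linear_qsym_functional, where xs = "qshuffle k \<nu>"] \<phi>[OF that]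
      by (simp_all add: monomial_qsym_power_sum_mult[OF k that])
  qed
  have supp: "composition \<nu>" if "\<nu> \<in> qsym_support g" for \<nu> using that by (simp add: qsym_support_def)
  have "series_mult (monomial_qsym [k]) g =
      (\<lambda>m. \<Sum>\<nu>\<in>qsym_support g. g (Poly_Mapping.nth \<nu>) * ?p \<nu> m)"
    unfolding series_mult_sum_right[symmetric] qsym_expansion[OF g, symmetric] ..
  then have "qsym_functional \<phi> (series_mult (monomial_qsym [k]) g) =
      (\<Sum>\<nu>\<in>qsym_support g. g (Poly_Mapping.nth \<nu>) * qsym_functional \<phi> (?p \<nu>))"
    by (simp only: linear_functional_on_sum[OF subspace_QSym linear_qsym_functional *(1)[OF supp]])
  also have "\<dots> = (\<Sum>\<nu>\<in>qsym_support g. \<phi> [k] * (g (Poly_Mapping.nth \<nu>) * \<phi> \<nu>))"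
    by (intro sum.cong refl) (simp add: *(2)[OF supp])
  finally show ?thesis by (simp add: qsym_functional_def sum_distrib_left)
qed

section \<open>Symmetric functions\<close>

text \<open>Padding with zeros makes monomials with different supports comparable on a common index
  set.\<close>

lemma mset_exponents_superset:
  assumes "finite A" "Poly_Mapping.keys m \<subseteq> A"
  shows "image_mset (lk m) (mset_set A) =
    mset (exponents m) + replicate_mset (card A - card (Poly_Mapping.keys m)) 0"
proof -
  have "mset_set A = mset_set (Poly_Mapping.keys m) + mset_set (A - Poly_Mapping.keys m)"
    using assms by (metis Diff_disjoint Diff_partition finite_Diff finite_keys mset_set_Union)
  moreover have "image_mset (lk m) (mset_set (A - Poly_Mapping.keys m)) =
      image_mset (\<lambda>_. 0) (mset_set (A - Poly_Mapping.keys m))"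
    using assms by (intro image_mset_cong) (simp add: in_keys_iff)
  moreover have "card (A - Poly_Mapping.keys m) = card A - card (Poly_Mapping.keys m)"
    using assms by (simp add: card_Diff_subset)
  ultimately show ?thesis by (simp add: mset_exponents image_mset_const_eq)
qed

lemma lookup_map_key: "bij p \<Longrightarrow> lk (Poly_Mapping.map_key p m) i = lk m (p i)"
  by (simp add: map_key.rep_eq bij_is_inj)

text \<open>On the union of the supports both exponent functions take the same values with
  multiplicity, zeros included. A permutation of this finite set matches them and is the identity
  elsewhere.\<close>

lemma ex_bij_map_key:
  assumes "mset (exponents m) = mset (exponents m')"
  shows "\<exists>p. bij p \<and> Poly_Mapping.map_key p m = m'"
proof -
  let ?A = "Poly_Mapping.keys m \<union> Poly_Mapping.keys m'"
  have "length (exponents m) = length (exponents m')"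
    using assms by (rule mset_eq_length)
  then have eq: "image_mset (lk m') (mset_set ?A) = image_mset (lk m) (mset_set ?A)"
    using assms by (simp add: mset_exponents_superset length_exponents)
  have "finite ?A" by simp
  from image_mset_eq_implies_permutes[OF this eq] obtain p
    where p: "p permutes ?A" "\<forall>x\<in>?A. lk m' x = lk m (p x)" by blast
  have bij: "bij p" using p(1) by (rule permutes_bij)
  have "lk m (p x) = lk m' x" for x
  proof (cases "x \<in> ?A")
    case True
    then show ?thesis using p(2) by simp
  next
    case False
    then have "p x = x" using p(1) by (simp add: permutes_not_in)
    then show ?thesis using False by (simp add: in_keys_iff)
  qed
  then have "Poly_Mapping.map_key p m = m'"
    by (intro poly_mapping_eqI) (simp add: lookup_map_key[OF bij])
  with bij show ?thesis by blast
qed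

lemma Sym_mset_exponents_cong:
  assumes "f \<in> Sym" "mset (exponents m) = mset (exponents m')"
  shows "f m = f m'"
  using ex_bij_map_key[OF assms(2)] Sym_map_key[OF assms(1)] by metis

lemma Sym_subset_QSym: "Sym \<subseteq> QSym"
proof
  fix f assume f: "f \<in> Sym"
  show "f \<in> QSym"
    by (rule QSymI[OF Sym_bounded_degree[OF f]], rule Sym_mset_exponents_cong[OF f], rule arg_cong)
qed

lemma mset_exponents_map_key:
  assumes p: "bij p"
  shows "mset (exponents (Poly_Mapping.map_key p m)) = mset (exponents m)"
proof -
  have "Poly_Mapping.keys m = p ` (p -` Poly_Mapping.keys m)"
    using p by (simp add: surj_image_vimage_eq bij_is_surj)
  also have "mset_set \<dots> = image_mset p (mset_set (p -` Poly_Mapping.keys m))"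
    by (rule image_mset_mset_set[symmetric]) (meson bij_is_inj inj_on_subset p subset_UNIV)
  finally have "mset (exponents m) = image_mset (\<lambda>i. lk m (p i)) (mset_set (p -` Poly_Mapping.keys m))"
    by (simp add: mset_exponents multiset.map_comp comp_def)
  moreover have "lk (Poly_Mapping.map_key p m) = (\<lambda>i. lk m (p i))"
    by (rule ext) (rule lookup_map_key[OF p])
  ultimately show ?thesis
    by (simp add: mset_exponents keys_map_key bij_is_inj[OF p])
qed

lemma mdegree_map_key: "bij p \<Longrightarrow> mdegree (Poly_Mapping.map_key p m) = mdegree m"
  using mset_exponents_map_key[of p m] by (metis sum_list_exponents sum_mset_sum_list)

lemma Sym_series_one: "series_one \<in> Sym"
proof (rule SymI)
  show "bounded_degree series_one"
    unfolding bounded_degree_def series_one_def by (rule exI[of _ 0]) (simp add: mdegree_def)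
  fix p :: "nat \<Rightarrow> nat" and m :: monomial assume "bij p"
  then have "Poly_Mapping.map_key p m = 0 \<longleftrightarrow> m = 0"
    using mset_exponents_map_key[of p m] exponents_zero_iff by (metis mset_zero_iff)
  then show "series_one (Poly_Mapping.map_key p m) = series_one m" by (simp add: series_one_def)
qed

lemma Sym_complete_sym: "complete_sym n \<in> Sym"
proof (rule SymI)
  show "bounded_degree (complete_sym n)"
    unfolding bounded_degree_def complete_sym_def by (rule exI[of _ n]) simp
qed (simp add: complete_sym_def mdegree_map_key)

lemma Sym_series_mult:
  assumes f: "f \<in> Sym" and g: "g \<in> Sym"
  shows "series_mult f g \<in> Sym"
proof (rule SymI)
  obtain d e where d: "\<And>m. f m \<noteq> 0 \<Longrightarrow> mdegree m \<le> d" and e: "\<And>m. g m \<noteq> 0 \<Longrightarrow> mdegree m \<le> e"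
    using Sym_bounded_degree[OF f] Sym_bounded_degree[OF g] unfolding bounded_degree_def by blast
  show "bounded_degree (series_mult f g)"
    unfolding bounded_degree_def
  proof (intro exI allI impI)
    fix m assume "series_mult f g m \<noteq> 0"
    then obtain a b where ab: "a + b = m" "f a * g b \<noteq> 0"
      unfolding series_mult_def by (auto elim!: sum.not_neutral_contains_not_neutral)
    then have "mdegree a \<le> d" "mdegree b \<le> e" by (auto intro: d e)
    then show "mdegree m \<le> d + e"
      unfolding ab(1)[symmetric] mdegree_add by (rule add_mono)
  qed
  fix p :: "nat \<Rightarrow> nat" and m :: monomial assume p: "bij p"
  let ?k = "Poly_Mapping.map_key p :: monomial \<Rightarrow> monomial"
    and ?k' = "Poly_Mapping.map_key (inv p) :: monomial \<Rightarrow> monomial"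
  have p': "bij (inv p)" using p by (rule bij_imp_bij_inv)
  have inv: "?k (?k' a) = a" "?k' (?k a) = a" for a
    using p p' by (auto intro!: poly_mapping_eqI simp: lookup_map_key bij_is_surj surj_f_inv_f bij_is_inj)
  have plus: "?k (a + b) = ?k a + ?k b" "?k' (a + b) = ?k' a + ?k' b" for a b
    using p p' by (simp_all add: map_key_plus bij_is_inj)
  show "series_mult f g (?k m) = series_mult f g m"
    unfolding series_mult_def
  proof (rule sum.reindex_bij_witness[where i = "map_prod ?k ?k" and j = "map_prod ?k' ?k'"])
    fix x assume "x \<in> {(a, b). a + b = ?k m}"
    then show "map_prod ?k ?k (map_prod ?k' ?k' x) = x" "map_prod ?k' ?k' x \<in> {(a, b). a + b = m}"
      by (cases x, simp add: inv, cases x, simp add: inv flip: plus)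
    show "(case map_prod ?k' ?k' x of (a, b) \<Rightarrow> f a * g b) = (case x of (a, b) \<Rightarrow> f a * g b)"
      by (cases x) (simp add: Sym_map_key[OF f p'] Sym_map_key[OF g p'])
  next
    fix x assume "x \<in> {(a, b). a + b = m}"
    then show "map_prod ?k' ?k' (map_prod ?k ?k x) = x" "map_prod ?k ?k x \<in> {(a, b). a + b = ?k m}"
      by (cases x, simp add: inv, cases x, simp add: inv flip: plus)
  qed
qed

text \<open>A partition is encoded as the multiset of its parts.\<close>

definition monomial_sym :: "nat multiset \<Rightarrow> series" where
  "monomial_sym A = (\<lambda>m. if mset (exponents m) = A then 1 else 0)"

lemma Sym_monomial_sym: "monomial_sym A \<in> Sym"
proof (rule SymI)
  show "bounded_degree (monomial_sym A)"
    unfolding bounded_degree_def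
  proof (intro exI allI impI)
    fix m assume "monomial_sym A m \<noteq> 0"
    then have "mset (exponents m) = A"
      by (simp add: monomial_sym_def split: if_splits)
    then show "mdegree m \<le> sum_mset A" by (auto simp: sum_mset_sum_list sum_list_exponents)
  qed
qed (simp add: monomial_sym_def mset_exponents_map_key)

lemma monomial_qsym_singleton: "monomial_qsym [k] = monomial_sym {#k#}"
  by (simp add: monomial_qsym_def monomial_sym_def)

lemma Sym_power_sum: "monomial_qsym [k] \<in> Sym"
  by (simp add: monomial_qsym_singleton Sym_monomial_sym)

text \<open>Taking away only a piece of an exponent does not lower the number of variables, which
  exceeds the size of A; so a whole exponent k has to go. On monomials with that many variables the
  product is thus a multiple of one monomial symmetric function, the factor being the number of
  variables with exponent k.\<close>

lemma power_sum_mult_monomial_sym: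
  assumes k: "0 < k" and m: "size A < card (Poly_Mapping.keys m)"
  shows "series_mult (monomial_qsym [k]) (monomial_sym A) m =
    (if mset (exponents m) = add_mset k A then real (count (add_mset k A) k) else 0)"
proof -
  let ?m = "\<lambda>i. m - Poly_Mapping.single i k"
  have lk: "lk (?m i) j = (if j = i then lk m i - k else lk m j)" for i j
    by (simp add: lookup_minus lookup_single when_def)
  have *: "mset (exponents (?m i)) = A \<longleftrightarrow> lk m i = k \<and> mset (exponents m) = add_mset k A"
    if i: "i \<in> Poly_Mapping.keys m" "k \<le> lk m i" for i
  proof (cases "lk m i = k")
    case True
    have keys: "Poly_Mapping.keys (?m i) = Poly_Mapping.keys m - {i}"
      using True by (intro set_eqI) (auto simp: lk simp flip: lookup_not_eq_zero_eq_in_keys)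
    have "mset (exponents m) = add_mset (lk m i) (image_mset (lk m) (mset_set (Poly_Mapping.keys m - {i})))"
      unfolding mset_exponents using i(1) by (subst mset_set.remove[of _ i]) auto
    also have "image_mset (lk m) (mset_set (Poly_Mapping.keys m - {i})) = mset (exponents (?m i))"
      unfolding mset_exponents keys by (rule image_mset_cong) (simp add: lk)
    finally show ?thesis using True by simp
  next
    case False
    then have "Poly_Mapping.keys (?m i) = Poly_Mapping.keys m"
      using i by (intro set_eqI) (auto simp: lk simp flip: lookup_not_eq_zero_eq_in_keys)
    then have "size (mset (exponents (?m i))) = card (Poly_Mapping.keys m)"
      by (simp add: length_exponents)
    then show ?thesis using m False by auto
  qed
  let ?I = "{i. i \<in> Poly_Mapping.keys m \<and> k \<le> lk m i}"
  have "series_mult (monomial_qsym [k]) (monomial_sym A) m =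
      (\<Sum>i\<in>?I. if lk m i = k \<and> mset (exponents m) = add_mset k A then 1 else 0)"
    unfolding power_sum_mult[OF k] monomial_sym_def by (rule sum.cong[OF refl]) (simp add: *)
  also have "\<dots> = (if mset (exponents m) = add_mset k A then real (card {i\<in>Poly_Mapping.keys m. lk m i = k}) else 0)"
  proof -
    have "?I \<inter> {i. lk m i = k} = {i\<in>Poly_Mapping.keys m. lk m i = k}" by auto
    then show ?thesis by (simp add: sum.If_cases)
  qed
  also have "card {i\<in>Poly_Mapping.keys m. lk m i = k} = count (mset (exponents m)) k"
    unfolding mset_exponents count_image_mset'
    by (simp add: count_mset_set eq_commute[of k] Int_def conj_commute)
  finally show ?thesis by simp
qed

text \<open>Generation of Sym by power sums, in the form of an induction rule. The inner induction
  bounds the number of variables per monomial: the terms with l + 1 variables are removed by a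
  combination of products of a power sum with a monomial symmetric function of size l. The
  multiplicities can be divided out over the reals.\<close>

lemma Sym_induct [consumes 1, case_names one add scale power_sum]:
  assumes f: "f \<in> Sym"
    and one: "P series_one"
    and add: "\<And>f g. f \<in> Sym \<Longrightarrow> g \<in> Sym \<Longrightarrow> P f \<Longrightarrow> P g \<Longrightarrow> P (\<lambda>m. f m + g m)"
    and scale: "\<And>c f. f \<in> Sym \<Longrightarrow> P f \<Longrightarrow> P (\<lambda>m. c * f m)"
    and power_sum: "\<And>k f. 0 < k \<Longrightarrow> f \<in> Sym \<Longrightarrow> P f \<Longrightarrow> P (series_mult (monomial_qsym [k]) f)"
  shows "P f"
proof -
  have zero: "P (\<lambda>m. 0)" using scale[OF Sym_series_one one, of 0] by simp
  have sum: "P (\<lambda>m. \<Sum>i\<in>I. c i * g i m)" if "finite I" "\<And>i. i \<in> I \<Longrightarrow> g i \<in> Sym \<and> P (g i)"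
    for I :: "nat multiset set" and c g
    using that
  proof (induction I)
    case (insert i I)
    have gi: "g i \<in> Sym" "P (g i)" using insert.prems[OF insertI1] by auto
    have gI: "g j \<in> Sym" "P (g j)" if "j \<in> I" for j using insert.prems[OF insertI2[OF that]] by auto
    have "P (\<lambda>m. c i * g i m + (\<Sum>i\<in>I. c i * g i m))"
      by (rule add[OF subspace_series_scale[OF subspace_Sym gi(1)] subspace_series_sum[OF subspace_Sym gI(1)]
          scale[OF gi] insert.IH]) (simp_all add: gI)
    then show ?case using insert.hyps by (simp only: sum.insert not_False_eq_True)
  qed (simp add: zero)
  have "P f" if "f \<in> Sym" "\<And>m. f m \<noteq> 0 \<Longrightarrow> card (Poly_Mapping.keys m) \<le> l" for l f
    using that
  proof (induction l arbitrary: f)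
    case 0
    have "f = (\<lambda>m. f 0 * series_one m)"
    proof
      fix m show "f m = f 0 * series_one m"
        using "0.prems"(2)[of m] by (cases "m = 0") (auto simp: series_one_def)
    qed
    then show ?case using scale[OF Sym_series_one one, of "f 0"] by simp
  next
    case (Suc l)
    define S where "S = {mset (exponents m) |m. f m \<noteq> 0 \<and> card (Poly_Mapping.keys m) = Suc l}"
    \<comment> \<open>f depends only on the multiset of exponents, so any monomial chosen for B
      gives the coefficient.\<close>
    define v where "v B = f (SOME m. mset (exponents m) = B)" for B
    have v: "v (mset (exponents m)) = f m" for m
    proof -
      have "mset (exponents (SOME m'. mset (exponents m') = mset (exponents m))) = mset (exponents m)"
        by (rule someI[of "\<lambda>m'. mset (exponents m') = mset (exponents m)"]) (rule refl)
      then show ?thesis unfolding v_def by (rule Sym_mset_exponents_cong[OF Suc.prems(1)])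
    qed
    \<comment> \<open>Any part of B may be chosen for the power sum that is split off.\<close>
    define k where "k B = (SOME k. k \<in># B)" for B :: "nat multiset"
    define t where "t B = series_mult (monomial_qsym [k B]) (monomial_sym (B - {#k B#}))" for B
    have S: "size B = Suc l" "k B \<in># B" "0 < k B" if BS: "B \<in> S" for B
    proof -
      obtain m where m: "B = mset (exponents m)" "card (Poly_Mapping.keys m) = Suc l"
        using BS unfolding S_def by blast
      then show B: "size B = Suc l" by (simp add: length_exponents)
      then have "B \<noteq> {#}" by auto
      then have "\<exists>k. k \<in># B" by (rule multiset_nonemptyE) blast
      then show "k B \<in># B" unfolding k_def by (rule someI_ex)
      then show "0 < k B" using composition_exponents[of m] m(1) by (simp add: composition_def)
    qed
    have "finite S"
    proof -
      obtain d where "\<And>m. f m \<noteq> 0 \<Longrightarrow> mdegree m \<le> d"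
        using Sym_bounded_degree[OF Suc.prems(1)] unfolding bounded_degree_def by blast
      then have "S \<subseteq> mset ` {\<nu>. composition \<nu> \<and> sum_list \<nu> \<le> d}"
        unfolding S_def by (auto simp: sum_list_exponents composition_exponents intro!: imageI)
      then show ?thesis using finite_compositions_le finite_surj by blast
    qed
    have t: "t B \<in> Sym" "P (t B)" if "B \<in> S" for B
    proof -
      show "t B \<in> Sym" unfolding t_def by (rule Sym_series_mult[OF Sym_power_sum Sym_monomial_sym])
      have "P (monomial_sym (B - {#k B#}))"
      proof (rule Suc.IH[OF Sym_monomial_sym])
        fix m assume "monomial_sym (B - {#k B#}) m \<noteq> 0"
        then have "mset (exponents m) = B - {#k B#}"
          by (simp add: monomial_sym_def split: if_splits)
        then have "size (mset (exponents m)) = size (B - {#k B#})" by (rule arg_cong)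
        then show "card (Poly_Mapping.keys m) \<le> l"
          using S[OF that] by (simp add: length_exponents size_Diff_singleton)
      qed
      then show "P (t B)" unfolding t_def by (intro power_sum S(3)[OF that] Sym_monomial_sym)
    qed
    have t_eq: "t B m = (if mset (exponents m) = B then real (count B (k B)) else 0)"
      if "B \<in> S" "l < card (Poly_Mapping.keys m)" for B m
      unfolding t_def
      using S[OF that(1)] that(2) by (subst power_sum_mult_monomial_sym) (auto simp: size_Diff_singleton)
    \<comment> \<open>\<open>count B (k B)\<close> is the coefficient of \<open>t B\<close> at its
      monomials with l + 1 variables.\<close>
    define c where "c B = v B / real (count B (k B))" for B
    define g where "g = (\<lambda>m. \<Sum>B\<in>S. c B * t B m)"
    have g: "g \<in> Sym" "P g"
      unfolding g_def
      by (rule subspace_series_sum[OF subspace_Sym t(1)], assumption)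
        (rule sum[OF \<open>finite S\<close>], intro conjI t, assumption+)
    have g_eq: "g m = f m" if "l < card (Poly_Mapping.keys m)" for m
    proof -
      have "g m = (\<Sum>B\<in>S. if B = mset (exponents m) then c B * real (count B (k B)) else 0)"
        unfolding g_def using t_eq that by (intro sum.cong) auto
      also have "\<dots> = (\<Sum>B\<in>S. if B = mset (exponents m) then f m else 0)"
      proof (rule sum.cong[OF refl])
        fix B assume "B \<in> S"
        then have "k B \<in># B" by (rule S(2))
        then have "count B (k B) \<noteq> 0" by simp
        then have "c B * real (count B (k B)) = v B" by (simp add: c_def)
        then show "(if B = mset (exponents m) then c B * real (count B (k B)) else 0) =
            (if B = mset (exponents m) then f m else 0)"
          using v[of m] by presburger
      qed
      also have "\<dots> = (if mset (exponents m) \<in> S then f m else 0)"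
        using \<open>finite S\<close> by simp
      also have "\<dots> = f m"
      proof (cases "f m = 0")
        case False
        then have "card (Poly_Mapping.keys m) = Suc l" using Suc.prems(2)[of m] that by simp
        then have "mset (exponents m) \<in> S" using False by (auto simp: S_def)
        then show ?thesis by simp
      qed simp
      finally show ?thesis .
    qed
    \<comment> \<open>The difference f - g has no monomial with more than l variables, and f is
      recovered as (f - g) + g.\<close>
    have "P (\<lambda>m. f m + (- 1) * g m)"
    proof (rule Suc.IH)
      show "(\<lambda>m. f m + (- 1) * g m) \<in> Sym"
        by (intro subspace_series_add[OF subspace_Sym Suc.prems(1)] subspace_series_scale[OF subspace_Sym g(1)])
      fix m assume "f m + (- 1) * g m \<noteq> 0"
      then have "g m \<noteq> f m" by auto
      then show "card (Poly_Mapping.keys m) \<le> l" using g_eq by (meson not_le)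
    qed
    from add[OF subspace_series_add[OF subspace_Sym Suc.prems(1) subspace_series_scale[OF subspace_Sym g(1)]] g(1) this g(2)]
    have "P (\<lambda>m. (f m + (- 1) * g m) + g m)" .
    then show ?case by simp
  qed
  moreover obtain d where d: "\<And>m. f m \<noteq> 0 \<Longrightarrow> mdegree m \<le> d"
    using Sym_bounded_degree[OF f] unfolding bounded_degree_def by blast
  have "card (Poly_Mapping.keys m) \<le> d" if "f m \<noteq> 0" for m
    using composition_length_le[OF composition_exponents[of m]] d[OF that]
    by (simp add: sum_list_exponents length_exponents)
  ultimately show "P f" using f by blast
qed

section \<open>Newton's identities\<close>

text \<open>Double counting: a monomial of degree n arises once for each variable and each k from 1
  to its exponent, hence n times in all.\<close>

lemma newton_series:
  "(\<lambda>m. \<Sum>k\<in>{1..n}. 1 * series_mult (monomial_qsym [k]) (complete_sym (n - k)) m) =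
    (\<lambda>m. real n * complete_sym n m)"
proof
  fix m
  have "(\<Sum>k\<in>{1..n}. series_mult (monomial_qsym [k]) (complete_sym (n - k)) m) =
      (\<Sum>k\<in>{1..n}. \<Sum>i\<in>Poly_Mapping.keys m. if k \<le> lk m i \<and> mdegree m = n then 1 else 0)"
  proof (rule sum.cong[OF refl])
    fix k assume k: "k \<in> {1..n}"
    have "series_mult (monomial_qsym [k]) (complete_sym (n - k)) m =
        (\<Sum>i\<in>{i\<in>Poly_Mapping.keys m. k \<le> lk m i}. complete_sym (n - k) (m - Poly_Mapping.single i k))"
      using k by (subst power_sum_mult) auto
    also have "\<dots> = (\<Sum>i\<in>{i\<in>Poly_Mapping.keys m. k \<le> lk m i}. if mdegree m = n then 1 else 0)"
    proof (rule sum.cong[OF refl])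
      fix i assume i: "i \<in> {i\<in>Poly_Mapping.keys m. k \<le> lk m i}"
      then have "m = Poly_Mapping.single i k + (m - Poly_Mapping.single i k)"
        by (intro poly_mapping_eqI) (auto simp: lookup_add lookup_minus lookup_single when_def)
      then have "mdegree m = k + mdegree (m - Poly_Mapping.single i k)"
        by (metis mdegree_add mdegree_single)
      then show "complete_sym (n - k) (m - Poly_Mapping.single i k) = (if mdegree m = n then 1 else 0)"
        using k by (auto simp: complete_sym_def)
    qed
    also have "\<dots> = (\<Sum>i\<in>Poly_Mapping.keys m. if k \<le> lk m i \<and> mdegree m = n then 1 else 0)"
      by (rule sum.mono_neutral_cong_left) auto
    finally show "series_mult (monomial_qsym [k]) (complete_sym (n - k)) m = \<dots>" .
  qed
  also have "\<dots> = (\<Sum>i\<in>Poly_Mapping.keys m. \<Sum>k\<in>{1..n}. if k \<le> lk m i \<and> mdegree m = n then 1 else 0)"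
    by (rule sum.swap)
  also have "\<dots> = (\<Sum>i\<in>Poly_Mapping.keys m. if mdegree m = n then real (lk m i) else 0)"
  proof (rule sum.cong[OF refl])
    fix i assume i: "i \<in> Poly_Mapping.keys m"
    have "lk m i \<le> mdegree m" unfolding mdegree_def using i by (intro member_le_sum) auto
    then have "{1..n} \<inter> {k. k \<le> lk m i} = {1..lk m i}" if "mdegree m = n" using that by auto
    then show "(\<Sum>k\<in>{1..n}. if k \<le> lk m i \<and> mdegree m = n then 1 else 0) =
        (if mdegree m = n then real (lk m i) else 0)"
      by (simp add: sum.If_cases)
  qed
  also have "\<dots> = real n * complete_sym n m"
    by (auto simp: complete_sym_def mdegree_def)
  finally show "(\<Sum>k\<in>{1..n}. 1 * series_mult (monomial_qsym [k]) (complete_sym (n - k)) m) =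
      real n * complete_sym n m"
    by simp
qed

lemma algebra_hom_newton:
  assumes "algebra_hom_on Sym \<psi>"
  shows "real n * \<psi> (complete_sym n) = (\<Sum>k\<in>{1..n}. \<psi> (monomial_qsym [k]) * \<psi> (complete_sym (n - k)))"
proof -
  have \<psi>: "linear_functional_on Sym \<psi>" "\<And>f g. f \<in> Sym \<Longrightarrow> g \<in> Sym \<Longrightarrow> \<psi> (series_mult f g) = \<psi> f * \<psi> g"
    using assms unfolding algebra_hom_on_def by blast+
  have "real n * \<psi> (complete_sym n) = \<psi> (\<lambda>m. real n * complete_sym n m)"
    using linear_functional_on_scale[OF \<psi>(1) Sym_complete_sym] by simp
  also have "\<dots> = (\<Sum>k\<in>{1..n}. 1 * \<psi> (series_mult (monomial_qsym [k]) (complete_sym (n - k))))"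
    unfolding newton_series[symmetric]
    by (rule linear_functional_on_sum[OF subspace_Sym \<psi>(1) Sym_series_mult[OF Sym_power_sum Sym_complete_sym]])
  finally show ?thesis by (simp add: \<psi>(2) Sym_power_sum Sym_complete_sym)
qed

lemma complete_sym_0: "complete_sym 0 = series_one"
proof
  fix m
  have "mdegree m = 0 \<longleftrightarrow> m = 0"
    by (auto simp: mdegree_def in_keys_iff intro: poly_mapping_eqI)
  then show "complete_sym 0 m = series_one m" by (simp add: complete_sym_def series_one_def)
qed

text \<open>In Newton's identity p_n has the factor h_0 = 1, so the values at h_1, ..., h_n
  determine the value at p_n recursively; and power sums generate Sym.\<close>

lemma algebra_hom_Sym_eqI:
  assumes \<psi>: "algebra_hom_on Sym \<psi>" and \<psi>': "algebra_hom_on Sym \<psi>'"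
    and h: "\<And>n. \<psi> (complete_sym n) = \<psi>' (complete_sym n)"
    and f: "f \<in> Sym"
  shows "\<psi> f = \<psi>' f"
proof -
  have one: "\<psi> series_one = 1" "\<psi>' series_one = 1" and lin: "linear_functional_on Sym \<psi>" "linear_functional_on Sym \<psi>'"
    and mult: "\<And>f g. f \<in> Sym \<Longrightarrow> g \<in> Sym \<Longrightarrow> \<psi> (series_mult f g) = \<psi> f * \<psi> g"
      "\<And>f g. f \<in> Sym \<Longrightarrow> g \<in> Sym \<Longrightarrow> \<psi>' (series_mult f g) = \<psi>' f * \<psi>' g"
    using \<psi> \<psi>' unfolding algebra_hom_on_def by blast+
  have p: "\<psi> (monomial_qsym [n]) = \<psi>' (monomial_qsym [n])" if "0 < n" for n
    using that
  proof (induction n rule: less_induct)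
    case (less n)
    have "{1..n} = insert n {1..<n}" using less.prems by auto
    then have newton: "real n * \<eta> (complete_sym n) = \<eta> (monomial_qsym [n]) * \<eta> series_one +
        (\<Sum>k\<in>{1..<n}. \<eta> (monomial_qsym [k]) * \<eta> (complete_sym (n - k)))"
      if "algebra_hom_on Sym \<eta>" for \<eta>
      using algebra_hom_newton[OF that, of n] by (simp add: complete_sym_0)
    have "(\<Sum>k\<in>{1..<n}. \<psi> (monomial_qsym [k]) * \<psi> (complete_sym (n - k))) =
        (\<Sum>k\<in>{1..<n}. \<psi>' (monomial_qsym [k]) * \<psi>' (complete_sym (n - k)))"
      using less.IH h by (intro sum.cong) auto
    then show ?case using newton[OF \<psi>] newton[OF \<psi>'] h[of n] one by simp
  qed
  from f show ?thesis
  proof (induction rule: Sym_induct)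
    case one
    then show ?case using \<open>\<psi> series_one = 1\<close> \<open>\<psi>' series_one = 1\<close> by simp
  next
    case (add f g)
    then show ?case using linear_functional_on_add[OF lin(1)] linear_functional_on_add[OF lin(2)] by simp
  next
    case (scale c f)
    then show ?case using linear_functional_on_scale[OF lin(1)] linear_functional_on_scale[OF lin(2)] by simp
  next
    case (power_sum k f)
    then show ?case by (simp add: mult[OF Sym_power_sum] p)
  qed
qed

text \<open>Induction on the first factor: associativity brings a power sum to the front of the
  whole product, where the quasi-shuffle relation applies.\<close>

lemma algebra_hom_qsym_functional:
  assumes Nil: "\<phi> [] = 1"
    and shuffle: "\<And>k \<nu>. 0 < k \<Longrightarrow> composition \<nu> \<Longrightarrow> (\<Sum>\<mu>\<leftarrow>qshuffle k \<nu>. \<phi> \<mu>) = \<phi> [k] * \<phi> \<nu>"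
  shows "algebra_hom_on Sym (qsym_functional \<phi>)"
proof -
  let ?\<psi> = "qsym_functional \<phi>"
  have Q: "f \<in> QSym" if "f \<in> Sym" for f using Sym_subset_QSym that by (rule subsetD)
  have lin: "linear_functional_on Sym ?\<psi>"
    using linear_qsym_functional Q unfolding linear_functional_on_def by simp
  have "series_one = monomial_qsym []"
    by (rule ext) (simp add: series_one_def monomial_qsym_def exponents_zero_iff)
  then have one: "?\<psi> series_one = 1" using qsym_functional_monomial[of "[]" \<phi>] Nil by simp
  have p: "?\<psi> (series_mult (monomial_qsym [k]) f) = \<phi> [k] * ?\<psi> f" if "0 < k" "f \<in> Sym" for k f
    by (rule qsym_functional_power_sum_mult[OF that(1) Q[OF that(2)] shuffle[OF that(1)]])
  have "?\<psi> (series_mult f g) = ?\<psi> f * ?\<psi> g" if "f \<in> Sym" and g: "g \<in> Sym" for f g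
    using that(1)
  proof (induction rule: Sym_induct)
    case one
    then show ?case using \<open>?\<psi> series_one = 1\<close> by simp
  next
    case (add f f')
    then show ?case
      using linear_functional_on_add[OF lin] Sym_series_mult g by (simp add: series_mult_add_left distrib_right)
  next
    case (scale c f)
    then show ?case
      using linear_functional_on_scale[OF lin] Sym_series_mult g by (simp add: series_mult_scale_left)
  next
    case (power_sum k f)
    then show ?case using Sym_series_mult[OF _ g] by (simp add: series_mult_assoc p)
  qed
  then show ?thesis using lin one by (simp add: algebra_hom_on_def)
qed

section \<open>Geometry of the components\<close>

abbreviation unif :: "real measure" where "unif \<equiv> uniform_measure lborel {0..1}"

lemma prob_space_unif: "prob_space unif"
  by (rule prob_space_uniform_measure) simp_all

lemma AE_unif_neq: "AE x in unif. x \<noteq> a"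
proof (rule AE_uniform_measureI)
  show "AE x in lborel. x \<in> {0..1} \<longrightarrow> x \<noteq> a"
    using AE_lborel_singleton[of a] by eventually_elim simp
qed simp

lemma AE_unif_Icc: "AE x in unif. x \<in> {0..1}"
  by (rule AE_uniform_measureI) simp_all

lemma borel_measurable_unif [simp]: "borel_measurable unif = borel_measurable borel"
  by (rule measurable_cong_sets) simp_all

lemma connected_component_between:
  fixes x y z :: real
  assumes "connected_component S x z" "x \<le> y" "y \<le> z"
  shows "connected_component S x y"
proof -
  obtain T where T: "connected T" "T \<subseteq> S" "x \<in> T" "z \<in> T"
    using assms(1) by (auto simp: connected_component_def)
  then have "y \<in> T" using connected_contains_Icc[OF T(1,3,4)] assms(2,3) by auto
  with T show ?thesis by (auto simp: connected_component_def)
qed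

text \<open>The relation is a union of squares C \<times> C over the open components C; its
  measurability rests on this.\<close>

lemma open_connected_component_rel:
  fixes S :: "real set"
  assumes "open S"
  shows "open {(x, y). connected_component S x y}"
  unfolding open_prod_def
proof (safe)
  fix x y assume xy: "connected_component S x y"
  let ?C = "connected_component_set S x"
  have "open ?C" using assms by (rule open_connected_component)
  moreover have "(x, y) \<in> ?C \<times> ?C"
    using xy connected_component_in(1)[OF xy] by (simp add: connected_component_refl)
  moreover have "?C \<times> ?C \<subseteq> {(x, y). connected_component S x y}"
    by (auto intro: connected_component_trans connected_component_sym)
  ultimately show "\<exists>A B. open A \<and> open B \<and> (x, y) \<in> A \<times> B \<and> A \<times> B \<subseteq> {(x, y). connected_component S x y}"
    by blast
qed

section \<open>Components of U and V and their compatibility with the order\<close>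

locale open_pair =
  fixes U V :: "real set"
  assumes open_U: "open U" and open_V: "open V" and disjoint: "U \<inter> V = {}"
    and U_subset: "U \<subseteq> {0<..<1}" and V_subset: "V \<subseteq> {0<..<1}"
begin

abbreviation "su \<equiv> connected_component U"
abbreviation "sv \<equiv> connected_component V"
abbreviation "sm \<equiv> connected_component (U \<union> V)"

text \<open>A connected subset of the union cannot meet both sets, since they are open and
  disjoint.\<close>

lemma sm_iff: "sm x y \<longleftrightarrow> su x y \<or> sv x y"
proof
  assume "sm x y"
  then obtain T where T: "connected T" "T \<subseteq> U \<union> V" "x \<in> T" "y \<in> T"
    by (auto simp: connected_component_def)
  have "U \<inter> T = {} \<or> V \<inter> T = {}"
    using connectedD[OF T(1) open_U open_V _ T(2)] disjoint by auto
  then have "T \<subseteq> U \<or> T \<subseteq> V" using T(2) by blast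
  then show "su x y \<or> sv x y" using T by (auto simp: connected_component_def)
next
  assume "su x y \<or> sv x y"
  then show "sm x y" by (meson connected_component_of_subset sup_ge1 sup_ge2)
qed

lemma sm_sym: "sm x y \<Longrightarrow> sm y x"
  and sm_trans: "sm x y \<Longrightarrow> sm y z \<Longrightarrow> sm x z"
  and su_sym: "su x y \<Longrightarrow> su y x"
  and su_trans: "su x y \<Longrightarrow> su y z \<Longrightarrow> su x z"
  and sv_sym: "sv x y \<Longrightarrow> sv y x"
  and sv_trans: "sv x y \<Longrightarrow> sv y z \<Longrightarrow> sv x z"
  by (blast intro: connected_component_sym connected_component_trans)+

lemma su_sv_False: "su x y \<Longrightarrow> sv x z \<Longrightarrow> False"
  using connected_component_in(1)[of U x y] connected_component_in(1)[of V x z] disjoint by blast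

lemma sm_su: "sm a b \<Longrightarrow> su y a \<longleftrightarrow> su y b"
  unfolding sm_iff using su_trans su_sym sv_sym su_sv_False by metis

lemma sm_sv: "sm a b \<Longrightarrow> sv y a \<longleftrightarrow> sv y b"
  unfolding sm_iff using sv_trans su_sym sv_sym su_sv_False by metis

lemma sm_sm: "sm a b \<Longrightarrow> sm y a \<longleftrightarrow> sm y b"
  using sm_su sm_sv sm_iff by blast

lemma sm_su_left: "sm a b \<Longrightarrow> su a y \<longleftrightarrow> su b y"
  using sm_su su_sym by blast

lemma sm_sv_left: "sm a b \<Longrightarrow> sv a y \<longleftrightarrow> sv b y"
  using sm_sv sv_sym by blast

lemma sm_sm_left: "sm a b \<Longrightarrow> sm a y \<longleftrightarrow> sm b y"
  using sm_sm sm_sym by blast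

lemma sm_between: "sm x z \<Longrightarrow> x \<le> y \<Longrightarrow> y \<le> z \<Longrightarrow> sm x y"
  by (rule connected_component_between)

text \<open>Components are intervals, so a point outside one lies on the same side of all its
  points.\<close>

lemma sm_less: "sm a b \<Longrightarrow> \<not> sm y a \<Longrightarrow> y < a \<longleftrightarrow> y < b"
  using sm_between[of b a y] sm_between[of a b y] sm_sym sm_trans by (metis linear not_le)

lemma sm_less': "sm a b \<Longrightarrow> \<not> sm y a \<Longrightarrow> a < y \<longleftrightarrow> b < y"
  using sm_between[of b a y] sm_between[of a b y] sm_sym sm_trans by (metis linear not_le)

definition desc :: "real \<Rightarrow> real \<Rightarrow> bool" where
  "desc x y \<longleftrightarrow> \<not> sm x y \<and> x < y \<or> sv x y"

definition asc :: "real \<Rightarrow> real \<Rightarrow> bool" where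
  "asc x y \<longleftrightarrow> \<not> sm x y \<and> x < y \<or> su x y"

definition D :: "real \<Rightarrow> real \<Rightarrow> real" where "D x y = of_bool (desc x y)"
definition A :: "real \<Rightarrow> real \<Rightarrow> real" where "A x y = of_bool (asc x y)"
definition B :: "real \<Rightarrow> real \<Rightarrow> real" where "B x y = of_bool (su x y) - of_bool (sv x y)"

text \<open>The values of A, D, B are 1, 0, 1 on a component of U and 0, 1, -1 on a component of V;
  otherwise A = D and B = 0.\<close>

lemma A_eq: "A x y = D x y + B x y"
  using su_sv_False[of x y y] by (auto simp: A_def D_def B_def asc_def desc_def sm_iff of_bool_def)

lemma B_sym: "B x y = B y x"
  using su_sym sv_sym by (auto simp: B_def of_bool_def)

lemma desc_cong: "sm a b \<Longrightarrow> desc y a \<longleftrightarrow> desc y b"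
  unfolding desc_def using sm_sv[of a b y] sm_sm[of a b y] sm_less[of a b y] by blast

lemma desc_cong_left: "sm a b \<Longrightarrow> desc a y \<longleftrightarrow> desc b y"
  unfolding desc_def
  using sm_sv_left[of a b y] sm_sm_left[of a b y] sm_less'[of a b y] sm_sym by blast

text \<open>Lets \<open>D y a * D y b\<close> collapse to the factor at the smaller point when a and
  b share no component. If y shares a component of V with a, convexity keeps y below b.\<close>

lemma desc_less: "\<not> sm a b \<Longrightarrow> a < b \<Longrightarrow> desc y a \<Longrightarrow> desc y b"
proof -
  assume ab: "\<not> sm a b" "a < b" and "desc y a"
  then consider "\<not> sm y a" "y < a" | "sv y a" by (auto simp: desc_def)
  then show "desc y b"
  proof cases
    case 1
    then have "\<not> sm y b" using sm_between[of y b a] ab by auto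
    then show ?thesis using 1 ab by (simp add: desc_def)
  next
    case 2
    then have ya: "sm y a" by (simp add: sm_iff)
    then have nb: "\<not> sm y b" using ab sm_sym sm_trans by blast
    have "y < b"
    proof (rule ccontr)
      assume "\<not> y < b"
      then have "sm a b" using sm_between[of a y b] sm_sym[OF ya] ab by auto
      then show False using ab by simp
    qed
    then show ?thesis using nb by (simp add: desc_def)
  qed
qed

text \<open>A Rota-Baxter type identity; integrating it gives the quasi-shuffle relation.\<close>

lemma rota_baxter:
  assumes "a \<noteq> b"
  shows "D y a * D y b = D y a * D a b + D y b * D b a + D y b * B a b"
proof (cases "sm a b")
  case True
  then have y: "D y a = D y b" using desc_cong by (simp add: D_def)
  \<comment> \<open>Both kernels from y agree here, with value 0 or 1, so the three coefficients
    have to add up to 1: they are 0 + 0 + 1 on a component of U and 1 + 1 - 1 on one of V.\<close>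
  show ?thesis
  proof (cases "su a b")
    case True
    then have "\<not> sv a b" using su_sv_False by blast
    then have "D a b = 0" "D b a = 0" "B a b = 1"
      using True \<open>sm a b\<close> sm_sym[OF \<open>sm a b\<close>] sv_sym[of b a] by (auto simp: D_def desc_def B_def)
    then show ?thesis using y by (simp add: D_def)
  next
    case False
    then have "sv a b" using True by (simp add: sm_iff)
    then have "D a b = 1" "D b a = 1" "B a b = - 1"
      using False sv_sym[of a b] by (auto simp: D_def desc_def B_def)
    then show ?thesis using y by (simp add: D_def)
  qed
next
  case False
  then have ns: "\<not> sm b a" "\<not> su a b" "\<not> sv a b" "\<not> sv b a" using sm_sym by (auto simp: sm_iff)
  then have B: "B a b = 0" by (simp add: B_def)
  show ?thesis
  proof (cases "a < b")
    case True
    then have "D a b = 1" "D b a = 0" using False ns by (auto simp: D_def desc_def)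
    then show ?thesis using desc_less[OF False True, of y] B by (simp add: D_def)
  next
    case ba: False
    \<comment> \<open>A tie outside U and V is excluded at this point: it would make the right side
      0 while the left side can be 1.\<close>
    then have "b < a" using assms by simp
    then have "D a b = 0" "D b a = 1" using False ns by (auto simp: D_def desc_def)
    then show ?thesis using desc_less[OF ns(1) \<open>b < a\<close>, of y] B by (simp add: D_def)
  qed
qed

section \<open>Measurability\<close>

lemma measurable_su [measurable]: "Measurable.pred (borel \<Otimes>\<^sub>M borel) (\<lambda>p. su (fst p) (snd p))"
  and measurable_sv [measurable]: "Measurable.pred (borel \<Otimes>\<^sub>M borel) (\<lambda>p. sv (fst p) (snd p))"
proof -
  have "Measurable.pred (borel \<Otimes>\<^sub>M borel) (\<lambda>p. connected_component S (fst p) (snd p))" if "open S" for S :: "real set"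
  proof -
    have "{(x, y). connected_component S x y} \<in> sets borel"
      using open_connected_component_rel[OF that] by (rule borel_open)
    then have "{(x, y). connected_component S x y} \<in> sets (borel \<Otimes>\<^sub>M borel)"
      by (simp only: borel_prod)
    then show ?thesis
      by (simp add: pred_def space_pair_measure case_prod_unfold)
  qed
  then show "Measurable.pred (borel \<Otimes>\<^sub>M borel) (\<lambda>p. su (fst p) (snd p))"
    "Measurable.pred (borel \<Otimes>\<^sub>M borel) (\<lambda>p. sv (fst p) (snd p))"
    using open_U open_V by blast+
qed

lemma measurable_su' [measurable (raw)]:
  "f \<in> borel_measurable N \<Longrightarrow> g \<in> borel_measurable N \<Longrightarrow> Measurable.pred N (\<lambda>x. su (f x) (g x))"
  using measurable_compose[OF measurable_Pair measurable_su, of f N g] by simp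

lemma measurable_sv' [measurable (raw)]:
  "f \<in> borel_measurable N \<Longrightarrow> g \<in> borel_measurable N \<Longrightarrow> Measurable.pred N (\<lambda>x. sv (f x) (g x))"
  using measurable_compose[OF measurable_Pair measurable_sv, of f N g] by simp

lemma measurable_D [measurable (raw)]:
  assumes [measurable]: "f \<in> borel_measurable N" "g \<in> borel_measurable N"
  shows "(\<lambda>x. D (f x) (g x)) \<in> borel_measurable N"
  unfolding D_def desc_def sm_iff of_bool_def by measurable

lemma measurable_B [measurable (raw)]:
  assumes [measurable]: "f \<in> borel_measurable N" "g \<in> borel_measurable N"
  shows "(\<lambda>x. B (f x) (g x)) \<in> borel_measurable N"
  unfolding B_def of_bool_def by measurable

lemma measurable_A [measurable (raw)]:
  assumes [measurable]: "f \<in> borel_measurable N" "g \<in> borel_measurable N"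
  shows "(\<lambda>x. A (f x) (g x)) \<in> borel_measurable N"
  unfolding A_eq by measurable

lemma abs_D_le: "\<bar>D x y\<bar> \<le> 1" and abs_A_le: "\<bar>A x y\<bar> \<le> 1" and abs_B_le: "\<bar>B x y\<bar> \<le> 1"
  by (auto simp: D_def A_def B_def of_bool_def)

end

sublocale open_pair \<subseteq> unif: prob_space unif
  by (rule prob_space_unif)

context open_pair
begin

lemma integrable_unif:
  fixes f :: "real \<Rightarrow> real"
  assumes "f \<in> borel_measurable borel" "\<And>x. \<bar>f x\<bar> \<le> C"
  shows "integrable unif f"
  by (rule unif.integrable_const_bound[of _ C]) (use assms in auto)

text \<open>For a non-integrable function the integral is 0 by convention and the bound still
  holds.\<close>

lemma abs_integral_unif_le:
  fixes f :: "real \<Rightarrow> real"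
  assumes "\<And>x. \<bar>f x\<bar> \<le> 1"
  shows "\<bar>LINT x|unif. f x\<bar> \<le> 1"
proof (cases "integrable unif f")
  case True
  have "\<bar>LINT x|unif. f x\<bar> \<le> (LINT x|unif. \<bar>f x\<bar>)" by (rule integral_abs_bound)
  also have "\<dots> \<le> 1"
    by (rule unif.integral_le_const) (use True assms in auto)
  finally show ?thesis .
qed (simp add: not_integrable_integral_eq)

section \<open>Iterated integrals and the quasi-shuffle relation\<close>

definition s :: "real \<Rightarrow> real" where "s x = (LINT y|unif. B x y)"

lemma measurable_s [measurable]: "s \<in> borel_measurable borel"
  unfolding s_def by measurable

lemma abs_s_le: "\<bar>s x\<bar> \<le> 1"
  unfolding s_def by (rule abs_integral_unif_le) (rule abs_B_le)

lemma abs_s_power_le: "\<bar>s x ^ n\<bar> \<le> 1"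
  by (simp add: power_abs power_le_one abs_s_le)

text \<open>The base point y stands for the position of the preceding block. A block of c letters
  has one free position x and c - 1 further letters in the same component, each integrating to
  \<open>s x\<close>.\<close>

primrec \<Phi> :: "nat list \<Rightarrow> real \<Rightarrow> real" where
  "\<Phi> [] y = 1"
| "\<Phi> (c # \<nu>) y = (LINT x|unif. D y x * s x ^ (c - 1) * \<Phi> \<nu> x)"

lemma abs_mult_le_1: "\<bar>a\<bar> \<le> 1 \<Longrightarrow> \<bar>b\<bar> \<le> 1 \<Longrightarrow> \<bar>a * b\<bar> \<le> (1 :: real)"
  by (simp add: abs_mult mult_le_one)

lemma abs_\<Phi>_le: "\<bar>\<Phi> \<nu> y\<bar> \<le> 1"
  by (induction \<nu> arbitrary: y)
    (auto intro!: abs_integral_unif_le abs_mult_le_1 abs_D_le abs_s_power_le)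

lemma measurable_\<Phi> [measurable]: "\<Phi> \<nu> \<in> borel_measurable borel"
proof (induction \<nu>)
  case (Cons c \<nu>)
  note [measurable] = Cons
  show ?case unfolding \<Phi>.simps by measurable
qed simp

lemma s_cong: "sm a b \<Longrightarrow> s a = s b"
  unfolding s_def B_def using sm_su_left sm_sv_left by simp

lemma \<Phi>_cong: "sm a b \<Longrightarrow> \<Phi> \<nu> a = \<Phi> \<nu> b"
  using desc_cong_left by (cases \<nu>) (simp_all add: D_def)

text \<open>\<open>B a\<close> is supported on the component of a, where g is constant.\<close>

lemma integral_B:
  assumes "\<And>b. sm a b \<Longrightarrow> g b = g a"
  shows "(LINT b|unif. B a b * g b) = s a * g a"
proof -
  have "B a b * g b = B a b * g a" for b
    using assms[of b] by (auto simp: B_def sm_iff of_bool_def)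
  then have "(LINT b|unif. B a b * g b) = (LINT b|unif. B a b * g a)" by (simp only:)
  then show ?thesis by (simp add: s_def)
qed

lemma sum_list_\<Phi>_Cons:
  "(\<Sum>\<mu>\<leftarrow>xs. \<Phi> (c # \<mu>) y) = (LINT x|unif. D y x * s x ^ (c - 1) * (\<Sum>\<mu>\<leftarrow>xs. \<Phi> \<mu> x))"
proof (induction xs)
  case (Cons \<mu> xs)
  have 1: "integrable unif (\<lambda>x. D y x * s x ^ (c - 1) * \<Phi> \<mu> x)"
    by (rule integrable_unif[of _ 1]) (measurable, intro abs_mult_le_1 abs_D_le abs_s_power_le abs_\<Phi>_le)
  have bound: "\<bar>\<Sum>\<mu>\<leftarrow>xs. \<Phi> \<mu> x\<bar> \<le> real (length xs)" for x
  proof (induction xs)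
    case (Cons \<mu> xs)
    then show ?case using abs_\<Phi>_le[of \<mu> x] by simp
  qed simp
  have meas: "(\<lambda>x. \<Sum>\<mu>\<leftarrow>xs. \<Phi> \<mu> x) \<in> borel_measurable borel"
    by (induction xs) simp_all
  have 2: "integrable unif (\<lambda>x. D y x * s x ^ (c - 1) * (\<Sum>\<mu>\<leftarrow>xs. \<Phi> \<mu> x))"
  proof (rule integrable_unif[of _ "1 * real (length xs)"])
    show "(\<lambda>x. D y x * s x ^ (c - 1) * (\<Sum>\<mu>\<leftarrow>xs. \<Phi> \<mu> x)) \<in> borel_measurable borel"
      using meas by measurable
    show "\<bar>D y x * s x ^ (c - 1) * (\<Sum>\<mu>\<leftarrow>xs. \<Phi> \<mu> x)\<bar> \<le> 1 * real (length xs)" for x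
      unfolding abs_mult[of "D y x * s x ^ (c - 1)"]
      by (intro mult_mono abs_mult_le_1 abs_D_le abs_s_power_le bound) simp_all
  qed
  show ?case
    unfolding list.map sum_list.Cons Cons.IH
    by (simp only: distrib_left Bochner_Integration.integral_add[OF 1 2] \<Phi>.simps)
qed simp

lemma \<Phi>_singleton: "\<Phi> [k] y = (LINT x|unif. D y x * s x ^ (k - 1))"
  by simp

text \<open>The product is a double integral of \<open>D y a * D y b\<close>, with weight
  \<open>v a\<close> for the letter k and \<open>w b\<close> for the word \<open>c # \<nu>\<close>.
  In \<open>rota_baxter\<close> the first term places k before c; the second places it behind c,
  where the induction hypothesis applies with base point b; the third merges the two into c +
  k.\<close>

theorem \<Phi>_qshuffle:
  assumes "0 < k" "composition \<nu>"
  shows "(\<Sum>\<mu>\<leftarrow>qshuffle k \<nu>. \<Phi> \<mu> y) = \<Phi> [k] y * \<Phi> \<nu> y"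
  using assms
proof (induction \<nu> arbitrary: y)
  case (Cons c \<nu>)
  have c: "0 < c" and k: "0 < k" and \<nu>: "composition \<nu>" using Cons.prems by auto
  define v where "v a = s a ^ (k - 1)" for a
  define w where "w b = s b ^ (c - 1) * \<Phi> \<nu> b" for b
  have [measurable]: "v \<in> borel_measurable borel" "w \<in> borel_measurable borel"
    unfolding v_def w_def by measurable
  have v: "\<bar>v a\<bar> \<le> 1" and w: "\<bar>w a\<bar> \<le> 1" for a
    unfolding v_def w_def by (intro abs_s_power_le abs_mult_le_1 abs_\<Phi>_le)+
  note le = abs_mult_le_1 abs_D_le abs_B_le v w
  interpret P: pair_prob_space unif unif ..
  let ?f1 = "\<lambda>a b. D y a * v a * (D a b * w b)"
  let ?f2 = "\<lambda>a b. D y b * w b * (D b a * v a)"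
  let ?f3 = "\<lambda>a b. D y b * w b * (B a b * v a)"
  have int: "integrable unif (\<lambda>a. ?f1 a b)" "integrable unif (\<lambda>a. ?f2 a b)" "integrable unif (\<lambda>a. ?f3 a b)" for b
    by (rule integrable_unif[of _ 1], measurable, intro le)+
  have int': "integrable unif (\<lambda>b. LINT a|unif. ?f1 a b)" "integrable unif (\<lambda>b. LINT a|unif. ?f2 a b)"
    "integrable unif (\<lambda>b. LINT a|unif. ?f3 a b)"
    by (rule integrable_unif[of _ 1], measurable, intro abs_integral_unif_le le)+
  have 1: "\<Phi> (k # c # \<nu>) y = (LINT b|unif. LINT a|unif. ?f1 a b)"
  proof -
    have "\<Phi> (k # c # \<nu>) y = (LINT a|unif. LINT b|unif. ?f1 a b)"
      by (simp add: v_def w_def mult.assoc)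
    \<comment> \<open>\<open>\<Phi>\<close> has the position a of k outside, the other two terms
      have b outside; the bounded integrand allows the exchange.\<close>
    also have "\<dots> = (LINT b|unif. LINT a|unif. ?f1 a b)"
    proof (rule P.Fubini_integral[symmetric])
      show "integrable (unif \<Otimes>\<^sub>M unif) (\<lambda>(a, b). ?f1 a b)"
      proof (rule P.integrable_const_bound[of _ 1])
        show "AE x in unif \<Otimes>\<^sub>M unif. norm (case x of (a, b) \<Rightarrow> ?f1 a b) \<le> 1"
          unfolding split_beta real_norm_def by (intro AE_I2 le)
        have "(\<lambda>(a, b). ?f1 a b) \<in> borel_measurable (borel \<Otimes>\<^sub>M borel)" by measurable
        then show "(\<lambda>(a, b). ?f1 a b) \<in> borel_measurable (unif \<Otimes>\<^sub>M unif)"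
          by (subst measurable_cong_sets[OF sets_pair_measure_cong refl]) auto
      qed
    qed
    finally show ?thesis .
  qed
  have 2: "(\<Sum>\<mu>\<leftarrow>qshuffle k \<nu>. \<Phi> (c # \<mu>) y) = (LINT b|unif. LINT a|unif. ?f2 a b)"
    unfolding sum_list_\<Phi>_Cons
  proof (rule Bochner_Integration.integral_cong[OF refl])
    fix b
    show "D y b * s b ^ (c - 1) * (\<Sum>\<mu>\<leftarrow>qshuffle k \<nu>. \<Phi> \<mu> b) = (LINT a|unif. ?f2 a b)"
      unfolding Cons.IH[OF k \<nu>] \<Phi>_singleton by (simp add: v_def w_def)
  qed
  have 3: "\<Phi> ((c + k) # \<nu>) y = (LINT b|unif. LINT a|unif. ?f3 a b)"
    unfolding \<Phi>.simps
  proof (rule Bochner_Integration.integral_cong[OF refl])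
    fix b
    have "(LINT a|unif. B a b * v a) = s b * v b"
      unfolding B_sym[of _ b] v_def by (rule integral_B) (simp add: s_cong)
    \<comment> \<open>The exponent splits as (c - 1) + 1 + (k - 1); the middle factor
      \<open>s b\<close> comes from integrating a over the component of b.\<close>
    moreover have "s b ^ (c + k - 1) = s b ^ (c - 1) * (s b * s b ^ (k - 1))"
      using c k by (simp flip: power_add power_Suc)
    ultimately show "D y b * s b ^ (c + k - 1) * \<Phi> \<nu> b = (LINT a|unif. ?f3 a b)"
      by (simp add: v_def w_def)
  qed
  have k_eq: "\<Phi> [k] y = (LINT a|unif. D y a * v a)"
    by (simp add: v_def)
  have c_eq: "\<Phi> (c # \<nu>) y = (LINT b|unif. D y b * w b)"
    by (simp add: w_def mult.assoc)
  have "\<Phi> [k] y * \<Phi> (c # \<nu>) y = (LINT b|unif. D y b * w b * (LINT a|unif. D y a * v a))"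
    unfolding k_eq c_eq by (simp add: mult.commute)
  also have "\<dots> = (LINT b|unif. (LINT a|unif. ?f1 a b) + (LINT a|unif. ?f2 a b) + (LINT a|unif. ?f3 a b))"
  proof (rule Bochner_Integration.integral_cong[OF refl])
    fix b
    have "D y b * w b * (LINT a|unif. D y a * v a) = (LINT a|unif. D y b * w b * (D y a * v a))"
      by simp
    also have "\<dots> = (LINT a|unif. ?f1 a b + ?f2 a b + ?f3 a b)"
    \<comment> \<open>The diagonal a = b, where the kernel identity may fail, is a null set for
      fixed b.\<close>
    proof (rule integral_cong_AE)
      show "AE a in unif. D y b * w b * (D y a * v a) = ?f1 a b + ?f2 a b + ?f3 a b"
        using AE_unif_neq[of b]
      proof eventually_elim
        case (elim a)
        have "D y b * w b * (D y a * v a) = (D y a * D y b) * (v a * w b)" by (simp add: ac_simps)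
        also have "\<dots> = ?f1 a b + ?f2 a b + ?f3 a b"
          unfolding rota_baxter[OF elim] by (simp add: algebra_simps)
        finally show ?case .
      qed
    qed (unfold borel_measurable_unif, measurable)
    also have "\<dots> = (LINT a|unif. ?f1 a b) + (LINT a|unif. ?f2 a b) + (LINT a|unif. ?f3 a b)"
      using int by simp
    finally show "D y b * w b * (LINT a|unif. D y a * v a) =
        (LINT a|unif. ?f1 a b) + (LINT a|unif. ?f2 a b) + (LINT a|unif. ?f3 a b)" .
  qed
  also have "\<dots> = \<Phi> (k # c # \<nu>) y + (\<Sum>\<mu>\<leftarrow>qshuffle k \<nu>. \<Phi> (c # \<mu>) y) + \<Phi> ((c + k) # \<nu>) y"
    unfolding 1 2 3 using int' by simp
  finally show ?case by (simp add: comp_def del: \<Phi>.simps)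
qed simp

end

context open_pair
begin

section \<open>The probability of a permutation\<close>

definition K :: "nat \<Rightarrow> nat \<Rightarrow> real \<Rightarrow> real \<Rightarrow> real" where
  "K i j = (if i < j then A else D)"

lemma measurable_K [measurable (raw)]:
  assumes [measurable]: "f \<in> borel_measurable N" "g \<in> borel_measurable N"
  shows "(\<lambda>x. K i j (f x) (g x)) \<in> borel_measurable N"
  unfolding K_def by simp

lemma abs_K_le: "\<bar>K i j x y\<bar> \<le> 1"
  by (simp add: K_def abs_A_le abs_D_le)

text \<open>For distinct letters, the conditional probability of the order w given the value x of
  \<xi> at the first letter.\<close>

fun chain_integral :: "nat list \<Rightarrow> real \<Rightarrow> real" where
  "chain_integral [] x = 1"
| "chain_integral [i] x = 1"
| "chain_integral (i # j # w) x = (LINT y|unif. K i j x y * chain_integral (j # w) y)"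

lemma integrable_D_term: "integrable unif (\<lambda>y. D x y * (s y ^ n * \<Phi> \<nu> y))"
  and integrable_B_term: "integrable unif (\<lambda>y. B x y * (s y ^ n * \<Phi> \<nu> y))"
  by (rule integrable_unif[of _ 1], measurable, intro abs_mult_le_1 abs_D_le abs_B_le abs_s_power_le abs_\<Phi>_le)+

text \<open>Induction along \<open>zs\<close>. A descent has kernel D and prepends a part 1. At an
  ascent the summand D again starts a new part, while B enlarges the first part: its integral yields
  one more factor \<open>s x\<close>, because the rest is constant on components. The position x of
  the first block is still free, whence the split of \<mu> into head and tail.\<close>

lemma chain_integral_eq:
  "w \<noteq> [] \<Longrightarrow> chain_integral w x = (\<Sum>\<mu>\<in>refinements (zs w). s x ^ (hd \<mu> - 1) * \<Phi> (tl \<mu>) x)"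
proof (induction w arbitrary: x rule: zs.induct)
  case (2 i)
  have "refinements [1] = {[1]}" using refinements_Cons_1[of "[]"] by (simp add: refinements_Nil)
  then show ?case by simp
next
  case (3 i j w)
  obtain c \<nu> where r: "zs (j # w) = c # \<nu>" "0 < c"
    using zs_eq_Nil_iff[of "j # w"] composition_zs[of "j # w"] by (cases "zs (j # w)") auto
  let ?R = "refinements (c # \<nu>)"
  let ?g = "\<lambda>\<mu> y. s y ^ (hd \<mu> - 1) * \<Phi> (tl \<mu>) y"
  have IH: "chain_integral (j # w) y = (\<Sum>\<mu>\<in>?R. ?g \<mu> y)" for y
    using 3 r(1) by simp
  have R: "\<mu> = hd \<mu> # tl \<mu>" "0 < hd \<mu>" if "\<mu> \<in> ?R" for \<mu>
    using refinements_ConsE[OF r(2) that] by (metis list.sel)+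
  have fin: "finite ?R" by (rule finite_refinements)
  have D: "(LINT y|unif. D x y * (\<Sum>\<mu>\<in>?R. ?g \<mu> y)) = (\<Sum>\<mu>\<in>?R. \<Phi> \<mu> x)"
  proof -
    have "(LINT y|unif. D x y * (\<Sum>\<mu>\<in>?R. ?g \<mu> y)) = (\<Sum>\<mu>\<in>?R. LINT y|unif. D x y * ?g \<mu> y)"
      unfolding sum_distrib_left by (rule Bochner_Integration.integral_sum) (rule integrable_D_term)
    also have "\<dots> = (\<Sum>\<mu>\<in>?R. \<Phi> (hd \<mu> # tl \<mu>) x)"
      by (simp add: mult.assoc)
    finally show ?thesis using R(1) by simp
  qed
  have inj1: "inj_on ((#) 1) ?R" by simp
  have sum1: "(\<Sum>\<mu>\<in>(#) 1 ` ?R. ?g \<mu> x) = (\<Sum>\<mu>\<in>?R. \<Phi> \<mu> x)"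
    by (subst sum.reindex[OF inj1]) simp
  show ?case
  proof (cases "i < j")
    case False
    then have zs: "zs (i # j # w) = 1 # c # \<nu>" using r by simp
    have lhs: "chain_integral (i # j # w) x = (\<Sum>\<mu>\<in>?R. \<Phi> \<mu> x)"
      using False D by (simp only: chain_integral.simps K_def if_False IH)
    show ?thesis unfolding lhs zs refinements_Cons_1 sum1 ..
  next
    case True
    then have zs: "zs (i # j # w) = Suc c # \<nu>" using r by simp
    have B: "(LINT y|unif. B x y * (\<Sum>\<mu>\<in>?R. ?g \<mu> y)) = (\<Sum>\<mu>\<in>?R. s x ^ hd \<mu> * \<Phi> (tl \<mu>) x)"
    proof -
      have "(LINT y|unif. B x y * (\<Sum>\<mu>\<in>?R. ?g \<mu> y)) = (\<Sum>\<mu>\<in>?R. LINT y|unif. B x y * ?g \<mu> y)"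
        unfolding sum_distrib_left by (rule Bochner_Integration.integral_sum) (rule integrable_B_term)
      also have "\<dots> = (\<Sum>\<mu>\<in>?R. s x ^ hd \<mu> * \<Phi> (tl \<mu>) x)"
      proof (rule sum.cong[OF refl])
        fix \<mu> assume "\<mu> \<in> ?R"
        then have "0 < hd \<mu>" by (rule R(2))
        then have "s x ^ hd \<mu> = s x * s x ^ (hd \<mu> - 1)" by (simp add: power_eq_if)
        moreover have "(LINT y|unif. B x y * ?g \<mu> y) = s x * ?g \<mu> x"
          by (rule integral_B) (metis s_cong \<Phi>_cong)
        ultimately show "(LINT y|unif. B x y * ?g \<mu> y) = s x ^ hd \<mu> * \<Phi> (tl \<mu>) x" by simp
      qed
      finally show ?thesis .
    qed
    have int: "integrable unif (\<lambda>y. D x y * (\<Sum>\<mu>\<in>?R. ?g \<mu> y))" "integrable unif (\<lambda>y. B x y * (\<Sum>\<mu>\<in>?R. ?g \<mu> y))"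
      unfolding sum_distrib_left
      by (rule Bochner_Integration.integrable_sum, rule integrable_D_term integrable_B_term)+
    have "chain_integral (i # j # w) x =
        (LINT y|unif. D x y * (\<Sum>\<mu>\<in>?R. ?g \<mu> y) + B x y * (\<Sum>\<mu>\<in>?R. ?g \<mu> y))"
      using True by (simp add: K_def IH A_eq distrib_right)
    also have "\<dots> = (\<Sum>\<mu>\<in>?R. \<Phi> \<mu> x) + (\<Sum>\<mu>\<in>?R. s x ^ hd \<mu> * \<Phi> (tl \<mu>) x)"
      unfolding Bochner_Integration.integral_add[OF int] D B ..
    finally have lhs: "chain_integral (i # j # w) x = \<dots>" .
    let ?inc = "\<lambda>\<mu>. Suc (hd \<mu>) # tl \<mu>"
    have inj2: "inj_on ?inc ?R"
    proof (rule inj_onI)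
      fix \<mu> \<mu>' assume "\<mu> \<in> ?R" "\<mu>' \<in> ?R" "?inc \<mu> = ?inc \<mu>'"
      then show "\<mu> = \<mu>'" using R(1)[of \<mu>] R(1)[of \<mu>'] by simp
    qed
    \<comment> \<open>Incremented heads are at least 2, so no refinement arises from both
      choices.\<close>
    have disj: "(#) 1 ` ?R \<inter> ?inc ` ?R = {}"
      using R(2) by fastforce
    have "(\<Sum>\<mu>\<in>?inc ` ?R. ?g \<mu> x) = (\<Sum>\<mu>\<in>?R. s x ^ hd \<mu> * \<Phi> (tl \<mu>) x)"
      by (subst sum.reindex[OF inj2]) simp
    then show ?thesis
      unfolding lhs zs refinements_Cons_Suc[OF r(2)]
      by (subst sum.union_disjoint) (simp_all only: fin finite_imageI disj sum1)
  qed
qed simp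

section \<open>From the order event to an iterated integral\<close>

lemma left_of_iff:
  "i < j \<Longrightarrow> left_of U V \<xi> i j \<longleftrightarrow> asc (\<xi> i) (\<xi> j)"
  "j < i \<Longrightarrow> left_of U V \<xi> i j \<longleftrightarrow> desc (\<xi> i) (\<xi> j)"
  by (auto simp: left_of_def asc_def desc_def)

lemma left_of_irrefl: "\<not> left_of U V \<xi> i i"
  by (simp add: left_of_def)

text \<open>Convexity of the components makes \<open>left_of\<close> a strict order, so only
  adjacent letters of a word need to be compared.\<close>

lemma left_of_trans:
  assumes ij: "left_of U V \<xi> i j" and jk: "left_of U V \<xi> j k"
  shows "left_of U V \<xi> i k"
proof -
  consider "sm (\<xi> i) (\<xi> j)" "sm (\<xi> j) (\<xi> k)" | "\<not> sm (\<xi> i) (\<xi> j)" "sm (\<xi> j) (\<xi> k)"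
    | "sm (\<xi> i) (\<xi> j)" "\<not> sm (\<xi> j) (\<xi> k)" | "\<not> sm (\<xi> i) (\<xi> j)" "\<not> sm (\<xi> j) (\<xi> k)"
    by blast
  then show ?thesis
  proof cases
    case 1
    then have "su (\<xi> i) (\<xi> j) \<and> i < j \<or> sv (\<xi> i) (\<xi> j) \<and> j < i"
      "su (\<xi> j) (\<xi> k) \<and> j < k \<or> sv (\<xi> j) (\<xi> k) \<and> k < j"
      using ij jk by (auto simp: left_of_def)
    then show ?thesis
      unfolding left_of_def using su_trans sv_trans su_sv_False su_sym sv_sym by (meson less_trans)
  next
    case 2
    then have "\<xi> i < \<xi> j" using ij by (auto simp: left_of_def sm_iff)
    moreover have "\<not> sm (\<xi> i) (\<xi> k)" using 2 sm_sm by blast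
    ultimately show ?thesis
      using 2 sm_less[OF 2(2) 2(1)] by (simp add: left_of_def)
  next
    case 3
    then have "\<xi> j < \<xi> k" using jk by (auto simp: left_of_def sm_iff)
    moreover have "\<not> sm (\<xi> k) (\<xi> j)" using 3 sm_sym by blast
    moreover have "\<not> sm (\<xi> i) (\<xi> k)" using 3 sm_sm_left by blast
    ultimately show ?thesis
      using sm_less'[OF sm_sym[OF 3(1)]] by (simp add: left_of_def)
  next
    case 4
    then have *: "\<xi> i < \<xi> j" "\<xi> j < \<xi> k" using ij jk by (auto simp: left_of_def sm_iff)
    then have "\<not> sm (\<xi> i) (\<xi> k)" using sm_between[of "\<xi> i" "\<xi> k" "\<xi> j"] 4 by auto
    then show ?thesis using * by (simp add: left_of_def)
  qed
qed

lemma left_of_order_iff: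
  "(\<forall>a < length w. \<forall>b < length w. left_of U V \<xi> (w ! a) (w ! b) \<longleftrightarrow> a < b) \<longleftrightarrow>
    successively (left_of U V \<xi>) w"
proof -
  have "(\<forall>a < length w. \<forall>b < length w. left_of U V \<xi> (w ! a) (w ! b) \<longleftrightarrow> a < b) \<longleftrightarrow>
      sorted_wrt (left_of U V \<xi>) w"
    unfolding sorted_wrt_iff_nth_less
  proof
    assume *: "\<forall>i j. i < j \<longrightarrow> j < length w \<longrightarrow> left_of U V \<xi> (w ! i) (w ! j)"
    have "left_of U V \<xi> (w ! a) (w ! b) \<longleftrightarrow> a < b" if ab: "a < length w" "b < length w" for a b
    proof
      assume "left_of U V \<xi> (w ! a) (w ! b)"
      then have "a \<noteq> b" "\<not> b < a"
        using * ab left_of_irrefl left_of_trans by metis+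
      then show "a < b" by simp
    qed (use * ab in blast)
    then show "\<forall>a < length w. \<forall>b < length w. left_of U V \<xi> (w ! a) (w ! b) \<longleftrightarrow> a < b"
      by blast
  qed auto
  also have "\<dots> \<longleftrightarrow> successively (left_of U V \<xi>) w"
    by (rule successively_iff_sorted_wrt_strong[symmetric]) (rule left_of_trans)
  finally show ?thesis .
qed

fun chain_weight :: "nat list \<Rightarrow> (nat \<Rightarrow> real) \<Rightarrow> real" where
  "chain_weight [] \<xi> = 1"
| "chain_weight [i] \<xi> = 1"
| "chain_weight (i # j # w) \<xi> = K i j (\<xi> i) (\<xi> j) * chain_weight (j # w) \<xi>"

lemma abs_chain_weight_le: "\<bar>chain_weight w \<xi>\<bar> \<le> 1"
  by (induction w rule: zs.induct) (auto intro: abs_mult_le_1 abs_K_le)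

lemma chain_weight_cong: "(\<And>i. i \<in> set w \<Longrightarrow> \<xi> i = \<xi>' i) \<Longrightarrow> chain_weight w \<xi> = chain_weight w \<xi>'"
  by (induction w rule: zs.induct) auto

lemma chain_weight_eq: "distinct w \<Longrightarrow> chain_weight w \<xi> = of_bool (successively (left_of U V \<xi>) w)"
proof (induction w rule: zs.induct)
  case (3 i j w)
  then have "K i j (\<xi> i) (\<xi> j) = of_bool (left_of U V \<xi> i j)"
    by (cases "i < j") (auto simp: K_def A_def D_def left_of_iff)
  then show ?case using 3 by simp
qed simp_all

lemma measurable_component_unif:
  "i \<in> J \<Longrightarrow> (\<lambda>\<xi>. \<xi> i) \<in> borel_measurable (PiM J (\<lambda>_. unif))"
  using measurable_component_singleton[of i J "\<lambda>_. unif"]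
  by (subst measurable_cong_sets[OF refl, of _ unif]) simp_all

lemma measurable_chain_weight:
  "set w \<subseteq> J \<Longrightarrow> chain_weight w \<in> borel_measurable (PiM J (\<lambda>_. unif))"
proof (induction w rule: zs.induct)
  case (3 i j w)
  then have [measurable]: "chain_weight (j # w) \<in> borel_measurable (PiM J (\<lambda>_. unif))"
    "(\<lambda>\<xi>. \<xi> i) \<in> borel_measurable (PiM J (\<lambda>_. unif))" "(\<lambda>\<xi>. \<xi> j) \<in> borel_measurable (PiM J (\<lambda>_. unif))"
    by (auto intro: measurable_component_unif)
  show ?case unfolding chain_weight.simps by measurable
qed (simp_all add: chain_weight.simps[abs_def])

lemma prob_space_PiM_unif: "prob_space (PiM J (\<lambda>_. unif))"
  by (rule prob_space_PiM) (rule prob_space_unif)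

text \<open>Fubini turns the insertion rule around: the inserted coordinate becomes the outer
  variable, as the recursion of \<open>chain_integral\<close> requires.\<close>

lemma integral_PiM_insert_rev:
  fixes f :: "('i \<Rightarrow> real) \<Rightarrow> real"
  assumes I: "finite I" "i \<notin> I"
    and f: "f \<in> borel_measurable (PiM (insert i I) (\<lambda>_. unif))" "\<And>\<xi>. \<bar>f \<xi>\<bar> \<le> 1"
  shows "(LINT \<xi>|PiM (insert i I) (\<lambda>_. unif). f \<xi>) = (LINT y|unif. LINT \<xi>|PiM I (\<lambda>_. unif). f (\<xi>(i := y)))"
proof -
  interpret product_sigma_finite "\<lambda>_ :: 'i. unif"
    by unfold_locales
  interpret I: prob_space "PiM I (\<lambda>_. unif)" by (rule prob_space_PiM_unif)
  interpret I': prob_space "PiM (insert i I) (\<lambda>_. unif)" by (rule prob_space_PiM_unif)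
  interpret P: pair_prob_space "PiM I (\<lambda>_. unif)" unif ..
  have "integrable (PiM (insert i I) (\<lambda>_. unif)) f"
    by (rule I'.integrable_const_bound[of _ 1]) (use f in auto)
  then have "(LINT \<xi>|PiM (insert i I) (\<lambda>_. unif). f \<xi>) = (LINT \<xi>|PiM I (\<lambda>_. unif). LINT y|unif. f (\<xi>(i := y)))"
    by (rule product_integral_insert[OF I])
  also have "\<dots> = (LINT y|unif. LINT \<xi>|PiM I (\<lambda>_. unif). f (\<xi>(i := y)))"
  proof (rule P.Fubini_integral[symmetric])
    have "f \<circ> (\<lambda>(\<xi>, y). \<xi>(i := y)) \<in> borel_measurable (PiM I (\<lambda>_. unif) \<Otimes>\<^sub>M unif)"
      by (rule measurable_comp[OF measurable_add_dim f(1)])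
    then have "(\<lambda>(\<xi>, y). f (\<xi>(i := y))) \<in> borel_measurable (PiM I (\<lambda>_. unif) \<Otimes>\<^sub>M unif)"
      by (simp add: comp_def case_prod_unfold)
    then show "integrable (PiM I (\<lambda>_. unif) \<Otimes>\<^sub>M unif) (\<lambda>(\<xi>, y). f (\<xi>(i := y)))"
      by (intro P.integrable_const_bound[of _ 1]) (simp_all add: split_beta f(2))
  qed
  finally show ?thesis .
qed

text \<open>The letters are distinct, so the coordinate i occurs only in the first kernel; with it
  fixed at x, the next letter becomes the outer variable of the remaining integral.\<close>

lemma integral_chain_weight_update:
  "distinct (i # w) \<Longrightarrow>
    (LINT \<xi>|PiM (set w) (\<lambda>_. unif). chain_weight (i # w) (\<xi>(i := x))) = chain_integral (i # w) x"
proof (induction w arbitrary: i x)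
  case Nil
  interpret prob_space "PiM {} (\<lambda>_ :: nat. unif)" by (rule prob_space_PiM_unif)
  show ?case by (simp add: prob_space)
next
  case (Cons j w)
  have upd: "chain_weight (i # j # w) (\<xi>(i := x)) = K i j x (\<xi> j) * chain_weight (j # w) \<xi>" for \<xi>
  proof -
    have "chain_weight (j # w) (\<xi>(i := x)) = chain_weight (j # w) \<xi>"
      using Cons.prems by (intro chain_weight_cong) auto
    then show ?thesis using Cons.prems by simp
  qed
  have [measurable]: "chain_weight (j # w) \<in> borel_measurable (PiM (insert j (set w)) (\<lambda>_. unif))"
    "(\<lambda>\<xi>. \<xi> j) \<in> borel_measurable (PiM (insert j (set w)) (\<lambda>_. unif))"
    by (auto intro: measurable_chain_weight measurable_component_unif)
  have "(LINT \<xi>|PiM (insert j (set w)) (\<lambda>_. unif). K i j x (\<xi> j) * chain_weight (j # w) \<xi>) =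
      (LINT y|unif. LINT \<xi>|PiM (set w) (\<lambda>_. unif). K i j x y * chain_weight (j # w) (\<xi>(j := y)))"
  proof (subst integral_PiM_insert_rev)
    show "(\<lambda>\<xi>. K i j x (\<xi> j) * chain_weight (j # w) \<xi>) \<in> borel_measurable (PiM (insert j (set w)) (\<lambda>_. unif))"
      by measurable
  qed (use Cons.prems in \<open>auto intro: abs_mult_le_1 abs_K_le abs_chain_weight_le\<close>)
  also have "\<dots> = (LINT y|unif. K i j x y * chain_integral (j # w) y)"
    by (simp only: integral_mult_right_zero Cons.IH[OF distinct_tl[OF Cons.prems, unfolded list.sel]])
  finally show ?case unfolding upd by simp
qed

lemma perm_prob_eq_integral:
  assumes "distinct w" "w \<noteq> []"
  shows "perm_prob U V w = (LINT x|unif. chain_integral w x)"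
proof -
  obtain i w' where w: "w = i # w'" using assms(2) by (cases w) auto
  let ?P = "\<lambda>J. PiM J (\<lambda>_ :: nat. unif)"
  interpret product_prob_space "\<lambda>_ :: nat. unif" UNIV
    by unfold_locales
  interpret P: prob_space "?P UNIV" by (rule prob_space_PiM_unif)
  let ?E = "{\<xi> \<in> space (?P UNIV). successively (left_of U V \<xi>) w}"
  have E: "of_bool (successively (left_of U V \<xi>) w) = chain_weight w \<xi>" for \<xi>
    using chain_weight_eq[OF assms(1)] by simp
  have "?E = chain_weight w -` {1} \<inter> space (?P UNIV)"
    using E[symmetric] by auto
  also have "\<dots> \<in> sets (?P UNIV)"
    by (rule measurable_sets[OF measurable_chain_weight]) auto
  finally have meas: "?E \<in> sets (?P UNIV)" .
  have "perm_prob U V w = measure (?P UNIV) ?E"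
    by (simp add: perm_prob_def iid_uniform_def left_of_order_iff)
  also have "\<dots> = (LINT \<xi>|?P UNIV. indicator ?E \<xi>)"
    using meas by simp
  \<comment> \<open>The weight sees only the coordinates in w, so the infinite product measure can
    be projected to finitely many of them.\<close>
  also have "\<dots> = (LINT \<xi>|?P UNIV. chain_weight w (restrict \<xi> (set w)))"
  proof (rule Bochner_Integration.integral_cong[OF refl])
    fix \<xi> assume "\<xi> \<in> space (?P UNIV)"
    then have "indicator ?E \<xi> = chain_weight w \<xi>" by (simp add: E[symmetric] indicator_def)
    also have "\<dots> = chain_weight w (restrict \<xi> (set w))" by (rule chain_weight_cong) simp
    finally show "indicator ?E \<xi> = chain_weight w (restrict \<xi> (set w))" .
  qed
  also have "\<dots> = (LINT \<xi>|distr (?P UNIV) (?P (set w)) (\<lambda>\<xi>. restrict \<xi> (set w)). chain_weight w \<xi>)"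
    by (rule integral_distr[symmetric])
      (rule measurable_restrict_subset, simp, rule measurable_chain_weight, simp)
  also have "\<dots> = (LINT \<xi>|?P (set w). chain_weight w \<xi>)"
    by (subst distr_PiM_restrict_finite) auto
  also have "\<dots> = (LINT x|unif. LINT \<xi>|?P (set w'). chain_weight w (\<xi>(i := x)))"
    unfolding w list.set
    by (rule integral_PiM_insert_rev) (use assms w in \<open>auto intro: measurable_chain_weight abs_chain_weight_le\<close>)
  also have "\<dots> = (LINT x|unif. chain_integral w x)"
    using assms unfolding w by (simp only: integral_chain_weight_update)
  finally show ?thesis .
qed

lemma perm_prob_Nil: "perm_prob U V [] = 1"
proof -
  interpret P: prob_space "PiM UNIV (\<lambda>_ :: nat. unif)" by (rule prob_space_PiM_unif)
  show ?thesis by (simp add: perm_prob_def iid_uniform_def P.prob_space)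
qed

text \<open>-1 lies outside U and V and to the left of [0,1], so \<open>D (- 1)\<close> is 1 almost
  everywhere.\<close>

lemma \<Phi>_start: "\<Phi> (c # \<nu>) (- 1) = (LINT x|unif. s x ^ (c - 1) * \<Phi> \<nu> x)"
  unfolding \<Phi>.simps
proof (rule integral_cong_AE)
  show "AE x in unif. D (- 1) x * s x ^ (c - 1) * \<Phi> \<nu> x = s x ^ (c - 1) * \<Phi> \<nu> x"
    using AE_unif_Icc
  proof eventually_elim
    case (elim x)
    have "\<not> sm (- 1) x"
      using connected_component_in(1)[of "U \<union> V" "- 1" x] subsetD[OF U_subset, of "- 1"]
        subsetD[OF V_subset, of "- 1"] by auto
    then have "D (- 1) x = 1" using elim by (simp add: D_def desc_def)
    then show ?case by simp
  qed
qed (unfold borel_measurable_unif, measurable)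

text \<open>Integrating out the first position as well gives the expansion of F in M; in particular
  the probability depends on w only through \<open>zs w\<close>.\<close>

theorem perm_prob_eq:
  assumes "distinct w"
  shows "perm_prob U V w = (\<Sum>\<mu>\<in>refinements (zs w). \<Phi> \<mu> (- 1))"
proof (cases "w = []")
  case True
  then show ?thesis by (simp add: perm_prob_Nil refinements_Nil)
next
  case False
  then obtain c \<nu> where r: "zs w = c # \<nu>" "0 < c"
    using zs_eq_Nil_iff[of w] composition_zs[of w] by (cases "zs w") auto
  have "perm_prob U V w = (\<Sum>\<mu>\<in>refinements (zs w). LINT x|unif. s x ^ (hd \<mu> - 1) * \<Phi> (tl \<mu>) x)"
    unfolding perm_prob_eq_integral[OF assms False] chain_integral_eq[OF False]
    by (rule Bochner_Integration.integral_sum, rule integrable_unif[of _ 1])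
      (measurable, intro abs_mult_le_1 abs_s_power_le abs_\<Phi>_le)
  also have "\<dots> = (\<Sum>\<mu>\<in>refinements (zs w). \<Phi> \<mu> (- 1))"
  proof (rule sum.cong[OF refl])
    fix \<mu> assume "\<mu> \<in> refinements (zs w)"
    then have "\<mu> \<in> refinements (c # \<nu>)" using r(1) by simp
    then obtain d \<mu>' where "\<mu> = d # \<mu>'" by (rule refinements_ConsE[OF r(2)])
    then show "(LINT x|unif. s x ^ (hd \<mu> - 1) * \<Phi> (tl \<mu>) x) = \<Phi> \<mu> (- 1)"
      by (simp only: \<Phi>_start list.sel)
  qed
  finally show ?thesis .
qed

end

section \<open>The generating function\<close>

lemma fps_conv_radius_ge_1:
  fixes f :: "real fps"
  assumes "\<And>n. \<bar>fps_nth f n\<bar> \<le> 1"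
  shows "fps_conv_radius f \<ge> 1"
  unfolding fps_conv_radius_def
proof (rule conv_radius_geI_ex')
  fix r :: real assume r: "0 < r" "ereal r < 1"
  show "summable (\<lambda>n. fps_nth f n * of_real r ^ n)"
  proof (rule summable_comparison_test')
    show "summable (\<lambda>n. r ^ n)" using r by (intro summable_geometric) (simp add: one_ereal_def)
    show "norm (fps_nth f n * of_real r ^ n) \<le> r ^ n" if "0 \<le> n" for n
      using mult_right_mono[OF assms[of n], of "r ^ n"] r by (simp add: abs_mult)
  qed
qed

lemma convergent_prod_1_plus:
  fixes a :: "nat \<Rightarrow> real"
  assumes "summable a" "\<And>j. 0 \<le> a j"
  shows "convergent_prod (\<lambda>j. 1 + a j * t)"
proof -
  have "summable (\<lambda>j. a j * \<bar>t\<bar>)" using assms(1) by (rule summable_mult2)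
  then have "abs_convergent_prod (\<lambda>j. 1 + a j * t)"
    using assms(2) by (simp add: abs_convergent_prod_conv_summable abs_mult)
  then show ?thesis by (rule abs_convergent_prod_imp_convergent_prod)
qed

text \<open>With F the series of h and L that of \<open>q n / n\<close>, the recursion reads F' = L'
  F, hence F = exp L near 0. The logarithm of the j-th factor has coefficients
  \<open>d k j / k\<close>, and a uniform bound on partial sums over j justifies the interchange of
  limits for |t| < 1.\<close>

lemma generating_function:
  fixes \<alpha> \<beta> h q :: "nat \<Rightarrow> real"
  assumes \<alpha>: "\<And>j. 0 \<le> \<alpha> j" "summable \<alpha>" and \<beta>: "\<And>j. 0 \<le> \<beta> j" "summable \<beta>"
    and le1: "suminf \<alpha> + suminf \<beta> \<le> 1"
    and h0: "h 0 = 1" and newton: "\<And>n. real n * h n = (\<Sum>k\<in>{1..n}. q k * h (n - k))"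
    and q1: "q 1 = 1" and q: "\<And>k. 2 \<le> k \<Longrightarrow> q k = suminf (\<lambda>j. \<alpha> j ^ k - (- \<beta> j) ^ k)"
  shows "(\<lambda>t. exp ((1 - suminf \<alpha> - suminf \<beta>) * t) * prodinf (\<lambda>j. 1 + \<beta> j * t) / prodinf (\<lambda>i. 1 - \<alpha> i * t))
    has_fps_expansion Abs_fps h"
proof -
  define \<gamma> where "\<gamma> = 1 - suminf \<alpha> - suminf \<beta>"
  define d where "d k j = \<alpha> j ^ k - (- \<beta> j) ^ k" for k j
  define P where "P k = suminf (d k)" for k
  have \<alpha>_le: "\<alpha> j \<le> suminf \<alpha>" "suminf \<alpha> \<le> 1" and \<beta>_le: "\<beta> j \<le> suminf \<beta>" "suminf \<beta> \<le> 1" for j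
  proof -
    have "sum \<alpha> {j} \<le> suminf \<alpha>" "sum \<beta> {j} \<le> suminf \<beta>"
      by (rule sum_le_suminf; simp add: \<alpha> \<beta>)+
    then show "\<alpha> j \<le> suminf \<alpha>" "\<beta> j \<le> suminf \<beta>" by simp_all
    show "suminf \<alpha> \<le> 1" using le1 suminf_nonneg[OF \<beta>(2) \<beta>(1)] by simp
    show "suminf \<beta> \<le> 1" using le1 suminf_nonneg[OF \<alpha>(2) \<alpha>(1)] by simp
  qed
  have \<alpha>1: "\<alpha> j \<le> 1" and \<beta>1: "\<beta> j \<le> 1" for j
    using \<alpha>_le(1)[of j] \<alpha>_le(2) \<beta>_le(1)[of j] \<beta>_le(2) by linarith+
  have d_le: "\<bar>d k j\<bar> \<le> \<alpha> j + \<beta> j" for k j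
  proof (cases k)
    case (Suc l)
    have "\<bar>d k j\<bar> \<le> \<bar>\<alpha> j ^ k\<bar> + \<bar>(- \<beta> j) ^ k\<bar>" unfolding d_def by (rule abs_triangle_ineq4)
    also have "\<dots> = \<alpha> j ^ k + \<beta> j ^ k" using \<alpha>(1) \<beta>(1) by (simp add: power_abs)
    also have "\<dots> \<le> \<alpha> j + \<beta> j"
      unfolding Suc power_Suc
      by (intro add_mono mult_left_le power_le_one \<alpha>(1) \<beta>(1) \<alpha>1 \<beta>1)
    finally show ?thesis .
  qed (simp add: d_def \<alpha>(1) \<beta>(1))
  have summable_ab: "summable (\<lambda>j. \<alpha> j + \<beta> j)" using \<alpha>(2) \<beta>(2) by (rule summable_add)
  \<comment> \<open>Uniform in J and k: the domination needed for Tannery's theorem.\<close>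
  have sum_d: "\<bar>\<Sum>j<J. d k j\<bar> \<le> 1" for J k
  proof -
    have "\<bar>\<Sum>j<J. d k j\<bar> \<le> (\<Sum>j<J. \<alpha> j + \<beta> j)"
      by (rule order_trans[OF sum_abs]) (rule sum_mono, rule d_le)
    also have "\<dots> \<le> suminf (\<lambda>j. \<alpha> j + \<beta> j)"
      by (rule sum_le_suminf[OF summable_ab]) (simp_all add: \<alpha>(1) \<beta>(1))
    also have "\<dots> \<le> 1" using suminf_add[OF \<alpha>(2) \<beta>(2)] le1 by simp
    finally show ?thesis .
  qed
  have d_sums: "(\<lambda>J. \<Sum>j<J. d k j) \<longlonglongrightarrow> P k" for k
    unfolding P_def
    by (rule summable_LIMSEQ, rule summable_comparison_test'[OF summable_ab])
      (simp only: real_norm_def d_le)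
  have P_le: "\<bar>P k\<bar> \<le> 1" for k
    by (rule LIMSEQ_le_const2[OF tendsto_rabs[OF d_sums]]) (use sum_d in blast)
  have P1: "P 1 = suminf \<alpha> + suminf \<beta>"
    unfolding P_def d_def[abs_def] using suminf_add[OF \<alpha>(2) \<beta>(2)] by simp
  have q_eq: "q k = P k" if "2 \<le> k" for k using q[OF that] by (simp add: P_def d_def[abs_def])
  have q_le: "\<bar>q k\<bar> \<le> 1" if "1 \<le> k" for k
    using that q1 P_le[of k] q_eq[of k] by (cases "k = 1") auto
  \<comment> \<open>The recursion writes \<open>h n\<close> as the mean of n products of absolute
    value at most 1, so the series has radius at least 1.\<close>
  have h_le: "\<bar>h n\<bar> \<le> 1" for n
  proof (induction n rule: less_induct)
    case (less n)
    show ?case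
    proof (cases "n = 0")
      case False
      have "\<bar>real n * h n\<bar> \<le> (\<Sum>k\<in>{1..n}. \<bar>q k * h (n - k)\<bar>)"
        unfolding newton by (rule sum_abs)
      also have "\<dots> \<le> (\<Sum>k\<in>{1..n}. 1)"
      proof (rule sum_mono)
        fix k assume k: "k \<in> {1..n}"
        then have "\<bar>h (n - k)\<bar> \<le> 1" by (intro less.IH) auto
        then show "\<bar>q k * h (n - k)\<bar> \<le> 1" using q_le[of k] k by (simp add: abs_mult mult_le_one)
      qed
      finally have "real n * \<bar>h n\<bar> \<le> real n" by (simp add: abs_mult)
      then show ?thesis using False by simp
    qed (simp add: h0)
  qed
  define F where "F = Abs_fps h"
  \<comment> \<open>The coefficient at 1 is \<open>q 1 = 1\<close> instead of \<open>P 1\<close>,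
    which is the sum of all \<alpha> and \<beta>; the difference is \<gamma>. At 0, division by 0
    gives the coefficient 0.\<close>
  define L where "L = Abs_fps (\<lambda>n. if n = 1 then 1 else P n / real n)"
  have radF: "fps_conv_radius F \<ge> 1" by (rule fps_conv_radius_ge_1) (simp add: F_def h_le)
  have radL: "fps_conv_radius L \<ge> 1"
  proof (rule fps_conv_radius_ge_1)
    fix n
    have "\<bar>P n / real n\<bar> \<le> 1"
      using P_le[of n] by (cases "n = 0") (auto simp: divide_le_eq)
    then show "\<bar>fps_nth L n\<bar> \<le> 1" by (simp add: L_def)
  qed
  have radL': "fps_conv_radius (fps_deriv L) \<ge> 1"
    using radL fps_conv_radius_deriv[of L] by (rule order_trans)
  have derivF: "fps_deriv F = fps_deriv L * F"
  proof (rule fps_ext)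
    fix n
    have "fps_nth (fps_deriv F) n = (\<Sum>k\<in>{1..Suc n}. q k * h (Suc n - k))"
      using newton[of "Suc n"] by (simp add: F_def)
    also have "\<dots> = (\<Sum>k\<in>{0..n}. q (Suc k) * h (n - k))"
      by (rule sum.reindex_bij_witness[of _ Suc "\<lambda>k. k - 1"]) auto
    also have "\<dots> = (\<Sum>k\<in>{0..n}. fps_nth (fps_deriv L) k * fps_nth F (n - k))"
    proof (rule sum.cong[OF refl])
      fix k
      have "q (Suc k) = fps_nth (fps_deriv L) k"
        using q1 q_eq[of "Suc k"] by (cases "k = 0") (simp_all add: L_def)
      then show "q (Suc k) * h (n - k) = fps_nth (fps_deriv L) k * fps_nth F (n - k)"
        by (simp add: F_def)
    qed
    finally show "fps_nth (fps_deriv F) n = fps_nth (fps_deriv L * F) n"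
      by (simp add: fps_mult_nth)
  qed
  have F_exp: "eval_fps F t = exp (eval_fps L t)" if t: "\<bar>t\<bar> < 1" for t
  proof -
    \<comment> \<open>F / exp L has derivative 0, so it is constant, with value 1 at 0.\<close>
    have "\<exists>c. \<forall>x\<in>ball 0 1. eval_fps F x * exp (- eval_fps L x) = c"
    proof (rule has_field_derivative_zero_constant)
      fix x :: real assume "x \<in> ball 0 1"
      then have nx: "ereal (norm x) < 1" by (simp add: one_ereal_def)
      note x = less_le_trans[OF nx radF] less_le_trans[OF nx radL] less_le_trans[OF nx radL']
      have "((\<lambda>x. eval_fps F x * exp (- eval_fps L x)) has_field_derivative
          eval_fps (fps_deriv F) x * exp (- eval_fps L x) +
          exp (- eval_fps L x) * - eval_fps (fps_deriv L) x * eval_fps F x) (at x within ball 0 1)"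
        by (auto intro!: derivative_eq_intros has_field_derivative_eval_fps[OF x(1)] has_field_derivative_eval_fps[OF x(2)])
      then show "((\<lambda>x. eval_fps F x * exp (- eval_fps L x)) has_field_derivative 0) (at x within ball 0 1)"
        unfolding derivF eval_fps_mult[OF x(3,1)] by (simp add: algebra_simps)
    qed simp
    then obtain c where c: "\<And>x. \<bar>x\<bar> < 1 \<Longrightarrow> eval_fps F x * exp (- eval_fps L x) = c" by auto
    have "c = 1" using c[of 0] by (simp add: eval_fps_at_0 F_def L_def h0 P_def d_def[abs_def])
    then show ?thesis using c[OF t] by (simp add: exp_minus field_simps)
  qed
  have G: "exp (eval_fps L t) =
      exp (\<gamma> * t) * prodinf (\<lambda>j. 1 + \<beta> j * t) / prodinf (\<lambda>i. 1 - \<alpha> i * t)"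
    if t: "\<bar>t\<bar> < 1" for t
  proof -
    have small: "\<bar>\<alpha> j * t\<bar> < 1" "\<bar>\<beta> j * t\<bar> < 1" for j
      using mult_right_mono[OF \<alpha>1[of j], of "\<bar>t\<bar>"] mult_right_mono[OF \<beta>1[of j], of "\<bar>t\<bar>"] t \<alpha>(1)[of j] \<beta>(1)[of j]
      by (simp_all add: abs_mult)
    have pos: "1 - \<alpha> j * t > 0" "1 + \<beta> j * t > 0" for j
      using small[of j] by linarith+
    \<comment> \<open>The logarithm series of the first J factors; division by 0 makes the term at k
      = 0 vanish.\<close>
    define PJ where "PJ J k = (\<Sum>j<J. d k j) * t ^ k / real k" for J k
    have PJ_sums: "PJ J sums (\<Sum>j<J. ln (1 + \<beta> j * t) - ln (1 - \<alpha> j * t))" for J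
    proof -
      have "(\<lambda>k. d k j * t ^ k / real k) sums (ln (1 + \<beta> j * t) - ln (1 - \<alpha> j * t))" for j
      proof -
        have "(\<lambda>k. - ((- (\<beta> j * t)) ^ k) / real k - - ((- (- (\<alpha> j * t))) ^ k) / real k) sums
            (ln (1 + \<beta> j * t) - ln (1 + - (\<alpha> j * t)))"
          using small by (intro sums_diff ln_series') simp_all
        moreover have "- ((- (\<beta> j * t)) ^ k) / real k - - ((- (- (\<alpha> j * t))) ^ k) / real k =
            d k j * t ^ k / real k" for k
        proof -
          have "(- (\<beta> j * t)) ^ k = (- \<beta> j) ^ k * t ^ k" by (metis mult_minus_left power_mult_distrib)
          then show ?thesis by (simp add: d_def power_mult_distrib algebra_simps diff_divide_distrib)
        qed
        ultimately show ?thesis by simp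
      qed
      then have "(\<lambda>k. \<Sum>j<J. d k j * t ^ k / real k) sums (\<Sum>j<J. ln (1 + \<beta> j * t) - ln (1 - \<alpha> j * t))"
        by (intro sums_sum)
      then show ?thesis unfolding PJ_def by (simp add: sum_distrib_right sum_divide_distrib)
    qed
    have lim: "(\<lambda>J. PJ J k) \<longlonglongrightarrow> P k * t ^ k / real k" for k
    proof (cases "k = 0")
      case False
      then show ?thesis
        unfolding PJ_def by (intro tendsto_divide[OF tendsto_mult[OF d_sums tendsto_const] tendsto_const]) simp
    qed (simp add: PJ_def)
    have bound: "norm (PJ J k) \<le> \<bar>t\<bar> ^ k" for J k
    proof (cases "k = 0")
      case False
      have "norm (PJ J k) = \<bar>\<Sum>j<J. d k j\<bar> * \<bar>t\<bar> ^ k / real k" by (simp add: PJ_def abs_mult power_abs)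
      also have "\<dots> \<le> 1 * \<bar>t\<bar> ^ k / 1"
        using False by (intro frac_le mult_right_mono sum_d) auto
      finally show ?thesis by simp
    qed (simp add: PJ_def)
    have "summable (\<lambda>k. \<bar>t\<bar> ^ k)" using t by (intro summable_geometric) simp
    from tannerys_theorem[where F = sequentially and a = "\<lambda>k J. PJ J k", OF lim _ this]
    have S: "summable (\<lambda>k. P k * t ^ k / real k)"
        "(\<lambda>J. suminf (PJ J)) \<longlonglongrightarrow> suminf (\<lambda>k. P k * t ^ k / real k)"
      using bound by (auto simp: case_prod_unfold summable_norm_cancel)
    define E where "E = suminf (\<lambda>k. P k * t ^ k / real k)"
    have "(\<lambda>n. P n * t ^ n / real n + (if n = 1 then \<gamma> * t else 0)) sums (E + \<gamma> * t)"
      unfolding E_def by (intro sums_add summable_sums S(1) sums_single)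
    moreover have "P n * t ^ n / real n + (if n = 1 then \<gamma> * t else 0) = fps_nth L n * t ^ n" for n
      using P1 by (simp add: L_def \<gamma>_def algebra_simps)
    ultimately have eval: "eval_fps L t = E + \<gamma> * t"
      unfolding eval_fps_def by (simp add: sums_iff)
    have exp_PJ: "exp (suminf (PJ J)) = (\<Prod>j<J. 1 + \<beta> j * t) / (\<Prod>j<J. 1 - \<alpha> j * t)" for J
    proof -
      have "exp (suminf (PJ J)) = exp (\<Sum>j<J. ln (1 + \<beta> j * t) - ln (1 - \<alpha> j * t))"
        using PJ_sums[of J] by (simp add: sums_iff)
      also have "\<dots> = (\<Prod>j<J. (1 + \<beta> j * t) / (1 - \<alpha> j * t))"
        using pos by (simp add: exp_sum exp_diff)
      finally show ?thesis by (simp add: prod_dividef)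
    qed
    have conv: "convergent_prod (\<lambda>j. 1 + \<beta> j * t)" "convergent_prod (\<lambda>j. 1 - \<alpha> j * t)"
      using convergent_prod_1_plus[OF \<beta>(2,1), of t] convergent_prod_1_plus[OF \<alpha>(2,1), of "- t"] by simp_all
    \<comment> \<open>A convergent infinite product with nonzero factors has a nonzero limit, so the
      quotient of limits is legitimate.\<close>
    have "prodinf (\<lambda>j. 1 - \<alpha> j * t) \<noteq> 0"
      using pos(1) by (intro prodinf_nonzero conv(2)) (metis less_irrefl)
    then have "(\<lambda>J. (\<Prod>j\<le>J. 1 + \<beta> j * t) / (\<Prod>j\<le>J. 1 - \<alpha> j * t)) \<longlonglongrightarrow>
        prodinf (\<lambda>j. 1 + \<beta> j * t) / prodinf (\<lambda>j. 1 - \<alpha> j * t)"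
      by (intro tendsto_divide convergent_prod_LIMSEQ conv)
    moreover have "(\<lambda>J. exp (suminf (PJ (Suc J)))) \<longlonglongrightarrow> exp E"
      unfolding E_def by (intro tendsto_exp LIMSEQ_Suc S(2))
    ultimately have "exp E = prodinf (\<lambda>j. 1 + \<beta> j * t) / prodinf (\<lambda>j. 1 - \<alpha> j * t)"
      unfolding exp_PJ lessThan_Suc_atMost by (rule LIMSEQ_unique[rotated])
    then show ?thesis by (simp add: eval exp_add)
  qed
  show ?thesis
    unfolding has_fps_expansion_def
  proof
    show "0 < fps_conv_radius (Abs_fps h)"
      using radF unfolding F_def by (rule less_le_trans[rotated]) simp
    have "\<forall>\<^sub>F t :: real in nhds 0. t \<in> ball 0 1"
      by (rule eventually_nhds_in_open) simp_all
    then show "\<forall>\<^sub>F t in nhds 0. eval_fps (Abs_fps h) t =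
        exp ((1 - suminf \<alpha> - suminf \<beta>) * t) * prodinf (\<lambda>j. 1 + \<beta> j * t) / prodinf (\<lambda>i. 1 - \<alpha> i * t)"
    proof eventually_elim
      case (elim t)
      then show ?case using F_exp[of t] G[of t] by (simp add: F_def \<gamma>_def)
    qed
  qed
qed

section \<open>Ranks\<close>

text \<open>The index of c is the number of elements before it, in order of decreasing weight with
  ties broken by an injection into the naturals. It is finite because only finitely many weights
  reach the positive number \<open>w c\<close>.\<close>

lemma ex_decreasing_enumeration:
  fixes w :: "'a \<Rightarrow> real"
  assumes pos: "\<And>c. c \<in> X \<Longrightarrow> 0 < w c" and fin: "\<And>e. 0 < e \<Longrightarrow> finite {c\<in>X. e \<le> w c}"
  shows "\<exists>a C. decseq a \<and> (\<forall>j. 0 \<le> a j) \<and> bij_betw C {j :: nat. a j \<noteq> 0} X \<and>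
    (\<forall>j. a j \<noteq> 0 \<longrightarrow> a j = w (C j))"
proof -
  have "X \<subseteq> (\<Union>n. {c\<in>X. 1 / real (Suc n) \<le> w c})"
  proof
    fix c assume c: "c \<in> X"
    obtain n where "inverse (real (Suc n)) < w c" using reals_Archimedean[OF pos[OF c]] by auto
    then have "1 / real (Suc n) \<le> w c" by (simp add: inverse_eq_divide)
    then show "c \<in> (\<Union>n. {c\<in>X. 1 / real (Suc n) \<le> w c})" using c by blast
  qed
  moreover have "countable (\<Union>n. {c\<in>X. 1 / real (Suc n) \<le> w c})"
    by (rule countable_UN, simp, rule countable_finite, rule fin, simp)
  ultimately have "countable X" by (rule countable_subset)
  then obtain idx :: "'a \<Rightarrow> nat" where idx: "inj_on idx X" by (rule countableE)
  define before where "before c' c \<longleftrightarrow> w c < w c' \<or> w c' = w c \<and> idx c' < idx c" for c' c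
  define pred where "pred c = {c'\<in>X. before c' c}" for c
  define r where "r c = card (pred c)" for c
  have fin_pred: "finite (pred c)" if "c \<in> X" for c
    by (rule finite_subset[OF _ fin[OF pos[OF that]]]) (auto simp: pred_def before_def)
  have r_less: "r c' < r c" if "c \<in> X" "c' \<in> pred c" for c c'
  proof -
    have "c' \<notin> pred c'" by (simp add: pred_def before_def)
    moreover have "pred c' \<subseteq> pred c" using that by (auto simp: pred_def before_def)
    ultimately have "pred c' \<subset> pred c" using that(2) by blast
    then show ?thesis unfolding r_def using fin_pred[OF that(1)] by (rule psubset_card_mono[rotated])
  qed
  have inj: "inj_on r X"
  proof (rule inj_onI)
    fix c c' assume c: "c \<in> X" "c' \<in> X" "r c = r c'"
    then have "c \<notin> pred c'" "c' \<notin> pred c" using r_less by force+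
    then have "w c = w c'" "idx c = idx c'" using c by (auto simp: pred_def before_def)
    then show "c = c'" using idx c by (auto dest: inj_onD)
  qed
  \<comment> \<open>The predecessors of c have pairwise different indices below \<open>r c\<close>,
    and there are \<open>r c\<close> of them, so the indices leave no gap.\<close>
  have initial: "\<exists>c'\<in>pred c. r c' = n" if c: "c \<in> X" "n < r c" for c n
  proof -
    have "inj_on r (pred c)" using inj by (rule inj_on_subset) (auto simp: pred_def)
    then have "card (r ` pred c) = card (pred c)" by (rule card_image)
    also have "\<dots> = r c" by (simp only: r_def)
    finally have "card (r ` pred c) = r c" .
    then have "r ` pred c = {..<r c}"
      using r_less[OF c(1)] by (intro card_subset_eq) auto
    then show ?thesis using c(2) by (metis imageE lessThan_iff)
  qed
  define C where "C = inv_into X r"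
  define a where "a j = (if j \<in> r ` X then w (C j) else 0)" for j
  have C: "C (r c) = c" if "c \<in> X" for c unfolding C_def using inj that by (rule inv_into_f_f)
  have a_r: "a (r c) = w c" if "c \<in> X" for c using that C by (simp add: a_def)
  have nonzero: "{j. a j \<noteq> 0} = r ` X"
  proof (intro equalityI subsetI)
    fix j assume "j \<in> r ` X"
    then obtain c where "c \<in> X" "j = r c" by blast
    then show "j \<in> {j. a j \<noteq> 0}" using a_r[of c] pos[of c] by simp
  qed (simp add: a_def split: if_splits)
  have nonneg: "0 \<le> a j" for j
  proof (cases "j \<in> r ` X")
    case True
    then obtain c where "c \<in> X" "j = r c" by blast
    then show ?thesis using a_r[of c] pos[of c] by simp
  qed (simp add: a_def)
  have "bij_betw C {j. a j \<noteq> 0} X"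
    unfolding nonzero C_def using inj by (intro bij_betw_inv_into) (simp add: bij_betw_def)
  moreover have "a j = w (C j)" if "a j \<noteq> 0" for j using that by (simp add: a_def split: if_splits)
  moreover have "decseq a"
  proof (rule decseq_SucI)
    fix j show "a (Suc j) \<le> a j"
    proof (cases "Suc j \<in> r ` X")
      case True
      then obtain c where c: "c \<in> X" "r c = Suc j" by auto
      then obtain c' where c': "c' \<in> pred c" "r c' = j" using initial[of c j] by auto
      then have "c' \<in> X" "w c \<le> w c'" by (auto simp: pred_def before_def)
      then show ?thesis using a_r[of c] a_r[of c'] c c'(2) by simp
    qed (use nonneg in \<open>simp add: a_def\<close>)
  qed
  ultimately show ?thesis using nonneg by blast
qed

text \<open>Count the elements of weight at least \<open>a j\<close>: the decreasing sequence a
  lists at least j + 1 of them, but b would list at most j if \<open>b j < a j\<close>.\<close>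

lemma decreasing_enumeration_le:
  fixes w :: "'a \<Rightarrow> real"
  assumes fin: "\<And>e. 0 < e \<Longrightarrow> finite {c\<in>X. e \<le> w c}"
    and a: "decseq a" "bij_betw C {j :: nat. a j \<noteq> 0} X" "\<And>j. a j \<noteq> 0 \<Longrightarrow> a j = w (C j)"
    and b: "decseq b" "\<And>j. 0 \<le> b j" "bij_betw C' {j :: nat. b j \<noteq> 0} X" "\<And>j. b j \<noteq> 0 \<Longrightarrow> b j = w (C' j)"
  shows "a j \<le> b j"
proof (rule ccontr)
  assume "\<not> a j \<le> b j"
  then have less: "b j < a j" and e: "0 < a j" using b(2)[of j] by linarith+
  let ?Y = "{c\<in>X. a j \<le> w c}"
  have card_eq: "bij_betw D {i. a j \<le> g i} ?Y"
    if D: "bij_betw D {i :: nat. g i \<noteq> 0} X" "\<And>i. g i \<noteq> 0 \<Longrightarrow> g i = w (D i)" for g D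
  proof (rule bij_betw_subset[OF D(1)])
    show "{i. a j \<le> g i} \<subseteq> {i. g i \<noteq> 0}" using e by auto
    show "D ` {i. a j \<le> g i} = ?Y"
    proof (intro equalityI subsetI)
      fix c assume "c \<in> D ` {i. a j \<le> g i}"
      then show "c \<in> ?Y" using D e by (force simp: bij_betw_def)
    next
      fix c assume c: "c \<in> ?Y"
      then obtain i where "g i \<noteq> 0" "c = D i" using D(1) by (auto simp: bij_betw_def)
      then show "c \<in> D ` {i. a j \<le> g i}" using D(2)[of i] c by auto
    qed
  qed
  have Ca: "card {i. a j \<le> a i} = card ?Y" "finite {i. a j \<le> a i}"
    using card_eq[OF a(2,3)] fin[OF e] by (auto simp: bij_betw_same_card bij_betw_finite)
  have Cb: "card {i. a j \<le> b i} = card ?Y"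
    using card_eq[OF b(3,4)] by (auto simp: bij_betw_same_card)
  have "{..j} \<subseteq> {i. a j \<le> a i}" using a(1) by (auto simp: decseq_def)
  then have "card {..j} \<le> card {i. a j \<le> a i}" using Ca(2) by (intro card_mono)
  moreover have "{i. a j \<le> b i} \<subseteq> {..<j}"
  proof
    fix i assume "i \<in> {i. a j \<le> b i}"
    then have "\<not> j \<le> i" using decseqD[OF b(1), of j i] less by auto
    then show "i \<in> {..<j}" by simp
  qed
  then have "card {i. a j \<le> b i} \<le> card {..<j}" by (intro card_mono) simp_all
  ultimately show False using Ca Cb by simp
qed

section \<open>Lengths of the components of an open subset of the unit interval\<close>

lemma measure_unif:
  assumes "c \<in> sets borel" "c \<subseteq> {0..1}"
  shows "measure unif c = measure lborel c"
proof -
  have "{0..1} \<inter> c = c" using assms(2) by auto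
  then show ?thesis using assms(1) by (simp add: measure_uniform_measure)
qed

context
  fixes U :: "real set"
  assumes U: "open U" "U \<subseteq> {0<..<1}"
begin

interpretation unif: prob_space unif by (rule prob_space_unif)

lemma component_props:
  assumes "c \<in> components U"
  shows "open c" "c \<in> sets borel" "measure unif c = measure lborel c" "0 < measure lborel c"
proof -
  show c: "open c" by (rule open_components[OF U(1) assms])
  then show borel: "c \<in> sets borel" by simp
  have sub: "c \<subseteq> {0<..<1}" using in_components_subset[OF assms] U(2) by blast
  then have sub': "c \<subseteq> {0..1}" by fastforce
  with borel show "measure unif c = measure lborel c" by (rule measure_unif)
  obtain x where "x \<in> c" using in_components_nonempty[OF assms] by blast
  then obtain e where e: "0 < e" "ball x e \<subseteq> c" using c by (auto simp: open_contains_ball)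
  have "emeasure lborel c \<le> emeasure lborel {0..1 :: real}"
    using sub' by (intro emeasure_mono) auto
  then have fin: "emeasure lborel c < \<infinity>" by (auto simp: le_less_trans)
  have "{x - e / 2..x + e / 2} \<subseteq> c"
    using e by (force simp: dist_real_def subset_iff abs_le_iff)
  then have "measure lborel {x - e / 2..x + e / 2} \<le> measure lborel c"
    using fin borel by (intro measure_mono_fmeasurable) (auto simp: fmeasurable_def)
  then show "0 < measure lborel c" using e(1) by simp
qed

text \<open>Components are disjoint with total length at most 1, so at most 1 / e of them have
  length e or more.\<close>

lemma finite_large_components:
  assumes "0 < e"
  shows "finite {c\<in>components U. e \<le> measure lborel c}"
proof (rule ccontr)
  assume inf: "\<not> finite {c\<in>components U. e \<le> measure lborel c}"
  obtain n :: nat where n: "1 / e < real n" using reals_Archimedean2 by blast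
  obtain F where F: "finite F" "card F = n" "F \<subseteq> {c\<in>components U. e \<le> measure lborel c}"
    using infinite_arbitrarily_large[OF inf] by blast
  have "real n * e = (\<Sum>c\<in>F. e)" using F(2) by simp
  also have "\<dots> \<le> (\<Sum>c\<in>F. measure unif c)"
  proof (rule sum_mono)
    fix c assume "c \<in> F"
    then have "c \<in> components U" "e \<le> measure lborel c" using F(3) by auto
    then show "e \<le> measure unif c" using component_props(3) by simp
  qed
  also have "\<dots> = measure unif (\<Union>c\<in>F. c)"
  proof (rule unif.finite_measure_finite_Union[symmetric])
    show "(\<lambda>c. c) ` F \<subseteq> unif.events" using F(3) component_props(2) by auto
    show "disjoint_family_on (\<lambda>c. c) F"
      unfolding disjoint_family_on_def using F(3) components_nonoverlap[of _ U] by blast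
  qed (rule F(1))
  also have "\<dots> \<le> 1" by simp
  finally show False using n assms by (simp add: field_simps)
qed

lemma ex_lists_lengths: "\<exists>a. decseq a \<and> (\<forall>j. 0 \<le> a j) \<and> lists_lengths U a"
  using ex_decreasing_enumeration[of "components U" "measure lborel"] component_props(4) finite_large_components
  unfolding lists_lengths_def by blast

lemma lists_lengths_unique:
  assumes a: "decseq a" "\<And>j. 0 \<le> a j" "lists_lengths U a"
    and b: "decseq b" "\<And>j. 0 \<le> b j" "lists_lengths U b"
  shows "a = b"
proof
  fix j
  obtain C where C: "bij_betw C {j. a j \<noteq> 0} (components U)" "\<And>j. a j \<noteq> 0 \<Longrightarrow> a j = measure lborel (C j)"
    using a(3) by (auto simp: lists_lengths_def)
  obtain C' where C': "bij_betw C' {j. b j \<noteq> 0} (components U)" "\<And>j. b j \<noteq> 0 \<Longrightarrow> b j = measure lborel (C' j)"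
    using b(3) by (auto simp: lists_lengths_def)
  show "a j = b j"
    using decreasing_enumeration_le[OF finite_large_components a(1) C b(1,2) C']
      decreasing_enumeration_le[OF finite_large_components b(1) C' a(1,2) C]
    by (rule antisym)
qed

text \<open>On a component of length \<open>a j\<close> the function g has the constant value
  \<open>\<phi> (a j)\<close>. Taking a power of \<open>s\<close> for g yields the power sums, and g
  = 1 the total length.\<close>

lemma sums_lengths:
  fixes \<phi> g :: "real \<Rightarrow> real"
  assumes a: "\<And>j. 0 \<le> a j" "lists_lengths U a"
    and g: "g \<in> borel_measurable borel" "\<And>x. \<bar>g x\<bar> \<le> 1"
    and \<phi>: "\<And>x. x \<in> U \<Longrightarrow> g x = \<phi> (measure lborel (connected_component_set U x))"
  shows "(\<lambda>j. a j * \<phi> (a j)) sums (LINT x|unif. indicator U x * g x)" and "summable a"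
    and "suminf a = measure unif U"
proof -
  obtain C where C: "bij_betw C {j. a j \<noteq> 0} (components U)" "\<And>j. a j \<noteq> 0 \<Longrightarrow> a j = measure lborel (C j)"
    using a(2) by (auto simp: lists_lengths_def)
  \<comment> \<open>An index with \<open>a j = 0\<close> lists no component; the empty set fills it,
    so that all naturals index a disjoint family.\<close>
  define C' where "C' j = (if a j \<noteq> 0 then C j else {})" for j
  have comp: "C j \<in> components U" if "a j \<noteq> 0" for j using C(1) that by (auto simp: bij_betw_def)
  have meas: "C' j \<in> sets borel" for j using comp component_props(2) by (auto simp: C'_def)
  have len: "measure unif (C' j) = a j" for j
    using comp[of j] component_props(3) C(2)[of j] by (auto simp: C'_def)
  have disj: "disjoint_family C'"
    unfolding disjoint_family_on_def
  proof (intro ballI impI)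
    fix i j :: nat assume "i \<noteq> j"
    show "C' i \<inter> C' j = {}"
    proof (cases "a i \<noteq> 0 \<and> a j \<noteq> 0")
      case True
      then have "C i \<noteq> C j" using C(1) \<open>i \<noteq> j\<close> by (auto simp: bij_betw_def inj_on_def)
      then have "C i \<inter> C j = {}"
        using components_nonoverlap comp True by blast
      then show ?thesis using True by (simp add: C'_def)
    qed (auto simp: C'_def)
  qed
  have "(\<Union>j. C' j) = \<Union>(C ` {j. a j \<noteq> 0})" by (auto simp: C'_def)
  also have "\<dots> = U" using C(1) Union_components[of U] by (simp add: bij_betw_def)
  finally have Un: "(\<Union>j. C' j) = U" .
  have "(\<lambda>j. measure unif (C' j)) sums measure unif (\<Union>j. C' j)"
    by (rule unif.finite_measure_UNION) (use meas disj in auto)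
  then have a_sums: "a sums measure unif U" unfolding len Un .
  then show "summable a" "suminf a = measure unif U" by (simp_all add: sums_iff)
  have g_eq: "g x = \<phi> (a j)" if "x \<in> C' j" for x j
  proof -
    have aj: "a j \<noteq> 0" "x \<in> C j" using that by (auto simp: C'_def split: if_splits)
    obtain y where y: "C j = connected_component_set U y"
      using comp[OF aj(1)] by (auto simp: components_iff)
    have "x \<in> U" using in_components_subset[OF comp[OF aj(1)]] aj(2) by (rule subsetD)
    moreover have "connected_component_set U x = C j"
      using aj(2) unfolding y by (metis connected_component_eq)
    ultimately show ?thesis using \<phi>[of x] C(2)[OF aj(1)] by simp
  qed
  have int: "(LINT x:C' j|unif. g x) = a j * \<phi> (a j)" for j
  proof -
    have "(LINT x:C' j|unif. g x) = (LINT x|unif. indicator (C' j) x * \<phi> (a j))"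
      unfolding set_lebesgue_integral_def using g_eq
      by (intro Bochner_Integration.integral_cong) (auto simp: indicator_def)
    then show ?thesis using meas[of j] len[of j] by (simp add: measure_def)
  qed
  have "(LINT x:(\<Union>j. C' j)|unif. g x) = suminf (\<lambda>j. LINT x:C' j|unif. g x)"
  proof (rule lebesgue_integral_countable_add)
    show "C' i \<inter> C' j = {}" if "i \<noteq> j" for i j
      using disj that by (auto simp: disjoint_family_on_def)
    have "integrable unif g" by (rule unif.integrable_const_bound[of _ 1]) (use g in auto)
    then have "integrable unif (\<lambda>x. indicator U x *\<^sub>R g x)"
      using U(1) by (intro integrable_mult_indicator) auto
    then show "set_integrable unif (\<Union>j. C' j) g" unfolding Un set_integrable_def .
  qed (use meas in auto)
  then have "suminf (\<lambda>j. a j * \<phi> (a j)) = (LINT x|unif. indicator U x * g x)"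
    unfolding int Un by (simp add: set_lebesgue_integral_def)
  \<comment> \<open>The value of \<open>suminf\<close> does not entail convergence. A nonzero
    \<open>a j\<close> belongs to a nonempty component, where the bound on g carries over to
    \<open>\<phi> (a j)\<close>.\<close>
  moreover have "summable (\<lambda>j. a j * \<phi> (a j))"
  proof (rule summable_comparison_test'[OF \<open>summable a\<close>])
    fix j
    show "norm (a j * \<phi> (a j)) \<le> a j"
    proof (cases "a j = 0")
      case False
      then have "C j \<noteq> {}" using comp in_components_nonempty by blast
      then obtain x where "x \<in> C' j" using False by (auto simp: C'_def)
      then have "\<bar>\<phi> (a j)\<bar> \<le> 1" using g(2)[of x] g_eq by simp
      then show ?thesis using a(1)[of j] by (simp add: abs_mult mult_left_le)
    qed simp
  qed
  ultimately show "(\<lambda>j. a j * \<phi> (a j)) sums (LINT x|unif. indicator U x * g x)"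
    by (simp add: sums_iff)
qed

lemma suminf_lengths:
  assumes "\<And>j. 0 \<le> a j" "lists_lengths U a"
  shows "summable a" "suminf a = measure unif U"
  using sums_lengths(2,3)[OF assms, of "\<lambda>_. 1" "\<lambda>_. 1"] by simp_all

end

text \<open>Resolves the definite description: each set has exactly one decreasing enumeration, and
  disjointness of U and V inside the unit interval bounds the total length by 1.\<close>

lemma rank2_props:
  assumes UV: "(U, V) \<in> U2" and eq: "(\<alpha>, \<beta>) = rank2 (U, V)"
  shows "\<And>j. 0 \<le> \<alpha> j" "\<And>j. 0 \<le> \<beta> j" "lists_lengths U \<alpha>" "lists_lengths V \<beta>"
    "summable \<alpha>" "summable \<beta>" "suminf \<alpha> + suminf \<beta> \<le> 1"
proof -
  interpret unif: prob_space unif by (rule prob_space_unif)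
  have U: "open U" "U \<subseteq> {0<..<1}" and V: "open V" "V \<subseteq> {0<..<1}" and disj: "U \<inter> V = {}"
    using UV by (auto simp: U2_def)
  obtain a where a: "decseq a" "\<And>j. 0 \<le> a j" "lists_lengths U a"
    using ex_lists_lengths[OF U] by blast
  obtain b where b: "decseq b" "\<And>j. 0 \<le> b j" "lists_lengths V b"
    using ex_lists_lengths[OF V] by blast
  have sum_a: "summable a" "suminf a = measure unif U" using suminf_lengths[OF U a(2,3)] by auto
  have sum_b: "summable b" "suminf b = measure unif V" using suminf_lengths[OF V b(2,3)] by auto
  have "measure unif U + measure unif V = measure unif (U \<union> V)"
    using U V disj by (intro unif.finite_measure_Union[symmetric]) auto
  also have "\<dots> \<le> 1" by simp
  finally have le1: "suminf a + suminf b \<le> 1" using sum_a sum_b by simp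
  let ?P = "\<lambda>p. p \<in> Delta2 \<and> lists_lengths U (fst p) \<and> lists_lengths V (snd p)"
  have "(THE p. ?P p) = (a, b)"
  proof (rule the_equality)
    show "?P (a, b)"
      using a b sum_a sum_b le1 suminf_add[OF sum_a(1) sum_b(1)] summable_add[OF sum_a(1) sum_b(1)]
      by (auto simp: Delta2_def)
    fix p assume p: "?P p"
    then have "decseq (fst p)" "\<And>j. 0 \<le> fst p j" "decseq (snd p)" "\<And>j. 0 \<le> snd p j"
      by (auto simp: Delta2_def)
    then have "fst p = a" "snd p = b"
      using lists_lengths_unique[OF U _ _ _ a] lists_lengths_unique[OF V _ _ _ b] p by blast+
    then show "p = (a, b)" by (simp add: prod_eq_iff)
  qed
  then have "\<alpha> = a" "\<beta> = b" using eq by (auto simp: rank2_def)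
  then show "\<And>j. 0 \<le> \<alpha> j" "\<And>j. 0 \<le> \<beta> j" "lists_lengths U \<alpha>" "lists_lengths V \<beta>"
    "summable \<alpha>" "summable \<beta>" "suminf \<alpha> + suminf \<beta> \<le> 1"
    using a b sum_a sum_b le1 by auto
qed

text \<open>If a function vanishes near 0, so does its derivative; passing to the derivative series
  lowers the index of the coefficient. Uniqueness of real power series expansions follows.\<close>

lemma eval_fps_eventually_0:
  fixes f :: "real fps"
  assumes "0 < fps_conv_radius f" "\<forall>\<^sub>F t in nhds 0. eval_fps f t = 0"
  shows "fps_nth f n = 0"
  using assms
proof (induction n arbitrary: f)
  case 0
  then have "eval_fps f 0 = 0" using eventually_nhds_x_imp_x by fast
  then show ?case by (simp add: eval_fps_at_0)
next
  case (Suc n)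
  have "\<forall>\<^sub>F t in nhds 0. \<forall>\<^sub>F u in nhds t. eval_fps f u = 0"
    using Suc.prems(2) by (simp add: eventually_eventually)
  moreover have "\<forall>\<^sub>F t in nhds 0. t \<in> eball 0 (fps_conv_radius f)"
    using Suc.prems(1) by (intro eventually_nhds_in_open) (auto simp: zero_ereal_def)
  ultimately have "\<forall>\<^sub>F t in nhds 0. eval_fps (fps_deriv f) t = 0"
  proof eventually_elim
    case (elim t)
    then have "(eval_fps f has_field_derivative eval_fps (fps_deriv f) t) (at t)"
      by (intro has_field_derivative_eval_fps) simp
    then have "((\<lambda>_. 0) has_field_derivative eval_fps (fps_deriv f) t) (at t)"
      using elim(1) by (subst DERIV_cong_ev[OF refl _ refl, symmetric]) auto
    then show ?case using DERIV_const by (rule DERIV_unique)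
  qed
  moreover have "0 < fps_conv_radius (fps_deriv f)"
    using Suc.prems(1) fps_conv_radius_deriv by (rule less_le_trans)
  ultimately have "fps_nth (fps_deriv f) n = 0" by (intro Suc.IH)
  then show ?case by simp
qed

lemma has_fps_expansion_unique_real:
  fixes f g :: "real fps"
  assumes "h has_fps_expansion f" "h has_fps_expansion g"
  shows "f = g"
proof (rule fps_ext)
  fix n
  have *: "(\<lambda>t. h t - h t) has_fps_expansion (f - g)"
    using assms by (rule has_fps_expansion_diff)
  have "fps_nth (f - g) n = 0"
    by (rule eval_fps_eventually_0) (use * in \<open>simp_all add: has_fps_expansion_def\<close>)
  then show "fps_nth f n = fps_nth g n" by simp
qed

section \<open>The functional on symmetric functions\<close>

lemma fundamental_qsym_QSym: "fundamental_qsym \<nu> \<in> QSym"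
  unfolding fundamental_qsym_eq by (rule subspace_series_sum[OF subspace_QSym monomial_qsym_QSym])

lemma linear_functional_on_restrict:
  assumes "subspace_series A" "linear_functional_on A f"
  shows "linear_functional_on A (restrict f A)"
  unfolding linear_functional_on_def
  using subspace_series_add[OF assms(1)] subspace_series_scale[OF assms(1)]
    linear_functional_on_add[OF assms(2)] linear_functional_on_scale[OF assms(2)]
  by simp

context open_pair
begin

lemma s_in_U:
  assumes "x \<in> U"
  shows "s x = measure lborel (connected_component_set U x)"
proof -
  have c: "connected_component_set U x \<in> components U"
    using assms by (auto simp: components_iff)
  have "x \<notin> V" using assms disjoint by blast
  then have "\<not> sv x y" for y using connected_component_in(1)[of V x y] by blast
  then have *: "B x y = indicator (connected_component_set U x) y" for y
    by (simp add: B_def indicator_def)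
  have "s x = (LINT y|unif. indicator (connected_component_set U x) y)"
    unfolding s_def by (intro Bochner_Integration.integral_cong refl *)
  then show ?thesis
    using component_props(2,3)[OF open_U U_subset c] by simp
qed

lemma s_in_V:
  assumes "x \<in> V"
  shows "s x = - measure lborel (connected_component_set V x)"
proof -
  have c: "connected_component_set V x \<in> components V"
    using assms by (auto simp: components_iff)
  have "x \<notin> U" using assms disjoint by blast
  then have "\<not> su x y" for y using connected_component_in(1)[of U x y] by blast
  then have *: "B x y = - indicator (connected_component_set V x) y" for y
    by (simp add: B_def indicator_def)
  have "s x = (LINT y|unif. - indicator (connected_component_set V x) y)"
    unfolding s_def by (intro Bochner_Integration.integral_cong refl *)
  then show ?thesis
    using component_props(2,3)[OF open_V V_subset c] by simp
qed

lemma s_outside: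
  assumes "x \<notin> U" "x \<notin> V"
  shows "s x = 0"
proof -
  have "\<not> su x y" "\<not> sv x y" for y
    using assms connected_component_in(1)[of U x y] connected_component_in(1)[of V x y] by blast+
  then show ?thesis by (simp add: s_def B_def)
qed

text \<open>A component of V of length b contributes \<open>b * (- b) ^ (k - 1)\<close>, which is
  \<open>- ((- b) ^ k)\<close>; this is the origin of the minus sign.\<close>

lemma \<Phi>_power_sum:
  assumes k: "2 \<le> k" and \<alpha>: "\<And>j. 0 \<le> \<alpha> j" "lists_lengths U \<alpha>"
    and \<beta>: "\<And>j. 0 \<le> \<beta> j" "lists_lengths V \<beta>"
  shows "\<Phi> [k] (- 1) = suminf (\<lambda>j. \<alpha> j ^ k - (- \<beta> j) ^ k)"
proof -
  let ?g = "\<lambda>x. s x ^ (k - 1)"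
  have g: "?g \<in> borel_measurable borel" by measurable
  have k': "x * x ^ (k - 1) = x ^ k" for x :: real using k by (cases k) simp_all
  have "(\<lambda>j. \<alpha> j * \<alpha> j ^ (k - 1)) sums (LINT x|unif. indicator U x * ?g x)"
    by (rule sums_lengths(1)[OF open_U U_subset \<alpha> g abs_s_power_le]) (simp add: s_in_U)
  then have 1: "(\<lambda>j. \<alpha> j ^ k) sums (LINT x|unif. indicator U x * ?g x)" by (simp only: k')
  have "(\<lambda>j. \<beta> j * (- \<beta> j) ^ (k - 1)) sums (LINT x|unif. indicator V x * ?g x)"
    by (rule sums_lengths(1)[OF open_V V_subset \<beta> g abs_s_power_le]) (simp add: s_in_V)
  moreover have "\<beta> j * (- \<beta> j) ^ (k - 1) = - ((- \<beta> j) ^ k)" for j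
    using k'[of "- \<beta> j"] by simp
  ultimately have 2: "(\<lambda>j. - ((- \<beta> j) ^ k)) sums (LINT x|unif. indicator V x * ?g x)" by simp
  have int: "integrable unif (\<lambda>x. indicator S x * ?g x)" if "open S" for S :: "real set"
  proof (rule integrable_unif[of _ 1])
    show "(\<lambda>x. indicator S x * ?g x) \<in> borel_measurable borel"
      by (rule borel_measurable_times[OF borel_measurable_indicator[OF borel_open[OF that]] g])
    show "\<bar>indicator S x * ?g x\<bar> \<le> 1" for x
      by (rule abs_mult_le_1[OF _ abs_s_power_le]) (simp add: indicator_def)
  qed
  have "?g x = indicator U x * ?g x + indicator V x * ?g x" for x
  proof (cases "x \<in> U \<or> x \<in> V")
    case True
    then show ?thesis using disjoint by (auto simp: indicator_def)
  next
    case False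
    then have "s x = 0" using s_outside by blast
    \<comment> \<open>For k = 1 the power \<open>0 ^ 0 = 1\<close> would add the measure of the
      complement of U and V in [0,1], that is \<gamma>.\<close>
    then show ?thesis using k by (simp add: power_0_left)
  qed
  then have "(LINT x|unif. ?g x) = (LINT x|unif. indicator U x * ?g x + indicator V x * ?g x)"
    by (simp only:)
  also have "\<dots> = (LINT x|unif. indicator U x * ?g x) + (LINT x|unif. indicator V x * ?g x)"
    by (rule Bochner_Integration.integral_add[OF int[OF open_U] int[OF open_V]])
  also have "\<dots> = suminf (\<lambda>j. \<alpha> j ^ k + - ((- \<beta> j) ^ k))"
    using sums_add[OF 1 2] by (simp add: sums_iff)
  finally show ?thesis unfolding \<Phi>_start by simp
qed

lemma \<Phi>_power_sum_1: "\<Phi> [1] (- 1) = 1"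
  unfolding \<Phi>_start by (simp add: unif.prob_space)

abbreviation \<psi> :: "series \<Rightarrow> real" where "\<psi> \<equiv> qsym_functional (\<lambda>\<nu>. \<Phi> \<nu> (- 1))"

lemma algebra_hom_\<psi>: "algebra_hom_on Sym \<psi>"
  by (rule algebra_hom_qsym_functional) (simp, rule \<Phi>_qshuffle)

lemma \<psi>_fundamental:
  assumes "distinct w"
  shows "\<psi> (fundamental_qsym (zs w)) = perm_prob U V w"
proof -
  have "(\<Sum>\<mu>\<in>refinements (zs w). \<psi> (monomial_qsym \<mu>)) = (\<Sum>\<mu>\<in>refinements (zs w). \<Phi> \<mu> (- 1))"
    by (rule sum.cong[OF refl], rule qsym_functional_monomial) (simp add: refinements_def)
  then show ?thesis
    unfolding linear_functional_fundamental[OF linear_qsym_functional] perm_prob_eq[OF assms] .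
qed

text \<open>For uniqueness, every composition is \<open>zs\<close> of a word, so all values on F are
  prescribed and fix the functional on QSym; outside, extensionality fixes it.\<close>

lemma psi_open_eq: "psi_open (U, V) = restrict \<psi> QSym"
  unfolding psi_open_def prod.case
proof (rule the_equality)
  show "restrict \<psi> QSym \<in> extensional QSym \<and> linear_functional_on QSym (restrict \<psi> QSym) \<and>
    (\<forall>n. \<forall>w\<in>permutations_of_set {1..n}. restrict \<psi> QSym (fundamental_qsym (zs w)) = perm_prob U V w)"
    using linear_functional_on_restrict[OF subspace_QSym linear_qsym_functional]
    by (simp add: fundamental_qsym_QSym \<psi>_fundamental permutations_of_set_def)
  fix \<psi>' assume \<psi>': "\<psi>' \<in> extensional QSym \<and> linear_functional_on QSym \<psi>' \<and>
    (\<forall>n. \<forall>w\<in>permutations_of_set {1..n}. \<psi>' (fundamental_qsym (zs w)) = perm_prob U V w)"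
  have "\<psi>' f = \<psi> f" if "f \<in> QSym" for f
  proof (rule linear_functional_QSym_eqI[OF _ linear_qsym_functional _ that])
    fix \<nu> assume "composition \<nu>"
    then obtain w where w: "w \<in> permutations_of_set {1..sum_list \<nu>}" "zs w = \<nu>"
      using ex_permutation_zs by blast
    then show "\<psi>' (fundamental_qsym \<nu>) = \<psi> (fundamental_qsym \<nu>)"
      using \<psi>' \<psi>_fundamental[of w] by (auto simp: permutations_of_set_def)
  qed (use \<psi>' in blast)
  then show "\<psi>' = restrict \<psi> QSym"
    using \<psi>' by (intro extensionalityI[of _ QSym]) auto
qed

lemma restrict_psi_open: "restrict (psi_open (U, V)) Sym = restrict \<psi> Sym"
  unfolding psi_open_eq using Sym_subset_QSym by (simp add: inf.absorb2)

text \<open>For uniqueness, the expansion fixes the values at all h_n, and these fix an algebra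
  homomorphism on Sym.\<close>

lemma \<psi>_eq_psi_seq:
  assumes \<alpha>: "\<And>j. 0 \<le> \<alpha> j" "lists_lengths U \<alpha>" "summable \<alpha>"
    and \<beta>: "\<And>j. 0 \<le> \<beta> j" "lists_lengths V \<beta>" "summable \<beta>"
    and le1: "suminf \<alpha> + suminf \<beta> \<le> 1"
  shows "psi_seq (\<alpha>, \<beta>) = restrict \<psi> Sym"
  unfolding psi_seq_def prod.case
proof (rule the_equality)
  let ?G = "\<lambda>t. exp ((1 - suminf \<alpha> - suminf \<beta>) * t) *
    prodinf (\<lambda>j. 1 + \<beta> j * t) / prodinf (\<lambda>i. 1 - \<alpha> i * t)"
  let ?\<psi> = "restrict \<psi> Sym"
  have one: "\<psi> series_one = 1" and lin: "linear_functional_on Sym \<psi>"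
    and mult: "\<And>f g. f \<in> Sym \<Longrightarrow> g \<in> Sym \<Longrightarrow> \<psi> (series_mult f g) = \<psi> f * \<psi> g"
    using algebra_hom_\<psi> unfolding algebra_hom_on_def by blast+
  have hom: "algebra_hom_on Sym ?\<psi>"
    unfolding algebra_hom_on_def
    using linear_functional_on_restrict[OF subspace_Sym lin] one mult Sym_series_one Sym_series_mult by simp
  have "?G has_fps_expansion Abs_fps (\<lambda>n. \<psi> (complete_sym n))"
  proof (rule generating_function[OF \<alpha>(1,3) \<beta>(1,3) le1])
    show "\<psi> (complete_sym 0) = 1" by (simp add: complete_sym_0 one)
    show "real n * \<psi> (complete_sym n) = (\<Sum>k\<in>{1..n}. \<Phi> [k] (- 1) * \<psi> (complete_sym (n - k)))" for n
      unfolding algebra_hom_newton[OF algebra_hom_\<psi>]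
      by (rule sum.cong[OF refl], subst qsym_functional_monomial) auto
    show "\<Phi> [1] (- 1) = 1" by (rule \<Phi>_power_sum_1)
    show "\<Phi> [k] (- 1) = suminf (\<lambda>j. \<alpha> j ^ k - (- \<beta> j) ^ k)" if "2 \<le> k" for k
      by (rule \<Phi>_power_sum[OF that \<alpha>(1,2) \<beta>(1,2)])
  qed
  then have expansion: "?G has_fps_expansion Abs_fps (\<lambda>n. ?\<psi> (complete_sym n))"
    by (simp add: Sym_complete_sym)
  show "?\<psi> \<in> extensional Sym \<and> algebra_hom_on Sym ?\<psi> \<and>
      ?G has_fps_expansion Abs_fps (\<lambda>n. ?\<psi> (complete_sym n))"
    using hom expansion by simp
  fix \<psi>' assume \<psi>': "\<psi>' \<in> extensional Sym \<and> algebra_hom_on Sym \<psi>' \<and>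
      ?G has_fps_expansion Abs_fps (\<lambda>n. \<psi>' (complete_sym n))"
  have "Abs_fps (\<lambda>n. \<psi>' (complete_sym n)) = Abs_fps (\<lambda>n. ?\<psi> (complete_sym n))"
    using \<psi>'[THEN conjunct2, THEN conjunct2] expansion by (rule has_fps_expansion_unique_real)
  then have "\<psi>' (complete_sym n) = ?\<psi> (complete_sym n)" for n
    by (metis fps_nth_Abs_fps)
  then have "\<psi>' f = ?\<psi> f" if "f \<in> Sym" for f
    by (rule algebra_hom_Sym_eqI[OF \<psi>'[THEN conjunct2, THEN conjunct1] hom _ that])
  then show "\<psi>' = ?\<psi>"
    using \<psi>' by (intro extensionalityI[of _ Sym]) auto
qed

end

theorem corollary32:
  fixes U_up U_down :: "real set" and \<alpha> \<beta> :: "nat \<Rightarrow> real"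
  assumes "(U_up, U_down) \<in> U2"
    and "(\<alpha>, \<beta>) = rank2 (U_up, U_down)"
  shows "restrict (psi_open (U_up, U_down)) Sym = psi_seq (\<alpha>, \<beta>)"
proof -
  interpret open_pair U_up U_down
    using assms(1) by unfold_locales (auto simp: U2_def)
  note rank = rank2_props[OF assms]
  show ?thesis
    unfolding restrict_psi_open \<psi>_eq_psi_seq[OF rank(1,3,5,2,4,6,7)] ..
qed

end
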